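(* Let $\alpha\in(0,1)$, let $\Omega\subset\mathbb R^d$ be a bounded Lipschitz domain, let $f\in L^\infty([0,\infty);L^2(\Omega))\cap BV([0,\infty);L^2(\Omega))$ be of bounded variation in time, and let $u^0\in H_0^1(\Omega)$. Let $0=t_0<t_1<t_2<\cdots$ be a mesh with steps $\tau_k=t_k-t_{k-1}$ and ratios $\rho_k=\tau_k/\tau_{k-1}$ satisfying, with the constants $\rho_*,\rho^*,\xi_1,\xi_2$ of the context, $$\rho_*<\rho_2,\qquad \rho_*<\rho_3<\rho^*,\qquad 2+\frac{2}{1+\rho_3}+\frac{4\rho_2}{1+\rho_2}-\frac{\rho_2^3}{(1+\rho_2)^2}\ge0,\qquad \frac1{\rho_3}\ge\frac{1}{\rho_2^2(1+\rho_2)}-3,$$ and for every $k\ge3$ $$\begin{cases}\rho_*<\rho_{k+1}\le\dfrac{\rho_k^2(1+\rho_k)}{1-3\rho_k^2(1+\rho_k)}, & \text{if }\rho_*<\rho_k<\xi_1,\\[2mm] \rho_*<\rho_{k+1}<\rho^*, & \text{if }\xi_1\le\rho_k\le\xi_2,\\[1mm] \rho_*<\rho_{k+1}\le\dfrac{-\rho_k^2+4\rho_k+2}{\rho_k^2-3\rho_k-1}, & \text{if }\xi_2<\rho_k<\rho^*\end{cases}$$ (or simply $\rho_k\in[\rho_{\rm L},\rho_{\rm R}]$ for all $k\ge2$). Let $u^k$, $k\ge1$, be the solution of the L2 scheme $$L_k^\alpha u=\Delta u^k+f^k\ \text{ in }\Omega,\qquad u^k=0\ \text{ on }\partial\Omega,\qquad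 f^k=f(t_k,\cdot),$$ started from $u^0$. Then for all $n\ge1$ $$\|\nabla u^n\|_{L^2(\Omega)}\le\|\nabla u^0\|_{L^2(\Omega)}+2C_fC_\Omega,$$ where $C_f$ is a constant depending only on $f$ and $C_\Omega$ is the Sobolev embedding constant, depending only on $\Omega$ and $d$, in $\|v\|_{L^2(\Omega)}\le C_\Omega\|\nabla v\|_{L^2(\Omega)}$ for $v\in H_0^1(\Omega)$.
   Context: The scheme discretizes the subdiffusion equation $\partial_t^\alpha u=\Delta u+f$ in $(0,\infty)\times\Omega$, $u=0$ on $(0,\infty)\times\partial\Omega$, $u(0,\cdot)=u^0$, with Caputo derivative $\partial_t^\alpha$. The scheme is understood weakly: $u^k\in H_0^1(\Omega)$ and $\langle L_k^\alpha u,v\rangle=-\langle\nabla u^k,\nabla v\rangle+\langle f^k,v\rangle$ for all $v\in H_0^1(\Omega)$, with $\langle\cdot,\cdot\rangle$ the $L^2(\Omega)$ inner product. The function $f$ is taken as defined at every $t$, with $\|f(t)\|_{L^2(\Omega)}$ bounded uniformly in $t$ and with finite total variation $\sup\sum_i\|f(s_i)-f(s_{i-1})\|_{L^2(\Omega)}$ over finite increasing sequences $(s_i)$ in $[0,\infty)$. L2 operator: for $j\ge1$ let $H_2^j$ be the quadratic Lagrange polynomial in $t$ interpolating $u^{j-1},u^j,u^{j+1}$ at $t_{j-1},t_j,t_{j+1}$. Then $$L_1^\alpha u=\frac{u^1-u^0}{\Gamma(2-\alpha)\tau_1^\alpha},\qquad L_k^\alpha u=\frac1{\Gamma(1-\alpha)}\left(\sum_{j=1}^{k-1}\int_{t_{j-1}}^{t_j}\frac{\partial_sH_2^j(s)}{(t_k-s)^\alpha}ds+\int_{t_{k-1}}^{t_k}\frac{\partial_sH_2^{k-1}(s)}{(t_k-s)^\alpha}ds\right),\quad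 k\ge2.$$ Constants: $\rho_*\approx0.356341$ is the positive root of $\rho(1+\rho)=1-3\rho^2(1+\rho)$; $$\rho^*=\frac12\left[\frac{4+3\rho_*}{1+\rho_*}+\sqrt{\Big(\frac{4+3\rho_*}{1+\rho_*}\Big)^2+4\,\frac{2+\rho_*}{1+\rho_*}}\right]\approx4.155358;$$ $\xi_1\approx0.459770$ is the positive root of $\frac{\rho^2(1+\rho)}{1-3\rho^2(1+\rho)}=\rho^*$; $\xi_2\approx3.532016$ is the positive root of $\frac{-\rho^2+4\rho+2}{\rho^2-3\rho-1}=\rho^*$; $\rho_{\rm R}=\frac{3+\sqrt{17}}2\approx3.561553$; $\rho_{\rm L}\approx0.457333$ is the positive root of $\frac{\rho^2(1+\rho)}{1-3\rho^2(1+\rho)}=\rho_{\rm R}$. *)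

theory Defs
  imports "HOL-Analysis.Analysis"
begin

text \<open>Elements of Lebesgue and Sobolev spaces over \<open>\<Omega>\<close> are represented by functions on the whole
  space; only their values on \<open>\<Omega>\<close>, up to null sets, enter the definitions below.\<close>

definition square_integrable_on :: "('a::euclidean_space \<Rightarrow> 'b::euclidean_space) \<Rightarrow> 'a set \<Rightarrow> bool"
  (infixr "square'_integrable'_on" 46) where
  "v square_integrable_on \<Omega> \<longleftrightarrow>
     v \<in> borel_measurable (lebesgue_on \<Omega>) \<and> integrable (lebesgue_on \<Omega>) (\<lambda>x. (norm (v x))\<^sup>2)"

definition L2_inner ::
    "'a::euclidean_space set \<Rightarrow> ('a \<Rightarrow> 'b::euclidean_space) \<Rightarrow> ('a \<Rightarrow> 'b) \<Rightarrow> real" where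
  "L2_inner \<Omega> v w = (\<integral>x. v x \<bullet> w x \<partial>lebesgue_on \<Omega>)"

definition L2_norm :: "'a::euclidean_space set \<Rightarrow> ('a \<Rightarrow> 'b::euclidean_space) \<Rightarrow> real" where
  "L2_norm \<Omega> v = sqrt (\<integral>x. (norm (v x))\<^sup>2 \<partial>lebesgue_on \<Omega>)"

primrec Ck :: "nat \<Rightarrow> ('a::euclidean_space \<Rightarrow> real) \<Rightarrow> bool" where
  "Ck 0 \<phi> \<longleftrightarrow> continuous_on UNIV \<phi>"
| "Ck (Suc k) \<phi> \<longleftrightarrow> (\<forall>x. \<phi> differentiable (at x)) \<and>
     (\<forall>i\<in>Basis. Ck k (\<lambda>x. frechet_derivative \<phi> (at x) i))"

text \<open>The space \<open>C\<^sub>c\<^sup>\<infinity>(\<Omega>)\<close>, its members being extended by zero.\<close>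

definition test_functions :: "'a::euclidean_space set \<Rightarrow> ('a \<Rightarrow> real) set" where
  "test_functions \<Omega> =
     {\<phi>. (\<forall>k. Ck k \<phi>) \<and> compact (closure {x. \<phi> x \<noteq> 0}) \<and> closure {x. \<phi> x \<noteq> 0} \<subseteq> \<Omega>}"

definition gradient :: "('a::euclidean_space \<Rightarrow> real) \<Rightarrow> 'a \<Rightarrow> 'a" where
  "gradient \<phi> x = (\<Sum>i\<in>Basis. frechet_derivative \<phi> (at x) i *\<^sub>R i)"

definition has_weak_gradient ::
    "'a::euclidean_space set \<Rightarrow> ('a \<Rightarrow> real) \<Rightarrow> ('a \<Rightarrow> 'a) \<Rightarrow> bool" where
  "has_weak_gradient \<Omega> v g \<longleftrightarrow> v square_integrable_on \<Omega> \<and> g square_integrable_on \<Omega> \<and>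
     (\<forall>\<phi>\<in>test_functions \<Omega>.
        (\<integral>x. v x *\<^sub>R gradient \<phi> x \<partial>lebesgue_on \<Omega>) = - (\<integral>x. \<phi> x *\<^sub>R g x \<partial>lebesgue_on \<Omega>))"

text \<open>For open \<open>\<Omega>\<close> a weak gradient is unique up to a null set, so the choice is immaterial.\<close>

definition weak_gradient :: "'a::euclidean_space set \<Rightarrow> ('a \<Rightarrow> real) \<Rightarrow> 'a \<Rightarrow> 'a" where
  "weak_gradient \<Omega> v = (SOME g. has_weak_gradient \<Omega> v g)"

definition H1 :: "'a::euclidean_space set \<Rightarrow> ('a \<Rightarrow> real) set" where
  "H1 \<Omega> = {v. \<exists>g. has_weak_gradient \<Omega> v g}"

definition H1_norm :: "'a::euclidean_space set \<Rightarrow> ('a \<Rightarrow> real) \<Rightarrow> real" where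
  "H1_norm \<Omega> v = sqrt ((L2_norm \<Omega> v)\<^sup>2 + (L2_norm \<Omega> (weak_gradient \<Omega> v))\<^sup>2)"

definition H10 :: "'a::euclidean_space set \<Rightarrow> ('a \<Rightarrow> real) set" where
  "H10 \<Omega> = {v \<in> H1 \<Omega>. \<forall>\<epsilon>>0. \<exists>\<phi>\<in>test_functions \<Omega>. H1_norm \<Omega> (\<lambda>x. v x - \<phi> x) < \<epsilon>}"

definition sobolev_embedding_constant :: "'a::euclidean_space set \<Rightarrow> real \<Rightarrow> bool" where
  "sobolev_embedding_constant \<Omega> C \<longleftrightarrow>
     0 \<le> C \<and> (\<forall>v\<in>H10 \<Omega>. L2_norm \<Omega> v \<le> C * L2_norm \<Omega> (weak_gradient \<Omega> v))"

text \<open>Near each boundary point, \<open>\<Omega>\<close> is the part above a Lipschitz graph over the hyperplane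
  orthogonal to a unit vector \<open>e\<close>; \<open>x - (x \<bullet> e) *\<^sub>R e\<close> is the projection of \<open>x\<close> to that hyperplane.\<close>

definition lipschitz_domain :: "'a::euclidean_space set \<Rightarrow> bool" where
  "lipschitz_domain \<Omega> \<longleftrightarrow> open \<Omega> \<and> connected \<Omega> \<and> \<Omega> \<noteq> {} \<and>
     (\<forall>p\<in>frontier \<Omega>. \<exists>r>0. \<exists>e. \<exists>\<gamma>. \<exists>L. norm e = 1 \<and> L-lipschitz_on {y. y \<bullet> e = 0} \<gamma> \<and>
        \<Omega> \<inter> ball p r = {x \<in> ball p r. \<gamma> (x - (x \<bullet> e) *\<^sub>R e) < x \<bullet> e})"

definition L2_bounded :: "'a::euclidean_space set \<Rightarrow> (real \<Rightarrow> 'a \<Rightarrow> real) \<Rightarrow> bool" where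
  "L2_bounded \<Omega> f \<longleftrightarrow> (\<forall>t\<ge>0. f t square_integrable_on \<Omega>) \<and> bdd_above ((\<lambda>t. L2_norm \<Omega> (f t)) ` {0..})"

text \<open>Measurability in time is not required separately, being a consequence of bounded
  variation.\<close>

definition L2_bounded_variation :: "'a::euclidean_space set \<Rightarrow> (real \<Rightarrow> 'a \<Rightarrow> real) \<Rightarrow> bool" where
  "L2_bounded_variation \<Omega> f \<longleftrightarrow>
     bdd_above {\<Sum>i=1..m. L2_norm \<Omega> (\<lambda>x. f (s i) x - f (s (i - 1)) x) | (m::nat) (s::nat \<Rightarrow> real).
       0 \<le> s 0 \<and> (\<forall>i<m. s i < s (Suc i))}"

definition mesh :: "(nat \<Rightarrow> real) \<Rightarrow> bool" where
  "mesh t \<longleftrightarrow> t 0 = 0 \<and> strict_mono t"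

definition step :: "(nat \<Rightarrow> real) \<Rightarrow> nat \<Rightarrow> real" where
  "step t k = t k - t (k - 1)"

definition step_ratio :: "(nat \<Rightarrow> real) \<Rightarrow> nat \<Rightarrow> real" where
  "step_ratio t k = step t k / step t (k - 1)"

text \<open>The quadratic Lagrange polynomial through \<open>(t\<^sub>i, w\<^sub>i)\<close> for \<open>i = j - 1, j, j + 1\<close>, where
  \<open>j \<ge> 1\<close>.\<close>

definition H2 :: "(nat \<Rightarrow> real) \<Rightarrow> (nat \<Rightarrow> real) \<Rightarrow> nat \<Rightarrow> real \<Rightarrow> real" where
  "H2 t w j s =
     w (j - 1) * (((s - t j) * (s - t (j + 1))) / ((t (j - 1) - t j) * (t (j - 1) - t (j + 1))))
   + w j * (((s - t (j - 1)) * (s - t (j + 1))) / ((t j - t (j - 1)) * (t j - t (j + 1))))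
   + w (j + 1) * (((s - t (j - 1)) * (s - t j)) / ((t (j + 1) - t (j - 1)) * (t (j + 1) - t j)))"

text \<open>The discrete Caputo derivative of order \<open>\<alpha>\<close> of a real sequence, meant for \<open>k \<ge> 1\<close>. It is
  applied below to the values of \<open>u\<close> at each point of \<open>\<Omega>\<close>.\<close>

definition L2_op :: "real \<Rightarrow> (nat \<Rightarrow> real) \<Rightarrow> (nat \<Rightarrow> real) \<Rightarrow> nat \<Rightarrow> real" where
  "L2_op \<alpha> t w k =
     (if k = 1 then (w 1 - w 0) / (Gamma (2 - \<alpha>) * step t 1 powr \<alpha>)
      else 1 / Gamma (1 - \<alpha>) *
        ((\<Sum>j=1..k-1. integral {t (j - 1)..t j} (\<lambda>s. deriv (H2 t w j) s / (t k - s) powr \<alpha>))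
         + integral {t (k - 1)..t k} (\<lambda>s. deriv (H2 t w (k - 1)) s / (t k - s) powr \<alpha>)))"

definition L2_scheme_solution ::
    "real \<Rightarrow> 'a::euclidean_space set \<Rightarrow> (real \<Rightarrow> 'a \<Rightarrow> real) \<Rightarrow> (nat \<Rightarrow> real) \<Rightarrow> (nat \<Rightarrow> 'a \<Rightarrow> real) \<Rightarrow> bool"
  where
  "L2_scheme_solution \<alpha> \<Omega> f t u \<longleftrightarrow>
     (\<forall>k\<ge>1. u k \<in> H10 \<Omega> \<and>
        (\<forall>v\<in>H10 \<Omega>. L2_inner \<Omega> (\<lambda>x. L2_op \<alpha> t (\<lambda>i. u i x) k) v =
           - L2_inner \<Omega> (weak_gradient \<Omega> (u k)) (weak_gradient \<Omega> v) + L2_inner \<Omega> (f (t k)) v))"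

text \<open>Each equation below has exactly one positive root. A zero of a denominator is never a
  spurious solution, since the right-hand side is nonzero.\<close>

definition rho_lower :: real where
  "rho_lower = (THE \<rho>. 0 < \<rho> \<and> \<rho> * (1 + \<rho>) = 1 - 3 * \<rho>\<^sup>2 * (1 + \<rho>))"

definition rho_upper :: real where
  "rho_upper = 1 / 2 * ((4 + 3 * rho_lower) / (1 + rho_lower)
     + sqrt (((4 + 3 * rho_lower) / (1 + rho_lower))\<^sup>2 + 4 * ((2 + rho_lower) / (1 + rho_lower))))"

definition xi1 :: real where
  "xi1 = (THE \<rho>. 0 < \<rho> \<and> \<rho>\<^sup>2 * (1 + \<rho>) / (1 - 3 * \<rho>\<^sup>2 * (1 + \<rho>)) = rho_upper)"

definition xi2 :: real where
  "xi2 = (THE \<rho>. 0 < \<rho> \<and> (- \<rho>\<^sup>2 + 4 * \<rho> + 2) / (\<rho>\<^sup>2 - 3 * \<rho> - 1) = rho_upper)"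

definition rho_R :: real where
  "rho_R = (3 + sqrt 17) / 2"

definition rho_L :: real where
  "rho_L = (THE \<rho>. 0 < \<rho> \<and> \<rho>\<^sup>2 * (1 + \<rho>) / (1 - 3 * \<rho>\<^sup>2 * (1 + \<rho>)) = rho_R)"

definition mesh_ratio_condition :: "(nat \<Rightarrow> real) \<Rightarrow> bool" where
  "mesh_ratio_condition \<rho> \<longleftrightarrow>
     rho_lower < \<rho> 2 \<and> rho_lower < \<rho> 3 \<and> \<rho> 3 < rho_upper \<and>
     2 + 2 / (1 + \<rho> 3) + 4 * \<rho> 2 / (1 + \<rho> 2) - (\<rho> 2) ^ 3 / (1 + \<rho> 2)\<^sup>2 \<ge> 0 \<and>
     1 / \<rho> 3 \<ge> 1 / ((\<rho> 2)\<^sup>2 * (1 + \<rho> 2)) - 3 \<and>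
     (\<forall>k\<ge>3.
        (rho_lower < \<rho> k \<and> \<rho> k < xi1 \<longrightarrow>
           rho_lower < \<rho> (k + 1) \<and>
           \<rho> (k + 1) \<le> (\<rho> k)\<^sup>2 * (1 + \<rho> k) / (1 - 3 * (\<rho> k)\<^sup>2 * (1 + \<rho> k))) \<and>
        (xi1 \<le> \<rho> k \<and> \<rho> k \<le> xi2 \<longrightarrow>
           rho_lower < \<rho> (k + 1) \<and> \<rho> (k + 1) < rho_upper) \<and>
        (xi2 < \<rho> k \<and> \<rho> k < rho_upper \<longrightarrow>
           rho_lower < \<rho> (k + 1) \<and>
           \<rho> (k + 1) \<le> (- (\<rho> k)\<^sup>2 + 4 * \<rho> k + 2) / ((\<rho> k)\<^sup>2 - 3 * \<rho> k - 1)))"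

definition simple_mesh_ratio_condition :: "(nat \<Rightarrow> real) \<Rightarrow> bool" where
  "simple_mesh_ratio_condition \<rho> \<longleftrightarrow> (\<forall>k\<ge>2. \<rho> k \<in> {rho_L..rho_R})"

end

theory Submission
  imports Defs
begin

text \<open>Write \<open>d k = u k - u (k - 1)\<close>. Testing the scheme with \<open>d k\<close> and summing over \<open>k\<close>, the gradient terms
  telescope and a summation by parts in time leaves \<open>2 C\<^sub>f C\<^sub>\<Omega> max \<parallel>\<nabla>u\<parallel>\<close> on the right, so everything rests on
  \<open>\<Sum>\<^sub>k (L2_op u)\<^sub>k d\<^sub>k \<ge> 0\<close>, pointwise in \<open>\<Omega>\<close>. The L2 operator is a lower triangular matrix acting on the
  increments. Its entries are integrals of the kernel \<open>(t\<^sub>k - s)\<^sup>-\<^sup>\<alpha>\<close> against fixed signed weights, up to corrections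
  on the diagonal and the subdiagonal. The Abel transform writes the first part as a combination of squares of
  sums of consecutive increments, and the coefficients off the diagonal are nonnegative because the kernel
  differences are increasing and convex and because of the lower bound on the ratios. The remaining tridiagonal form is
  diagonally dominant because of the upper bound on the ratios, except for its leading 2x2 block, whose determinant
  has to be estimated.\<close>

section \<open>Quadratic forms\<close>

text \<open>The functionals \<open>cell_weight t j\<close> are the same in all rows: row
  \<open>k\<close> merely applies them to \<open>kernel k\<close>. Differences within a row and
  mixed differences between rows therefore come from one inequality for nonnegative, increasing,
  convex functions, applied once to \<open>kernel k\<close> and once to
  \<open>kernel_increment k\<close>. The price is that row \<open>k\<close> is written as if its
  last cell carried the interpolant reaching to \<open>t (Suc k)\<close>; undoing this, and
  inserting the interpolant really used there, produces the corrections.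

  With \<beta> = 1 - \<alpha>, the determinant inequality for the leading block degenerates at
  \<beta> = 0 to the very assumption on the first two ratios, without any slack. The numerical
  bounds must hence be exact at \<beta> = 0 and fine enough to first order in \<beta>, which
  explains the rational constants.

  \<open>weak_gradient\<close> is a choice, so even its additivity needs uniqueness almost
  everywhere. This is why smooth bumps are constructed and the fundamental lemma of the calculus of
  variations is proved.\<close>

lemma sum_square_increments:
  fixes d :: "nat \<Rightarrow> real"
  assumes "1 \<le> a" "a \<le> k"
  shows "2 * d k * sum d {a..k} = (sum d {a..k})\<^sup>2 - (sum d {a..k-1})\<^sup>2 + (d k)\<^sup>2"
proof -
  have "sum d {a..k} = sum d {a..k-1} + d k"
    using assms by (cases k) (auto simp: sum.nat_ivl_Suc')
  then show ?thesis by (simp add: power2_eq_square algebra_simps)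
qed

text \<open>Summation by parts inside row \<open>k\<close> turns the entries into their differences
  and the increments into the tail sums \<open>sum d {i..k}\<close>. Multiplied by
  \<open>2 * d k\<close>, each tail sum becomes a difference of two squares plus
  \<open>(d k)\<^sup>2\<close>; the latter carry the total coefficient \<open>a k k\<close>, which
  is why \<open>a k k * d k\<close> is subtracted once. Regrouping over \<open>k\<close> then moves
  the difference of squares onto the coefficients.\<close>

lemma quadratic_form_abel:
  fixes a :: "nat \<Rightarrow> nat \<Rightarrow> real" and d :: "nat \<Rightarrow> real"
  assumes a0: "\<And>k. a k 0 = 0"
  shows "(\<Sum>k=1..n. d k * (2 * (\<Sum>j=1..k. a k j * d j) - a k k * d k)) =
    (\<Sum>i=1..n. (a n i - a n (i - 1)) * (sum d {i..n})\<^sup>2)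
    + (\<Sum>k=1..<n. \<Sum>i=1..k. ((a k i - a k (i - 1)) - (a (Suc k) i - a (Suc k) (i - 1))) * (sum d {i..k})\<^sup>2)"
proof -
  define v where "v k i = a k i - a k (i - 1)" for k i
  have v_sum: "(\<Sum>i=1..j. v k i) = a k j" for k j
    by (induction j) (auto simp: v_def a0)
  have row: "(\<Sum>j=1..m. a k j * d j) = (\<Sum>i=1..m. v k i * sum d {i..m})" for k m
  proof (induction m)
    case (Suc m)
    have "(\<Sum>i=1..Suc m. v k i * sum d {i..Suc m}) = (\<Sum>i=1..Suc m. v k i * sum d {i..m} + v k i * d (Suc m))"
      by (intro sum.cong refl) (simp add: distrib_left)
    also have "\<dots> = (\<Sum>i=1..m. v k i * sum d {i..m}) + a k (Suc m) * d (Suc m)"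
      by (simp only: sum.distrib sum_distrib_right[symmetric] v_sum) simp
    finally show ?case using Suc by simp
  qed simp
  have term_eq: "d k * (2 * (\<Sum>j=1..k. a k j * d j) - a k k * d k) =
      (\<Sum>i=1..k. v k i * (sum d {i..k})\<^sup>2) - (\<Sum>i=1..k. v k i * (sum d {i..k-1})\<^sup>2)" for k
  proof -
    have "d k * (2 * (\<Sum>j=1..k. a k j * d j)) = (\<Sum>i=1..k. v k i * (2 * d k * sum d {i..k}))"
      unfolding row by (simp add: sum_distrib_left mult_ac)
    also have "\<dots> = (\<Sum>i=1..k. v k i * ((sum d {i..k})\<^sup>2 - (sum d {i..k-1})\<^sup>2 + (d k)\<^sup>2))"
      by (intro sum.cong refl) (simp add: sum_square_increments del: sum.cl_ivl_Suc)
    also have "\<dots> = (\<Sum>i=1..k. v k i * (sum d {i..k})\<^sup>2) - (\<Sum>i=1..k. v k i * (sum d {i..k-1})\<^sup>2)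
        + (\<Sum>i=1..k. v k i) * (d k)\<^sup>2"
      by (simp add: algebra_simps sum.distrib sum_subtractf sum_distrib_left)
    finally show ?thesis unfolding v_sum by (simp add: algebra_simps power2_eq_square)
  qed
  have "(\<Sum>k=1..n. (\<Sum>i=1..k. v k i * (sum d {i..k})\<^sup>2) - (\<Sum>i=1..k. v k i * (sum d {i..k-1})\<^sup>2)) =
    (\<Sum>i=1..n. v n i * (sum d {i..n})\<^sup>2)
    + (\<Sum>k=1..<n. \<Sum>i=1..k. (v k i - v (Suc k) i) * (sum d {i..k})\<^sup>2)"
  proof (induction n)
    case (Suc n)
    \<comment> \<open>The term \<open>i = Suc n\<close> vanishes, its inner sum being empty.\<close>
    have "(\<Sum>i=1..Suc n. v (Suc n) i * (sum d {i..n})\<^sup>2) = (\<Sum>i=1..n. v (Suc n) i * (sum d {i..n})\<^sup>2)"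
      by simp
    moreover have "(\<Sum>k=1..<Suc n. \<Sum>i=1..k. (v k i - v (Suc k) i) * (sum d {i..k})\<^sup>2) =
      (\<Sum>k=1..<n. \<Sum>i=1..k. (v k i - v (Suc k) i) * (sum d {i..k})\<^sup>2) +
       (\<Sum>i=1..n. v n i * (sum d {i..n})\<^sup>2) - (\<Sum>i=1..n. v (Suc n) i * (sum d {i..n})\<^sup>2)"
      by (cases n) (simp_all add: left_diff_distrib sum_subtractf)
    moreover have "(\<Sum>k=1..Suc n. (\<Sum>i=1..k. v k i * (sum d {i..k})\<^sup>2) - (\<Sum>i=1..k. v k i * (sum d {i..k-1})\<^sup>2))
      = (\<Sum>k=1..n. (\<Sum>i=1..k. v k i * (sum d {i..k})\<^sup>2) - (\<Sum>i=1..k. v k i * (sum d {i..k-1})\<^sup>2))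
        + ((\<Sum>i=1..Suc n. v (Suc n) i * (sum d {i..Suc n})\<^sup>2) - (\<Sum>i=1..Suc n. v (Suc n) i * (sum d {i..n})\<^sup>2))"
      by (simp del: sum.cl_ivl_Suc add: sum.nat_ivl_Suc')
    ultimately show ?case using Suc by linarith
  qed simp
  then show ?thesis
    unfolding term_eq v_def by simp
qed

text \<open>The squares with \<open>i < k\<close> have coefficients of known sign and are dropped.
  Those with \<open>i = k\<close> are just \<open>(d k)\<^sup>2\<close>; they are kept, with
  coefficients of any sign, as the reserve against the tridiagonal remainder.\<close>

lemma quadratic_form_lower_bound:
  fixes a :: "nat \<Rightarrow> nat \<Rightarrow> real" and d :: "nat \<Rightarrow> real"
  assumes a0: "\<And>k. a k 0 = 0"
    and mono: "\<And>k i. 1 \<le> i \<Longrightarrow> i < k \<Longrightarrow> a k (i - 1) \<le> a k i"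
    and mixed: "\<And>k i. 1 \<le> i \<Longrightarrow> i < k \<Longrightarrow> a (Suc k) i - a (Suc k) (i - 1) \<le> a k i - a k (i - 1)"
  shows "(\<Sum>k=1..n. ((a k k - a k (k - 1)) - (a (Suc k) k - a (Suc k) (k - 1))) * (d k)\<^sup>2)
    \<le> (\<Sum>k=1..n. d k * (2 * (\<Sum>j=1..k. a k j * d j) - a k k * d k))"
proof -
  define w where "w k i = (a k i - a k (i - 1)) - (a (Suc k) i - a (Suc k) (i - 1))" for k i
  \<comment> \<open>Truncating the increments at \<open>n\<close> turns the last row into one that may be dropped.\<close>
  define e where "e k = (if k \<le> n then d k else 0)" for k
  have e_sum: "(\<Sum>j=1..k. a k j * e j) = (\<Sum>j=1..k. a k j * d j)" if "k \<le> n" for k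
    using that by (intro sum.cong) (auto simp: e_def)
  have "(\<Sum>k=1..n. w k k * (d k)\<^sup>2) \<le> (\<Sum>k=1..n. \<Sum>i=1..k. w k i * (sum e {i..k})\<^sup>2)"
  proof (intro sum_mono)
    fix k assume k: "k \<in> {1..n}"
    have "(\<Sum>i=1..k. w k i * (sum e {i..k})\<^sup>2) =
        w k k * (sum e {k..k})\<^sup>2 + (\<Sum>i\<in>{1..k}-{k}. w k i * (sum e {i..k})\<^sup>2)"
      using k by (intro sum.remove) auto
    moreover have "0 \<le> (\<Sum>i\<in>{1..k}-{k}. w k i * (sum e {i..k})\<^sup>2)"
    proof (intro sum_nonneg mult_nonneg_nonneg)
      fix i assume "i \<in> {1..k} - {k}"
      then show "0 \<le> w k i" using mixed[of i k] by (auto simp: w_def)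
    qed auto
    ultimately show "w k k * (d k)\<^sup>2 \<le> (\<Sum>i=1..k. w k i * (sum e {i..k})\<^sup>2)"
      using k by (auto simp: e_def)
  qed
  also have "\<dots> \<le> (\<Sum>i=1..Suc n. (a (Suc n) i - a (Suc n) (i - 1)) * (sum e {i..Suc n})\<^sup>2)
      + (\<Sum>k=1..<Suc n. \<Sum>i=1..k. w k i * (sum e {i..k})\<^sup>2)"
  proof -
    have "0 \<le> (a (Suc n) i - a (Suc n) (i - 1)) * (sum e {i..Suc n})\<^sup>2" if "i \<in> {1..Suc n}" for i
    proof (cases "i = Suc n")
      case False
      then show ?thesis using mono[of i "Suc n"] that by auto
    qed (simp add: e_def)
    then have "0 \<le> (\<Sum>i=1..Suc n. (a (Suc n) i - a (Suc n) (i - 1)) * (sum e {i..Suc n})\<^sup>2)"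
      by (rule sum_nonneg)
    moreover have "{1..n} = {1..<Suc n}" by auto
    ultimately show ?thesis by simp
  qed
  also have "\<dots> = (\<Sum>k=1..Suc n. e k * (2 * (\<Sum>j=1..k. a k j * e j) - a k k * e k))"
    unfolding w_def by (subst quadratic_form_abel) (simp_all add: a0)
  also have "\<dots> = (\<Sum>k=1..n. e k * (2 * (\<Sum>j=1..k. a k j * e j) - a k k * e k))"
    by (simp add: e_def)
  also have "\<dots> = (\<Sum>k=1..n. d k * (2 * (\<Sum>j=1..k. a k j * d j) - a k k * d k))"
    by (intro sum.cong refl) (simp add: e_sum, simp add: e_def)
  finally show ?thesis by (simp add: w_def)
qed

section \<open>Integrals against the centered linear weight\<close>

lemma has_integral_antiderivative:
  fixes F f :: "real \<Rightarrow> real"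
  assumes "a \<le> b" "\<And>x. x \<in> {a..b} \<Longrightarrow> (F has_real_derivative f x) (at x)" "F b - F a = I"
  shows "(f has_integral I) {a..b}"
  using fundamental_theorem_of_calculus[of a b F f] assms
  by (auto simp: has_real_derivative_iff_has_vector_derivative intro: has_vector_derivative_at_within)

lemma has_integral_centered: "u \<le> v \<Longrightarrow> ((\<lambda>s. 2 * s - u - v) has_integral 0) {u..v::real}"
  by (rule has_integral_antiderivative[where F = "\<lambda>s. s\<^sup>2 - (u + v) * s"])
     (auto intro!: derivative_eq_intros simp: power2_eq_square algebra_simps)

lemma has_integral_centered_mult_linear:
  "u \<le> v \<Longrightarrow> ((\<lambda>s. (2 * s - u - v) * (m * s)) has_integral m * (v - u) ^ 3 / 6) {u..v::real}"
  by (rule has_integral_antiderivative[where F = "\<lambda>s. m * (2 * s ^ 3 / 3 - (u + v) * s\<^sup>2 / 2)"])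
     (auto intro!: derivative_eq_intros simp: field_simps power2_eq_square power3_eq_cube)

text \<open>Chebyshev's argument: the weight has mean zero, so the midpoint value of
  \<open>g\<close> may be subtracted, after which both factors change sign at the same
  point.\<close>

lemma integral_centered_mult_mono:
  fixes g :: "real \<Rightarrow> real"
  assumes "u \<le> v" and cont: "continuous_on {u..v} g" and mono: "mono_on {u..v} g"
  shows "0 \<le> integral {u..v} (\<lambda>s. (2 * s - u - v) * g s)"
proof -
  define c where "c = g ((u + v) / 2)"
  have int: "(\<lambda>s. (2 * s - u - v) * g s) integrable_on {u..v}"
    by (intro integrable_continuous_real continuous_intros cont)
  have "0 \<le> integral {u..v} (\<lambda>s. (2 * s - u - v) * (g s - c))"
  proof (rule integral_nonneg)
    show "(\<lambda>s. (2 * s - u - v) * (g s - c)) integrable_on {u..v}"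
      by (intro integrable_continuous_real continuous_intros cont)
    fix s assume s: "s \<in> {u..v}"
    show "0 \<le> (2 * s - u - v) * (g s - c)"
    proof (cases "s \<le> (u + v) / 2")
      case True
      then have "g s \<le> c" unfolding c_def using s by (intro mono_onD[OF mono]) auto
      then show ?thesis using True by (intro mult_nonpos_nonpos) (auto simp: field_simps)
    next
      case False
      then have "c \<le> g s" unfolding c_def using s by (intro mono_onD[OF mono]) auto
      then show ?thesis using False by (intro mult_nonneg_nonneg) (auto simp: field_simps)
    qed
  qed
  also have "\<dots> = integral {u..v} (\<lambda>s. (2 * s - u - v) * g s) - c * 0"
    using has_integral_diff[OF integrable_integral[OF int] has_integral_mult_right[OF has_integral_centered[OF \<open>u \<le> v\<close>], of c]]
    by (intro integral_unique) (simp add: algebra_simps)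
  finally show ?thesis by simp
qed

text \<open>Subtracting \<open>m * s\<close> leaves an increasing function;
  \<open>(v - u) ^ 3 / 6\<close> is the centered moment of the identity.\<close>

lemma integral_centered_ge:
  fixes f f' :: "real \<Rightarrow> real"
  assumes "u \<le> v" and deriv: "\<And>s. s \<in> {u..v} \<Longrightarrow> (f has_real_derivative f' s) (at s)"
    and ge: "\<And>s. s \<in> {u..v} \<Longrightarrow> m \<le> f' s"
  shows "m * (v - u) ^ 3 / 6 \<le> integral {u..v} (\<lambda>s. (2 * s - u - v) * f s)"
proof -
  have contf: "continuous_on {u..v} f"
    using deriv by (meson DERIV_isCont continuous_at_imp_continuous_on)
  have "mono_on {u..v} (\<lambda>s. f s - m * s)"
  proof (rule mono_onI)
    fix r s assume rs: "r \<in> {u..v}" "s \<in> {u..v}" "r \<le> s"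
    show "f r - m * r \<le> f s - m * s"
    proof (rule DERIV_nonneg_imp_nondecreasing[OF rs(3)])
      fix x assume "r \<le> x" "x \<le> s"
      then have x: "x \<in> {u..v}" using rs by auto
      then have "((\<lambda>s. f s - m * s) has_real_derivative f' x - m) (at x)"
        by (auto intro!: derivative_eq_intros deriv)
      then show "\<exists>y. ((\<lambda>s. f s - m * s) has_real_derivative y) (at x) \<and> 0 \<le> y"
        using ge[OF x] by force
    qed
  qed
  then have "0 \<le> integral {u..v} (\<lambda>s. (2 * s - u - v) * (f s - m * s))"
    by (intro integral_centered_mult_mono assms continuous_intros contf)
  also have "\<dots> = integral {u..v} (\<lambda>s. (2 * s - u - v) * f s) - m * (v - u) ^ 3 / 6"
  proof -
    have "(\<lambda>s. (2 * s - u - v) * f s) integrable_on {u..v}"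
      by (intro integrable_continuous_real continuous_intros contf)
    from has_integral_diff[OF integrable_integral[OF this] has_integral_centered_mult_linear[OF \<open>u \<le> v\<close>, of m]]
    show ?thesis by (intro integral_unique) (simp add: algebra_simps)
  qed
  finally show ?thesis by simp
qed

lemma integral_centered_le:
  fixes f f' :: "real \<Rightarrow> real"
  assumes "u \<le> v" and deriv: "\<And>s. s \<in> {u..v} \<Longrightarrow> (f has_real_derivative f' s) (at s)"
    and le: "\<And>s. s \<in> {u..v} \<Longrightarrow> f' s \<le> m"
  shows "integral {u..v} (\<lambda>s. (2 * s - u - v) * f s) \<le> m * (v - u) ^ 3 / 6"
  using integral_centered_ge[of u v "\<lambda>s. - f s" "\<lambda>s. - f' s" "- m"] assms
  by (auto intro!: derivative_eq_intros)

text \<open>To the left of \<open>v\<close>, the graph lies below the line of slope \<open>m\<close>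
  through its right endpoint.\<close>

lemma integral_le_endpoint:
  fixes f f' :: "real \<Rightarrow> real"
  assumes "u \<le> v" and deriv: "\<And>s. s \<in> {u..v} \<Longrightarrow> (f has_real_derivative f' s) (at s)"
    and ge: "\<And>s. s \<in> {u..v} \<Longrightarrow> m \<le> f' s"
  shows "integral {u..v} f \<le> f v * (v - u) - m * (v - u)\<^sup>2 / 2"
proof -
  have contf: "continuous_on {u..v} f"
    using deriv by (meson DERIV_isCont continuous_at_imp_continuous_on)
  have "f s \<le> f v - m * (v - s)" if s: "s \<in> {u..v}" for s
  proof -
    have "f s - m * s \<le> f v - m * v"
    proof (rule DERIV_nonneg_imp_nondecreasing[where f = "\<lambda>s. f s - m * s" and a = s and b = v])
      fix x assume "s \<le> x" "x \<le> v"
      then have x: "x \<in> {u..v}" using s by auto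
      then have "((\<lambda>s. f s - m * s) has_real_derivative f' x - m) (at x)"
        by (auto intro!: derivative_eq_intros deriv)
      then show "\<exists>y. ((\<lambda>s. f s - m * s) has_real_derivative y) (at x) \<and> 0 \<le> y"
        using ge[OF x] by force
    qed (use s in auto)
    then show ?thesis by (simp add: algebra_simps)
  qed
  moreover have "((\<lambda>s. f v - m * (v - s)) has_integral f v * (v - u) - m * (v - u)\<^sup>2 / 2) {u..v}"
    by (rule has_integral_antiderivative[where F = "\<lambda>s. f v * s + m * (v - s)\<^sup>2 / 2"])
       (use \<open>u \<le> v\<close> in \<open>auto intro!: derivative_eq_intros simp: field_simps\<close>)
  ultimately show ?thesis
    by (intro has_integral_le[OF integrable_integral[OF integrable_continuous_real[OF contf]]]) auto
qed

text \<open>The right-hand side is an average of \<open>g\<close> with density \<open>?w\<close>: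
  its mass is 1 because the centered factor integrates to zero, and it is nonnegative because
  \<open>2 * s - u - v\<close> never exceeds \<open>v - u\<close>. With \<open>h\<close> the
  following step, this is the part of \<open>cell_weight\<close> supported on its own cell.\<close>

lemma weighted_mean_ge_left_value:
  fixes g :: "real \<Rightarrow> real"
  assumes "u < v" "0 \<le> h" and cont: "continuous_on {u..v} g"
    and ge: "\<And>s. s \<in> {u..v} \<Longrightarrow> g u \<le> g s"
  shows "g u \<le> integral {u..v} g / (v - u)
    - integral {u..v} (\<lambda>s. (2 * s - u - v) * g s) / ((v - u) * ((v - u) + h))"
proof -
  let ?w = "\<lambda>s. 1 / (v - u) - (2 * s - u - v) / ((v - u) * ((v - u) + h))"
  have i1: "g integrable_on {u..v}" and i2: "(\<lambda>s. (2 * s - u - v) * g s) integrable_on {u..v}"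
    by (intro integrable_continuous_real continuous_intros cont)+
  have "0 \<le> integral {u..v} (\<lambda>s. ?w s * (g s - g u))"
  proof (rule integral_nonneg)
    show "(\<lambda>s. ?w s * (g s - g u)) integrable_on {u..v}"
      using assms by (intro integrable_continuous_real continuous_intros cont) auto
    fix s assume s: "s \<in> {u..v}"
    then have "(2 * s - u - v) / ((v - u) * ((v - u) + h)) \<le> ((v - u) + h) / ((v - u) * ((v - u) + h))"
      using assms by (intro divide_right_mono) auto
    then have "0 \<le> ?w s" using assms by simp
    then show "0 \<le> ?w s * (g s - g u)" using ge[OF s] by simp
  qed
  also have "integral {u..v} (\<lambda>s. ?w s * (g s - g u)) = integral {u..v} g / (v - u)
    - integral {u..v} (\<lambda>s. (2 * s - u - v) * g s) / ((v - u) * ((v - u) + h)) - g u"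
  proof (rule integral_unique)
    have c: "((\<lambda>s. g u / (v - u)) has_integral g u) {u..v}"
      using has_integral_const_real[of "g u / (v - u)" u v] \<open>u < v\<close> by simp
    have z: "((\<lambda>s. (2 * s - u - v) * (g u / ((v - u) * ((v - u) + h)))) has_integral 0) {u..v}"
      using has_integral_mult_left[OF has_integral_centered[OF less_imp_le[OF \<open>u < v\<close>]], of "g u / ((v - u) * ((v - u) + h))"]
      by simp
    have eq: "(1 / d - x / q) * (y - c) = y / d - x * y / q - c / d + x * (c / q)" for d q x y c :: real
      by (simp add: algebra_simps diff_divide_distrib)
    have "((\<lambda>s. ?w s * (g s - g u)) has_integral
       integral {u..v} g / (v - u) - integral {u..v} (\<lambda>s. (2 * s - u - v) * g s) / ((v - u) * ((v - u) + h)) - g u + 0) {u..v}"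
      unfolding eq
      by (intro has_integral_add has_integral_diff has_integral_divide integrable_integral i1 i2 c z)
    then show "((\<lambda>s. ?w s * (g s - g u)) has_integral integral {u..v} g / (v - u)
      - integral {u..v} (\<lambda>s. (2 * s - u - v) * g s) / ((v - u) * ((v - u) + h)) - g u) {u..v}"
      by simp
  qed
  finally show ?thesis by simp
qed

section \<open>Integrals of the singular power kernel\<close>

lemma has_integral_reflected_powr:
  fixes p :: real
  assumes "a \<le> b" "b \<le> T" "-1 < p"
  shows "((\<lambda>s. (T - s) powr p) has_integral ((T - a) powr (p + 1) - (T - b) powr (p + 1)) / (p + 1)) {a..b}"
proof -
  have "((\<lambda>s. (T - s) powr p) has_integral
      (- ((T - b) powr (p + 1) / (p + 1))) - (- ((T - a) powr (p + 1) / (p + 1)))) {a..b}"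
  \<comment> \<open>For \<open>b = T\<close> and negative \<open>p\<close> the integrand is singular
    at the endpoint, so the derivative is only taken in the interior.\<close>
  proof (rule fundamental_theorem_of_calculus_interior)
    show "continuous_on {a..b} (\<lambda>s. - ((T - s) powr (p + 1) / (p + 1)))"
      using assms by (intro continuous_intros continuous_on_powr') auto
    fix s assume "s \<in> {a<..<b}"
    then show "((\<lambda>s. - ((T - s) powr (p + 1) / (p + 1))) has_vector_derivative (T - s) powr p) (at s)"
      using assms unfolding has_real_derivative_iff_has_vector_derivative[symmetric]
      by (auto intro!: derivative_eq_intros)
  qed (use assms in auto)
  then show ?thesis by (simp add: diff_divide_distrib)
qed

lemma has_integral_centered_mult_reflected_powr:
  fixes \<alpha> :: real
  assumes "a \<le> b" "b \<le> T" "0 < \<alpha>" "\<alpha> < 1"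
  shows "((\<lambda>s. (2 * s - a - b) * (T - s) powr - \<alpha>) has_integral
    (2 * T - a - b) * (((T - a) powr (1 - \<alpha>) - (T - b) powr (1 - \<alpha>)) / (1 - \<alpha>))
    - 2 * (((T - a) powr (2 - \<alpha>) - (T - b) powr (2 - \<alpha>)) / (2 - \<alpha>))) {a..b}"
proof -
  have "((\<lambda>s. (2 * T - a - b) * (T - s) powr - \<alpha> - 2 * (T - s) powr (1 - \<alpha>)) has_integral
    (2 * T - a - b) * (((T - a) powr (1 - \<alpha>) - (T - b) powr (1 - \<alpha>)) / (1 - \<alpha>))
    - 2 * (((T - a) powr (2 - \<alpha>) - (T - b) powr (2 - \<alpha>)) / (2 - \<alpha>))) {a..b}"
    using has_integral_reflected_powr[of a b T "- \<alpha>"] has_integral_reflected_powr[of a b T "1 - \<alpha>"] assms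
    by (intro has_integral_diff has_integral_mult_right) (auto simp: algebra_simps)
  \<comment> \<open>The centered factor is \<open>(2 * T - a - b) - 2 * (T - s)\<close>. At
    \<open>s = T\<close> both sides are 0, since \<open>0 powr p = 0\<close>.\<close>
  moreover have "(2 * T - a - b) * (T - s) powr - \<alpha> - 2 * (T - s) powr (1 - \<alpha>)
      = (2 * s - a - b) * (T - s) powr - \<alpha>" if "s \<in> {a..b}" for s
  proof (cases "s = T")
    case False
    then have "(T - s) powr (1 - \<alpha>) = (T - s) * (T - s) powr - \<alpha>"
      using that assms powr_mult_base[of "T - s" "- \<alpha>"] by simp
    then show ?thesis by (simp add: algebra_simps)
  qed (use assms in auto)
  ultimately show ?thesis by (rule has_integral_eq[rotated]) 
qed

section \<open>Weights of the mesh cells\<close>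

definition cell_mean :: "(nat \<Rightarrow> real) \<Rightarrow> nat \<Rightarrow> (real \<Rightarrow> real) \<Rightarrow> real" where
  "cell_mean t j F = integral {t (j - 1)..t j} F / step t j"

definition cell_moment :: "(nat \<Rightarrow> real) \<Rightarrow> nat \<Rightarrow> (real \<Rightarrow> real) \<Rightarrow> real" where
  "cell_moment t j F = integral {t (j - 1)..t j} (\<lambda>s. (2 * s - t (j - 1) - t j) * F s)"

text \<open>The coefficient of the increment \<open>w j - w (j - 1)\<close> in the integral of \<open>F\<close> against the
  piecewise derivative of the interpolants \<open>H2 t w j\<close>. For \<open>j = 1\<close> the cell \<open>j - 1 = 0\<close> degenerates
  to a point and contributes \<open>0\<close>; for \<open>j = 0\<close> the value is \<open>0\<close> because \<open>x / 0 = 0\<close>.\<close>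

definition cell_weight :: "(nat \<Rightarrow> real) \<Rightarrow> nat \<Rightarrow> (real \<Rightarrow> real) \<Rightarrow> real" where
  "cell_weight t j F = cell_mean t j F
     - cell_moment t j F / (step t j * (step t j + step t (Suc j)))
     + cell_moment t (j - 1) F / (step t j * (step t (j - 1) + step t j))"

lemma step_0 [simp]: "step t 0 = 0"
  by (simp add: step_def)

lemma cell_mean_0 [simp]: "cell_mean t 0 F = 0"
  and cell_moment_0 [simp]: "cell_moment t 0 F = 0"
  by (simp_all add: cell_mean_def cell_moment_def)

lemma cell_weight_0 [simp]: "cell_weight t 0 F = 0"
  by (simp add: cell_weight_def)

text \<open>Exactly what linearity in \<open>F\<close> requires. Continuity would exclude the kernel
  on the last cell, at whose right end it is singular.\<close>

definition cell_integrable :: "(nat \<Rightarrow> real) \<Rightarrow> nat \<Rightarrow> (real \<Rightarrow> real) \<Rightarrow> bool" where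
  "cell_integrable t j F \<longleftrightarrow> F integrable_on {t (j - 1)..t j} \<and>
     (\<lambda>s. (2 * s - t (j - 1) - t j) * F s) integrable_on {t (j - 1)..t j}"

lemma cell_mean_diff:
  "cell_integrable t j F \<Longrightarrow> cell_integrable t j G \<Longrightarrow>
    cell_mean t j (\<lambda>s. F s - G s) = cell_mean t j F - cell_mean t j G"
  by (simp add: cell_mean_def cell_integrable_def integral_diff diff_divide_distrib)

lemma cell_moment_diff:
  "cell_integrable t j F \<Longrightarrow> cell_integrable t j G \<Longrightarrow>
    cell_moment t j (\<lambda>s. F s - G s) = cell_moment t j F - cell_moment t j G"
  by (simp add: cell_moment_def cell_integrable_def integral_diff right_diff_distrib)

lemma cell_weight_diff:
  assumes "cell_integrable t j F" "cell_integrable t j G"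
    "cell_integrable t (j - 1) F" "cell_integrable t (j - 1) G"
  shows "cell_weight t j (\<lambda>s. F s - G s) = cell_weight t j F - cell_weight t j G"
  using assms by (simp add: cell_weight_def cell_mean_diff cell_moment_diff diff_divide_distrib)

section \<open>Growth of the weights from one cell to the next\<close>

locale graded_mesh =
  fixes t :: "nat \<Rightarrow> real"
  assumes mesh: "mesh t"
begin

abbreviation "\<tau> \<equiv> step t"
abbreviation "\<rho> \<equiv> step_ratio t"

lemma step_pos: "1 \<le> j \<Longrightarrow> 0 < \<tau> j"
  using mesh unfolding mesh_def step_def strict_mono_def by auto

lemma step_nonneg: "0 \<le> \<tau> j"
  by (cases "j = 0") (auto intro: less_imp_le[OF step_pos])

lemma mesh_le: "i \<le> j \<Longrightarrow> t i \<le> t j"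
  using mesh unfolding mesh_def by (simp add: strict_mono_less_eq)

lemma mesh_less: "i < j \<Longrightarrow> t i < t j"
  using mesh unfolding mesh_def by (simp add: strict_mono_less)

lemma step_ratio_pos: "2 \<le> j \<Longrightarrow> 0 < \<rho> j"
  unfolding step_ratio_def by (intro divide_pos_pos step_pos) auto

lemma step_eq_ratio_mult: "2 \<le> j \<Longrightarrow> \<tau> j = \<rho> j * \<tau> (j - 1)"
  using step_pos[of "j - 1"] by (cases j) (auto simp: step_ratio_def)

text \<open>Only \<open>t (a - 1) < T\<close> is known, so cell \<open>a\<close> may contain a
  singularity of \<open>F\<close> at \<open>T\<close>. Its mean and moment therefore stay
  unestimated on the left, and only the regular cells \<open>a - 1\<close> and \<open>a - 2\<close>
  are worked on.\<close>

lemma cell_weight_increment_ge: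
  fixes F F' :: "real \<Rightarrow> real"
  assumes a: "1 \<le> a" and T: "t (a - 1) < T"
    and deriv: "\<And>s. s < T \<Longrightarrow> (F has_real_derivative F' s) (at s)"
    and F'_mono: "\<And>r s. r \<le> s \<Longrightarrow> s < T \<Longrightarrow> F' r \<le> F' s"
    and F'_nonneg: "\<And>s. s < T \<Longrightarrow> 0 \<le> F' s"
    and F_nonneg: "\<And>s. s < T \<Longrightarrow> 0 \<le> F s"
    and ratio: "3 \<le> a \<Longrightarrow> 1 / ((\<rho> (a - 1))\<^sup>2 * (1 + \<rho> (a - 1))) - 3 \<le> 1 / \<rho> a"
  shows "cell_mean t a F - cell_moment t a F / (\<tau> a * (\<tau> a + \<tau> (Suc a))) - F (t (a - 1))
    \<le> cell_weight t a F - cell_weight t (a - 1) F"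
proof (cases "a = 1")
  case True
  then show ?thesis using F_nonneg[OF T] by (simp add: cell_weight_def)
next
  case False
  define b where "b = a - 1"
  define c where "c = a - 2"
  have ab: "a = Suc b" "b = Suc c" "a - 1 = b" "a - Suc 0 = b" "b - 1 = c" "2 \<le> a"
    using a False by (auto simp: b_def c_def)
  have tb: "t b < T" using T ab by simp
  have pos: "0 < \<tau> a" "0 < \<tau> b" using ab by (auto intro: step_pos)
  \<comment> \<open>As \<open>F\<close> is convex, its slope \<open>m\<close> at \<open>t c\<close> bounds the negative contribution of cell \<open>c\<close> from above and the
    positive one of cell \<open>b\<close> from below; \<open>ratio\<close> says that the latter wins.\<close>
  define m where "m = F' (t c)"
  have m0: "0 \<le> m" unfolding m_def using tb mesh_less[of c b] ab by (intro F'_nonneg) auto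
  have step_b: "t b - t c = \<tau> b" by (simp add: step_def ab)
  have mb: "m * \<tau> b ^ 3 / 6 \<le> cell_moment t b F"
    unfolding cell_moment_def m_def step_b[symmetric] \<open>b - 1 = c\<close>
    using tb mesh_le[of c b] ab by (intro integral_centered_ge[where f' = F'] deriv F'_mono) auto
  have meanb: "cell_mean t b F \<le> F (t b) - m * \<tau> b / 2"
  proof -
    have "integral {t c..t b} F \<le> F (t b) * (t b - t c) - m * (t b - t c)\<^sup>2 / 2"
      unfolding m_def using tb mesh_le[of c b] ab
      by (intro integral_le_endpoint[where f' = F'] deriv F'_mono) auto
    then show ?thesis
      using pos unfolding cell_mean_def step_b \<open>b - 1 = c\<close> pos_divide_le_eq[OF pos(2)]
      by (simp add: algebra_simps power2_eq_square)
  qed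
  have mc: "cell_moment t c F \<le> m * \<tau> c ^ 3 / 6"
  proof -
    have step_c: "step t c = t c - t (c - 1)" by (simp add: step_def)
    show ?thesis
      unfolding cell_moment_def m_def step_c
      using tb mesh_le[of "c - 1" c] mesh_less[of c b] ab
      by (intro integral_centered_le[where f' = F'] deriv F'_mono) auto
  qed
  have "cell_moment t c F / (\<tau> b * (\<tau> c + \<tau> b)) \<le> m * \<tau> b / 2 + m * \<tau> b ^ 3 / 6 / (\<tau> b * \<tau> a)"
  proof (cases "c = 0")
    case True
    then show ?thesis using pos m0 by simp
  next
    case False
    then have c1: "1 \<le> c" "3 \<le> a" using ab by auto
    have posc: "0 < \<tau> c" using c1 by (auto intro: step_pos)
    define x y where "x = \<rho> b" and "y = \<rho> a"
    have xy: "0 < x" "0 < y" using ab c1 by (auto simp: x_def y_def intro: step_ratio_pos)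
    have tb: "\<tau> b = x * \<tau> c" and ta: "\<tau> a = y * (x * \<tau> c)"
      using step_eq_ratio_mult[of b] step_eq_ratio_mult[of a] ab c1 by (auto simp: x_def y_def)
    have r: "1 / (x\<^sup>2 * (1 + x)) \<le> 3 + 1 / y" using ratio c1 ab by (simp add: x_def y_def)
    have "cell_moment t c F / (\<tau> b * (\<tau> c + \<tau> b)) \<le> m * \<tau> c ^ 3 / 6 / (\<tau> b * (\<tau> c + \<tau> b))"
      using mc pos posc by (intro divide_right_mono) auto
    also have "\<dots> = m * x * \<tau> c / 6 * (1 / (x\<^sup>2 * (1 + x)))"
    proof -
      have "x * \<tau> c * (\<tau> c + x * \<tau> c) = x * (1 + x) * (\<tau> c)\<^sup>2"
        by (simp add: algebra_simps power2_eq_square)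
      then show ?thesis
        using xy posc unfolding tb by (simp add: divide_simps power2_eq_square power3_eq_cube)
    qed
    also have "\<dots> \<le> m * x * \<tau> c / 6 * (3 + 1 / y)"
      using m0 xy posc by (intro mult_left_mono r) auto
    also have "\<dots> = m * \<tau> b / 2 + m * \<tau> b ^ 3 / 6 / (\<tau> b * \<tau> a)"
      using xy posc unfolding tb ta by (simp add: field_simps power2_eq_square power3_eq_cube)
    finally show ?thesis .
  qed
  also have "\<dots> \<le> F (t b) - cell_mean t b F + cell_moment t b F / (\<tau> b * \<tau> a)"
  proof -
    have "m * \<tau> b ^ 3 / 6 / (\<tau> b * \<tau> a) \<le> cell_moment t b F / (\<tau> b * \<tau> a)"
      using mb pos by (intro divide_right_mono) auto
    then show ?thesis using meanb by linarith
  qed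
  finally have "cell_moment t c F / (\<tau> b * (\<tau> c + \<tau> b))
      \<le> F (t b) - cell_mean t b F + cell_moment t b F / (\<tau> b * \<tau> a)" .
  \<comment> \<open>The moment of cell \<open>b\<close> occurs in both weights, with opposite signs;
    in the difference the two shares add up to this one fraction.\<close>
  moreover have "cell_moment t b F / (\<tau> b * \<tau> a) =
      cell_moment t b F / (\<tau> b * (\<tau> b + \<tau> a)) + cell_moment t b F / (\<tau> a * (\<tau> b + \<tau> a))"
    using pos by (simp add: divide_simps) (simp add: algebra_simps)
  ultimately show ?thesis
    unfolding cell_weight_def \<open>a - 1 = b\<close> \<open>b - 1 = c\<close> using ab(1) by simp
qed

lemma weighted_cell_mean_ge:
  assumes a: "1 \<le> a" and cont: "continuous_on {t (a - 1)..t a} F"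
    and mono: "\<And>s. s \<in> {t (a - 1)..t a} \<Longrightarrow> F (t (a - 1)) \<le> F s"
  shows "F (t (a - 1)) \<le> cell_mean t a F - cell_moment t a F / (\<tau> a * (\<tau> a + \<tau> (Suc a)))"
proof -
  have "t a - t (a - 1) = \<tau> a" "t (a - 1) < t a"
    using a mesh_less[of "a - 1" a] by (auto simp: step_def)
  then show ?thesis
    using weighted_mean_ge_left_value[of "t (a - 1)" "t a" "\<tau> (Suc a)" F] assms step_nonneg
    by (simp add: cell_mean_def cell_moment_def)
qed

end

section \<open>The Caputo kernel and its increments between time levels\<close>

locale caputo_mesh = graded_mesh +
  fixes \<alpha> :: real
  assumes \<alpha>: "0 < \<alpha>" "\<alpha> < 1"
begin

definition kernel :: "nat \<Rightarrow> real \<Rightarrow> real" where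
  "kernel k s = (t k - s) powr - \<alpha>"

lemma cell_integrable_kernel:
  assumes "j \<le> k"
  shows "cell_integrable t j (kernel k)"
  unfolding cell_integrable_def kernel_def
  using has_integral_reflected_powr[of "t (j - 1)" "t j" "t k" "- \<alpha>"]
    has_integral_centered_mult_reflected_powr[of "t (j - 1)" "t j" "t k" \<alpha>]
    mesh_le[of j k] mesh_le[of "j - 1" j] \<alpha> assms
  by (auto simp: has_integral_iff)

lemma kernel_has_derivative:
  "s < t k \<Longrightarrow> (kernel k has_real_derivative \<alpha> * (t k - s) powr (- \<alpha> - 1)) (at s)"
  unfolding kernel_def by (auto intro!: derivative_eq_intros)

text \<open>Convexity of \<open>kernel_increment k\<close>: its second derivative is a positive
  multiple of a difference of powers with exponent \<open>- \<alpha> - 2\<close>, and these decrease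
  as the base grows.\<close>

lemma kernel_diff_deriv_mono:
  assumes "r \<le> s" "s < t k"
  shows "\<alpha> * (t k - r) powr (- \<alpha> - 1) - \<alpha> * (t (Suc k) - r) powr (- \<alpha> - 1)
    \<le> \<alpha> * (t k - s) powr (- \<alpha> - 1) - \<alpha> * (t (Suc k) - s) powr (- \<alpha> - 1)"
proof (rule DERIV_nonneg_imp_nondecreasing[OF assms(1)])
  fix x assume "r \<le> x" "x \<le> s"
  then have x: "x < t k" "x < t (Suc k)" using assms mesh_less[of k "Suc k"] by auto
  let ?d = "\<alpha> * ((\<alpha> + 1) * (t k - x) powr (- \<alpha> - 2)) - \<alpha> * ((\<alpha> + 1) * (t (Suc k) - x) powr (- \<alpha> - 2))"
  have "((\<lambda>s. \<alpha> * (t k - s) powr (- \<alpha> - 1) - \<alpha> * (t (Suc k) - s) powr (- \<alpha> - 1))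
      has_real_derivative ?d) (at x)"
    using x by (auto intro!: derivative_eq_intros simp: algebra_simps)
  moreover have "(t (Suc k) - x) powr (- \<alpha> - 2) \<le> (t k - x) powr (- \<alpha> - 2)"
    using x \<alpha> mesh_le[of k "Suc k"] by (intro powr_mono2') auto
  then have "0 \<le> ?d" using \<alpha> by (auto intro!: mult_left_mono)
  ultimately show "\<exists>y. ((\<lambda>s. \<alpha> * (t k - s) powr (- \<alpha> - 1) - \<alpha> * (t (Suc k) - s) powr (- \<alpha> - 1))
      has_real_derivative y) (at x) \<and> 0 \<le> y" by blast
qed

definition kernel_increment :: "nat \<Rightarrow> real \<Rightarrow> real" where
  "kernel_increment k s = kernel k s - kernel (Suc k) s"

lemma kernel_increment_has_derivative:
  assumes "s < t k"
  shows "(kernel_increment k has_real_derivative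
      \<alpha> * (t k - s) powr (- \<alpha> - 1) - \<alpha> * (t (Suc k) - s) powr (- \<alpha> - 1)) (at s)"
proof -
  have "s < t (Suc k)" using assms mesh_less[of k "Suc k"] by simp
  from DERIV_diff[OF kernel_has_derivative[OF assms] kernel_has_derivative[OF this]]
  show ?thesis unfolding kernel_increment_def .
qed

lemma kernel_mono: "r \<le> s \<Longrightarrow> s < t k \<Longrightarrow> kernel k r \<le> kernel k s"
  unfolding kernel_def using \<alpha> by (intro powr_mono2') auto

lemma kernel_increment_mono:
  assumes "r \<le> s" "s < t k"
  shows "kernel_increment k r \<le> kernel_increment k s"
proof (rule DERIV_nonneg_imp_nondecreasing[OF assms(1)])
  fix x assume "r \<le> x" "x \<le> s"
  then have x: "x < t k" "x < t (Suc k)" using assms mesh_less[of k "Suc k"] by auto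
  have "(t (Suc k) - x) powr (- \<alpha> - 1) \<le> (t k - x) powr (- \<alpha> - 1)"
    using x \<alpha> mesh_le[of k "Suc k"] by (intro powr_mono2') auto
  then have "0 \<le> \<alpha> * (t k - x) powr (- \<alpha> - 1) - \<alpha> * (t (Suc k) - x) powr (- \<alpha> - 1)"
    using \<alpha> by auto
  then show "\<exists>y. (kernel_increment k has_real_derivative y) (at x) \<and> 0 \<le> y"
    using kernel_increment_has_derivative[OF x(1)] by blast
qed

lemma cell_weight_kernel_increment:
  assumes "j \<le> k"
  shows "cell_weight t j (kernel_increment k) = cell_weight t j (kernel k) - cell_weight t j (kernel (Suc k))"
  unfolding kernel_increment_def using assms
  by (intro cell_weight_diff cell_integrable_kernel) auto

end

text \<open>The interface between the mesh conditions and the positivity proof, free of the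
  constants delimiting the ratios. \<open>ratio_lower\<close> yields the signs away from the
  diagonal, \<open>ratio_upper\<close> the dominance from row 3 on,
  \<open>second_ratio_upper\<close> the leading block; \<open>ratio_bound\<close>, that is, a ratio
  of at most 2 + sqrt 6, controls the powers of ratios in the last two.\<close>

locale admissible_mesh = caputo_mesh +
  assumes ratio_lower: "\<And>k. 2 \<le> k \<Longrightarrow> 1 / ((\<rho> k)\<^sup>2 * (1 + \<rho> k)) - 3 \<le> 1 / \<rho> (Suc k)"
    and ratio_upper: "\<And>k. 3 \<le> k \<Longrightarrow>
      0 \<le> 1 + 1 / (1 + \<rho> (Suc k)) + 2 * \<rho> k / (1 + \<rho> k) - (\<rho> k)\<^sup>2 / (1 + \<rho> k)"
    and second_ratio_upper: "0 \<le> 2 + 2 / (1 + \<rho> 3) + 4 * \<rho> 2 / (1 + \<rho> 2) - \<rho> 2 ^ 3 / (1 + \<rho> 2)\<^sup>2"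
    and ratio_bound: "\<And>k. 3 \<le> k \<Longrightarrow> (\<rho> k)\<^sup>2 \<le> 4 * \<rho> k + 2"
begin

lemma cell_weight_kernel_mono:
  assumes "1 \<le> i" "i < k"
  shows "cell_weight t (i - 1) (kernel k) \<le> cell_weight t i (kernel k)"
proof -
  have "cell_mean t i (kernel k) - cell_moment t i (kernel k) / (\<tau> i * (\<tau> i + \<tau> (Suc i))) - kernel k (t (i - 1))
    \<le> cell_weight t i (kernel k) - cell_weight t (i - 1) (kernel k)"
  proof (rule cell_weight_increment_ge)
    show "t (i - 1) < t k" using assms by (intro mesh_less) auto
    show "r \<le> s \<Longrightarrow> s < t k \<Longrightarrow> \<alpha> * (t k - r) powr (- \<alpha> - 1) \<le> \<alpha> * (t k - s) powr (- \<alpha> - 1)" for r s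
      using \<alpha> by (intro mult_left_mono powr_mono2') auto
    show "3 \<le> i \<Longrightarrow> 1 / ((\<rho> (i - 1))\<^sup>2 * (1 + \<rho> (i - 1))) - 3 \<le> 1 / \<rho> i"
      using ratio_lower[of "i - 1"] by simp
  qed (use assms \<alpha> in \<open>auto intro: kernel_has_derivative simp: kernel_def\<close>)
  moreover have "kernel k (t (i - 1)) \<le> cell_mean t i (kernel k) - cell_moment t i (kernel k) / (\<tau> i * (\<tau> i + \<tau> (Suc i)))"
  proof (rule weighted_cell_mean_ge)
    have "s < t k" if "s \<in> {t (i - 1)..t i}" for s
      using that mesh_less[OF \<open>i < k\<close>] by auto
    then show "continuous_on {t (i - 1)..t i} (kernel k)"
      by (meson DERIV_isCont continuous_at_imp_continuous_on kernel_has_derivative)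
    show "s \<in> {t (i - 1)..t i} \<Longrightarrow> kernel k (t (i - 1)) \<le> kernel k s" for s
      using mesh_less[OF \<open>i < k\<close>] by (intro kernel_mono) auto
  qed fact
  ultimately show ?thesis by linarith
qed

text \<open>Unlike the monotonicity along a row, this includes \<open>i = k\<close>, where it bounds
  the coefficients that \<open>quadratic_form_lower_bound\<close> keeps.\<close>

lemma cell_weight_kernel_increment_ge:
  assumes "1 \<le> i" "i \<le> k"
  shows "cell_mean t i (kernel_increment k) - cell_moment t i (kernel_increment k) / (\<tau> i * (\<tau> i + \<tau> (Suc i)))
      - kernel_increment k (t (i - 1))
    \<le> cell_weight t i (kernel_increment k) - cell_weight t (i - 1) (kernel_increment k)"
proof (rule cell_weight_increment_ge)
  show "t (i - 1) < t k" using assms by (intro mesh_less) auto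
  fix s assume s: "s < t k"
  then have s': "s < t (Suc k)" "t k \<le> t (Suc k)" using mesh_le[of k "Suc k"] by auto
  show "(kernel_increment k has_real_derivative
      \<alpha> * (t k - s) powr (- \<alpha> - 1) - \<alpha> * (t (Suc k) - s) powr (- \<alpha> - 1)) (at s)"
    by (rule kernel_increment_has_derivative[OF s])
  show "r \<le> s \<Longrightarrow> \<alpha> * (t k - r) powr (- \<alpha> - 1) - \<alpha> * (t (Suc k) - r) powr (- \<alpha> - 1)
      \<le> \<alpha> * (t k - s) powr (- \<alpha> - 1) - \<alpha> * (t (Suc k) - s) powr (- \<alpha> - 1)" for r
    by (rule kernel_diff_deriv_mono[OF _ s])
  have "(t (Suc k) - s) powr (- \<alpha> - 1) \<le> (t k - s) powr (- \<alpha> - 1)"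
    using s s' \<alpha> by (intro powr_mono2') auto
  then show "0 \<le> \<alpha> * (t k - s) powr (- \<alpha> - 1) - \<alpha> * (t (Suc k) - s) powr (- \<alpha> - 1)"
    using \<alpha> by auto
  show "0 \<le> kernel_increment k s"
    unfolding kernel_increment_def kernel_def using s s' \<alpha> by (auto intro!: powr_mono2')
next
  show "3 \<le> i \<Longrightarrow> 1 / ((\<rho> (i - 1))\<^sup>2 * (1 + \<rho> (i - 1))) - 3 \<le> 1 / \<rho> i"
    using ratio_lower[of "i - 1"] by simp
qed (use assms in auto)

lemma cell_weight_kernel_mixed:
  assumes "1 \<le> i" "i < k"
  shows "cell_weight t i (kernel (Suc k)) - cell_weight t (i - 1) (kernel (Suc k))
    \<le> cell_weight t i (kernel k) - cell_weight t (i - 1) (kernel k)"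
proof -
  have "kernel_increment k (t (i - 1)) \<le> cell_mean t i (kernel_increment k)
      - cell_moment t i (kernel_increment k) / (\<tau> i * (\<tau> i + \<tau> (Suc i)))"
  proof (rule weighted_cell_mean_ge)
    have s: "s < t k" "s < t (Suc k)" if "s \<in> {t (i - 1)..t i}" for s
      using that mesh_less[OF \<open>i < k\<close>] mesh_less[of i "Suc k"] assms by auto
    then show "continuous_on {t (i - 1)..t i} (kernel_increment k)"
      by (meson DERIV_isCont continuous_at_imp_continuous_on kernel_increment_has_derivative)
    show "s \<in> {t (i - 1)..t i} \<Longrightarrow> kernel_increment k (t (i - 1)) \<le> kernel_increment k s" for s
      using s by (intro kernel_increment_mono) auto
  qed fact
  then show ?thesis
    using cell_weight_kernel_increment_ge[of i k] assms
      cell_weight_kernel_increment[of i k] cell_weight_kernel_increment[of "i - 1" k] by simp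
qed

end

section \<open>The L2 operator as a matrix acting on increments\<close>

lemma deriv_H2:
  assumes "t (j - 1) < t j" "t j < t (Suc j)"
  shows "deriv (H2 t w j) s = (w j - w (j - 1)) / (t j - t (j - 1))
    + (2 * s - t (j - 1) - t j) * (((w (Suc j) - w j) / (t (Suc j) - t j) - (w j - w (j - 1)) / (t j - t (j - 1)))
        / (t (Suc j) - t (j - 1)))"
proof -
  define a b c where "a = t (j - 1)" and "b = t j" and "c = t (Suc j)"
  have abc: "a < b" "b < c" using assms by (auto simp: a_def b_def c_def)
  \<comment> \<open>From Lagrange's form to Newton's: a first divided difference plus the centered
    factor times the second divided difference.\<close>
  have eq: "x * ((2 * s - b - c) / ((a - b) * (a - c))) + y * ((2 * s - a - c) / ((b - a) * (b - c)))
      + z * ((2 * s - a - b) / ((c - a) * (c - b)))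
    = (y - x) / (b - a) + (2 * s - a - b) * (((z - y) / (c - b) - (y - x) / (b - a)) / (c - a))" for x y z
  proof -
    define p q where "p = b - a" and "q = c - b"
    have pq: "0 < p" "0 < q" "p \<noteq> 0" "q \<noteq> 0" "p + q \<noteq> 0" and bc: "b = a + p" "c = a + p + q"
      using abc by (auto simp: p_def q_def)
    have e: "a - b = - p" "a - c = - (p + q)" "b - a = p" "b - c = - q" "c - a = p + q" "c - b = q"
      unfolding bc by simp_all
    show ?thesis unfolding e using pq(3-5)
      by (simp add: divide_simps) (simp add: bc algebra_simps)
  qed
  have q: "((\<lambda>s. A * ((s - p) * (s - q) / d)) has_real_derivative A * ((2 * s - p - q) / d)) (at s)" for A p q d
    by (intro DERIV_cmult DERIV_cdivide) (auto intro!: derivative_eq_intros simp: algebra_simps)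
  have "(H2 t w j has_real_derivative
     (w (j - 1) * ((2 * s - b - c) / ((a - b) * (a - c))) + w j * ((2 * s - a - c) / ((b - a) * (b - c)))
      + w (Suc j) * ((2 * s - a - b) / ((c - a) * (c - b))))) (at s)"
    unfolding H2_def[abs_def] a_def b_def c_def Suc_eq_plus1[symmetric]
    by (intro DERIV_add q)
  then show ?thesis
    unfolding eq by (simp add: DERIV_imp_deriv a_def b_def c_def)
qed

context caputo_mesh begin

text \<open>\<open>kappa\<close> is the natural unit for the entries near the diagonal of the L2 operator.\<close>

definition kappa :: "nat \<Rightarrow> real" where
  "kappa k = \<alpha> * \<tau> k powr - \<alpha> / ((1 - \<alpha>) * (2 - \<alpha>))"

lemma kappa_pos: "1 \<le> k \<Longrightarrow> 0 < kappa k"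
  using \<alpha> step_pos[of k] by (simp add: kappa_def)

lemma cell_mean_kernel_diag:
  assumes "1 \<le> k"
  shows "cell_mean t k (kernel k) = \<tau> k powr - \<alpha> / (1 - \<alpha>)"
proof -
  have "integral {t (k - 1)..t k} (kernel k) = \<tau> k powr (1 - \<alpha>) / (1 - \<alpha>)"
    unfolding kernel_def
    using has_integral_reflected_powr[of "t (k - 1)" "t k" "t k" "- \<alpha>"] mesh_le[of "k - 1" k] \<alpha>
    by (auto simp: has_integral_iff step_def)
  moreover have "\<tau> k powr (1 - \<alpha>) = \<tau> k * \<tau> k powr - \<alpha>"
    using powr_mult_base[of "\<tau> k" "- \<alpha>"] step_pos[OF assms] by simp
  ultimately show ?thesis using step_pos[OF assms] by (simp add: cell_mean_def)
qed

lemma cell_moment_kernel_diag: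
  assumes "1 \<le> k"
  shows "cell_moment t k (kernel k) = kappa k * (\<tau> k)\<^sup>2"
proof -
  have "cell_moment t k (kernel k) = \<tau> k * \<tau> k powr (1 - \<alpha>) / (1 - \<alpha>) - 2 * \<tau> k powr (2 - \<alpha>) / (2 - \<alpha>)"
    unfolding kernel_def cell_moment_def
    using has_integral_centered_mult_reflected_powr[of "t (k - 1)" "t k" "t k" \<alpha>] mesh_le[of "k - 1" k] \<alpha>
    by (auto simp: has_integral_iff step_def)
  moreover have "\<tau> k powr (1 - \<alpha>) = \<tau> k * \<tau> k powr - \<alpha>" "\<tau> k powr (2 - \<alpha>) = (\<tau> k)\<^sup>2 * \<tau> k powr - \<alpha>"
    using powr_add[of "\<tau> k" 1 "- \<alpha>"] powr_add[of "\<tau> k" 2 "- \<alpha>"] step_pos[OF assms] by simp_all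
  ultimately have "cell_moment t k (kernel k) = (\<tau> k)\<^sup>2 * \<tau> k powr - \<alpha> * (1 / (1 - \<alpha>) - 2 / (2 - \<alpha>))"
    by (simp add: algebra_simps power2_eq_square)
  also have "1 / (1 - \<alpha>) - 2 / (2 - \<alpha>) = \<alpha> / ((1 - \<alpha>) * (2 - \<alpha>))"
    using \<alpha> by (simp add: divide_simps)
  finally show ?thesis by (simp add: kappa_def)
qed

text \<open>On the last cell \<open>L2_op\<close> reuses the interpolant of the previous cell; \<open>correction\<close> measures the
  effect on the diagonal. There is none for \<open>k = 1\<close>, where \<open>L2_op\<close> is the L1 formula.\<close>

definition correction :: "nat \<Rightarrow> real" where
  "correction k = (if k = 1 then 0 else kappa k * \<rho> k / (1 + \<rho> k))"

text \<open>The weight of \<open>j = k\<close> pretends that the last cell carries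
  \<open>H2 t w k\<close>, although \<open>w (k + 1)\<close> is not known at level \<open>k\<close>.
  The term \<open>kappa k / (1 + \<rho> (Suc k))\<close> takes this share of the diagonal back, and
  the two terms with \<open>correction k\<close> come from \<open>H2 t w (k - 1)\<close>, which is
  really used there. For \<open>k = 1\<close> the index \<open>k - 2\<close> is 0, and
  \<open>correction\<close> vanishes.\<close>

lemma L2_op_eq:
  assumes k: "1 \<le> k"
  shows "Gamma (1 - \<alpha>) * L2_op \<alpha> t w k =
     (\<Sum>j=1..k. cell_weight t j (kernel k) * (w j - w (j - 1)))
      + (kappa k / (1 + \<rho> (Suc k)) + correction k) * (w k - w (k - 1))
      - \<rho> k * correction k * (w (k - 1) - w (k - 2))"
proof -
  define d where "d j = w j - w (j - 1)" for j
  define D where "D j = (d (Suc j) / \<tau> (Suc j) - d j / \<tau> j) / (\<tau> j + \<tau> (Suc j))" for j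
  define mean where "mean j = cell_mean t j (kernel k)" for j
  define mom where "mom j = cell_moment t j (kernel k)" for j
  have diag: "mom k / (\<tau> k * (\<tau> k + \<tau> (Suc k))) = kappa k / (1 + \<rho> (Suc k))"
  proof -
    have "\<tau> k * (\<tau> k + \<tau> (Suc k)) = (1 + \<rho> (Suc k)) * (\<tau> k)\<^sup>2"
      using step_eq_ratio_mult[of "Suc k"] k by (simp add: algebra_simps power2_eq_square)
    then show ?thesis
      using step_pos[OF k] by (simp add: mom_def cell_moment_kernel_diag[OF k])
  qed
  have G: "Gamma (1 - \<alpha>) \<noteq> 0"
    using \<alpha> by (intro less_imp_neq[symmetric] Gamma_real_pos) auto
  \<comment> \<open>\<open>D j\<close> involves \<open>d j\<close> and \<open>d (Suc j)\<close>, so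
    the moment of cell \<open>j\<close> is shared by the weights \<open>j\<close> and
    \<open>Suc j\<close>. The last moment is cut in half, which leaves the subtracted term.\<close>
  have weights: "(\<Sum>j=1..m. cell_weight t j (kernel k) * d j) =
      (\<Sum>j=1..m. mean j * d j) + (\<Sum>j=1..<m. mom j * D j) - mom m * d m / (\<tau> m * (\<tau> m + \<tau> (Suc m)))" 
    if "1 \<le> m" for m
    using that
  proof (induction m rule: nat_induct_at_least)
    case base
    then show ?case by (simp add: cell_weight_def mean_def mom_def left_diff_distrib)
  next
    case (Suc m)
    have p: "0 < \<tau> m" "0 < \<tau> (Suc m)" using Suc by (auto intro: step_pos)
    have "mom m * D m - mom m * d m / (\<tau> m * (\<tau> m + \<tau> (Suc m))) * (-1)
       = mom m / (\<tau> (Suc m) * (\<tau> m + \<tau> (Suc m))) * d (Suc m)"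
      using p unfolding D_def by (simp add: divide_simps) (simp add: algebra_simps)
    moreover have "{1..<Suc m} = insert m {1..<m}" using Suc by auto
    ultimately show ?case using Suc
      by (simp add: cell_weight_def mean_def[symmetric] mom_def[symmetric] algebra_simps)
  qed
  have cell: "integral {t (j - 1)..t j} (\<lambda>s. deriv (H2 t w i) s / (t k - s) powr \<alpha>) = mean j * d j + mom j * D i"
    if "1 \<le> j" "j \<le> k" "1 \<le> i" "j = i \<or> j = Suc i" for i j
  proof -
    have p: "0 < \<tau> i" "0 < \<tau> (Suc i)" "0 < \<tau> j" using that by (auto intro: step_pos)
    have s: "t (Suc i) - t (i - 1) = \<tau> i + \<tau> (Suc i)" "t i - t (i - 1) = \<tau> i" "t (Suc i) - t i = \<tau> (Suc i)"
      by (auto simp: step_def)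
    have H: "deriv (H2 t w i) s = d i / \<tau> i + (2 * s - t (i - 1) - t i) * D i" for s
      using deriv_H2[of t i w s] that mesh_less[of "i - 1" i] mesh_less[of i "Suc i"]
      unfolding s by (simp add: d_def D_def)
    \<comment> \<open>A quadratic interpolant has the divided difference as mean slope on each of
      its two cells, so its derivative can be centered on either, with the same second divided
      difference.\<close>
    have H': "deriv (H2 t w i) s = d j / \<tau> j + (2 * s - t (j - 1) - t j) * D i" for s
    proof (cases "j = i")
      case False
      then have j: "j = Suc i" using that by simp
      have "d (Suc i) / \<tau> (Suc i) = d i / \<tau> i + (\<tau> i + \<tau> (Suc i)) * D i"
        using p unfolding D_def by simp
      moreover have "\<tau> i + \<tau> (Suc i) = t (Suc i) - t (i - 1)" using s by simp
      ultimately show ?thesis unfolding H j by (simp add: algebra_simps)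
    qed (simp add: H)
    have "cell_integrable t j (kernel k)"
      using that \<alpha> by (intro cell_integrable_kernel) auto
    then have "((\<lambda>s. d j / \<tau> j * kernel k s + (2 * s - t (j - 1) - t j) * kernel k s * D i) has_integral
        d j / \<tau> j * integral {t (j - 1)..t j} (kernel k) + mom j * D i) {t (j - 1)..t j}"
      unfolding cell_integrable_def mom_def cell_moment_def
      by (intro has_integral_add has_integral_mult_left has_integral_mult_right integrable_integral) auto
    moreover have "deriv (H2 t w i) s / (t k - s) powr \<alpha>
        = d j / \<tau> j * kernel k s + (2 * s - t (j - 1) - t j) * kernel k s * D i" for s
      unfolding H' kernel_def by (simp add: powr_minus divide_inverse algebra_simps)
    ultimately show ?thesis
      by (simp add: integral_unique mean_def cell_mean_def)
  qed
  have L: "Gamma (1 - \<alpha>) * L2_op \<alpha> t w k =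
      (\<Sum>j=1..k. mean j * d j) + (\<Sum>j=1..<k. mom j * D j) + (if k = 1 then 0 else mom k * D (k - 1))"
  proof (cases "k = 1")
    case True
    have "Gamma (2 - \<alpha>) = (1 - \<alpha>) * Gamma (1 - \<alpha>)"
    proof -
      have "1 - \<alpha> \<notin> \<int>\<^sub>\<le>\<^sub>0" using \<alpha> by (auto dest: nonpos_Ints_nonpos)
      from Gamma_plus1[OF this] show ?thesis by (simp add: algebra_simps)
    qed
    then show ?thesis
      using G True cell_mean_kernel_diag[of 1] by (simp add: L2_op_def mean_def d_def powr_minus divide_inverse)
  next
    case False
    then have k2: "2 \<le> k" using k by simp
    have "Gamma (1 - \<alpha>) * L2_op \<alpha> t w k = (\<Sum>j=1..k-1. mean j * d j + mom j * D j) + (mean k * d k + mom k * D (k - 1))"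
    proof -
      have "(\<Sum>j=1..k-1. integral {t (j - 1)..t j} (\<lambda>s. deriv (H2 t w j) s / (t k - s) powr \<alpha>))
          = (\<Sum>j=1..k-1. mean j * d j + mom j * D j)"
        using k2 by (intro sum.cong refl cell) (auto simp del: One_nat_def)
      then show ?thesis
        using k2 G cell[of k "k - 1"] unfolding L2_op_def by simp
    qed
    moreover have "{1..k} = insert k {1..k-1}" "{1..<k} = {1..k-1}" using k2 by auto
    ultimately show ?thesis using False k2 by (simp add: sum.distrib)
  qed
  have "(if k = 1 then 0 else mom k * D (k - 1)) = correction k * d k - \<rho> k * correction k * d (k - 1)"
  proof (cases "k = 1")
    case False
    then have k2: "2 \<le> k" using k by simp
    define x h where "x = \<rho> k" and "h = \<tau> (k - 1)"
    have xh: "0 < x" "0 < h" "\<tau> k = x * h"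
      using k2 step_eq_ratio_mult[of k] step_ratio_pos[of k] step_pos[of "k - 1"] by (auto simp: x_def h_def)
    have "mom k * D (k - 1) = kappa k * (x * h)\<^sup>2 * ((d k / (x * h) - d (k - 1) / h) / (h + x * h))"
      using cell_moment_kernel_diag[OF k] k2 by (simp add: mom_def D_def xh h_def)
    also have "\<dots> = kappa k * x / (1 + x) * (d k - x * d (k - 1))"
    proof -
      have "1 + x \<noteq> 0" "h + x * h = h * (1 + x)" using xh by (auto simp: algebra_simps)
      then show ?thesis using xh by (simp add: divide_simps power2_eq_square)
    qed
    finally show ?thesis using False by (simp add: correction_def x_def right_diff_distrib diff_divide_distrib mult_ac)
  qed (simp add: correction_def)
  then have "Gamma (1 - \<alpha>) * L2_op \<alpha> t w k =
     (\<Sum>j=1..k. cell_weight t j (kernel k) * d j)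
      + (kappa k / (1 + \<rho> (Suc k)) + correction k) * d k - \<rho> k * correction k * d (k - 1)"
    unfolding L weights[OF k] diag[symmetric] by (simp add: algebra_simps)
  moreover have "k - 1 - 1 = k - 2" by simp
  ultimately show ?thesis unfolding d_def by simp
qed

end

section \<open>Elementary inequalities\<close>

text \<open>Bernoulli's inequality: the concave power lies below its tangent at 1, here obtained
  from the weighted inequality between arithmetic and geometric means.\<close>

lemma powr_le_chord:
  fixes x :: real
  assumes "0 < x" "0 \<le> \<beta>" "\<beta> \<le> 1"
  shows "x powr \<beta> \<le> 1 + \<beta> * (x - 1)"
  using Youngs_inequality_0[of "\<beta>" "1 - \<beta>" x 1] assms by (simp add: algebra_simps)

lemma ln_2_le: "ln 2 \<le> (25 / 36 :: real)"
proof -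
  \<comment> \<open>Five terms of the exponential series at 25 / 36 already exceed 2, and the
    remainder is nonnegative.\<close>
  obtain s where "exp (25 / 36) = (\<Sum>m<5. (25 / 36 :: real) ^ m / fact m) + exp s / fact 5 * (25 / 36) ^ 5"
    using Maclaurin_exp_le by blast
  moreover have "(\<Sum>m<5. (25 / 36 :: real) ^ m / fact m) \<ge> 2"
    by (simp add: eval_nat_numeral fact_numeral)
  moreover have "0 \<le> exp s / fact 5 * (25 / 36 :: real) ^ 5" by simp
  ultimately have "2 \<le> exp (25 / 36 :: real)" by linarith
  then have "ln 2 \<le> ln (exp (25 / 36 :: real))" by (subst ln_le_cancel_iff) simp_all
  then show ?thesis by simp
qed

text \<open>Taylor's formula for \<open>exp (25 / 36 * \<beta>)\<close> with
  \<open>exp 1 \<le> 3\<close> in the remainder. The coefficients are rounded up, and the fourth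
  power is absorbed into the cube.\<close>

lemma two_powr_le:
  fixes \<beta> :: real
  assumes "0 \<le> \<beta>" "\<beta> \<le> 1"
  shows "2 powr \<beta> \<le> 1 + 139 / 200 * \<beta> + 483 / 2000 * \<beta>\<^sup>2 + 17 / 200 * \<beta> ^ 3"
proof -
  define z where "z = 25 / 36 * \<beta>"
  have z: "0 \<le> z" "z \<le> 1" using assms by (auto simp: z_def)
  obtain s where s: "\<bar>s\<bar> \<le> \<bar>z\<bar>" "exp z = (\<Sum>m<4. z ^ m / fact m) + exp s / fact 4 * z ^ 4"
    using Maclaurin_exp_le by blast
  have "exp s \<le> exp 1" using s(1) z by auto
  then have "exp s \<le> 3" using exp_le by linarith
  then have "exp s / 24 * z ^ 4 \<le> 3 / 24 * z ^ 4"
    by (intro mult_right_mono divide_right_mono) auto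
  then have "exp z \<le> 1 + z + z\<^sup>2 / 2 + z ^ 3 / 6 + z ^ 4 / 8"
    unfolding s(2) by (simp add: eval_nat_numeral fact_numeral)
  also have "\<dots> = 1 + 25 / 36 * \<beta> + (25 / 36)\<^sup>2 / 2 * \<beta>\<^sup>2 + (25 / 36) ^ 3 / 6 * \<beta> ^ 3 + (25 / 36) ^ 4 / 8 * \<beta> ^ 4"
    by (simp add: z_def power_mult_distrib power_divide)
  also have "\<dots> \<le> 1 + 139 / 200 * \<beta> + 483 / 2000 * \<beta>\<^sup>2 + 17 / 200 * \<beta> ^ 3"
  proof -
    have "\<beta> ^ 4 \<le> \<beta> ^ 3" using assms by (intro power_decreasing) auto
    moreover have "0 \<le> \<beta>\<^sup>2" "0 \<le> \<beta> ^ 3" using assms by auto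
    ultimately show ?thesis using assms(1) unfolding power2_eq_square[of "25/36"] power3_eq_cube[of "25/36"] power4_eq_xxxx[of "25/36"] by linarith
  qed
  finally have "exp z \<le> 1 + 139 / 200 * \<beta> + 483 / 2000 * \<beta>\<^sup>2 + 17 / 200 * \<beta> ^ 3" .
  moreover have "2 powr \<beta> \<le> exp z"
    using mult_left_mono[OF ln_2_le assms(1)] by (simp add: powr_def z_def mult.commute)
  ultimately show ?thesis by linarith
qed

text \<open>Here and in the following lemmas \<beta> plays the role of \<open>1 - \<alpha>\<close>.
  The tangent bound for \<open>s powr \<beta>\<close> creates a term with s^2, and
  \<open>s\<^sup>2 \<le> 4 * s + 2\<close> is the precise bound that fits it into the right-hand
  side.\<close>

lemma off_diagonal_bound:
  fixes s :: real
  assumes \<beta>: "0 < \<beta>" "\<beta> < 1" and s: "0 < s" "s\<^sup>2 \<le> 4 * s + 2"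
  shows "s * s powr \<beta> / (1 + s) \<le> 2 * \<beta> / (1 - \<beta>) + (1 + \<beta>) * s / (1 + s)"
proof -
  have "s powr \<beta> \<le> 1 + \<beta> * (s - 1)" using powr_le_chord[of s \<beta>] \<beta> s by simp
  then have "s * s powr \<beta> \<le> s * (1 + \<beta> * (s - 1))" using s by (intro mult_left_mono) auto
  also have "\<dots> \<le> 2 * \<beta> * (1 + s) + (1 + \<beta>) * s"
    using mult_left_mono[OF s(2), of \<beta>] \<beta> by (simp add: algebra_simps power2_eq_square)
  finally have "s * s powr \<beta> / (1 + s) \<le> (2 * \<beta> * (1 + s) + (1 + \<beta>) * s) / (1 + s)"
    using s by (intro divide_right_mono) auto
  also have "\<dots> = 2 * \<beta> + (1 + \<beta>) * s / (1 + s)"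
    using s by (simp add: add_divide_distrib)
  also have "2 * \<beta> \<le> 2 * \<beta> / (1 - \<beta>)"
    using \<beta> by (simp add: field_simps)
  finally show ?thesis by simp
qed

text \<open>As \<open>2 / (1 + s) \<le> 2\<close>, the ratio \<open>x\<close> stays below the
  positive root of x^3 = (4 + 8 x)(1 + x), about 9.33, which 47 / 5 rounds up. In the shifted
  variable \<open>y\<close> the difference of the two sides has only positive coefficients.\<close>

lemma second_ratio_le:
  fixes x s :: real
  assumes "0 < x" "0 < s" "0 \<le> 2 + 2 / (1 + s) + 4 * x / (1 + x) - x ^ 3 / (1 + x)\<^sup>2"
  shows "x \<le> 47 / 5"
proof (rule ccontr)
  assume "\<not> x \<le> 47 / 5"
  define y where "y = x - 47 / 5"
  have y: "0 < y" "x = y + 47 / 5" using \<open>\<not> x \<le> 47 / 5\<close> by (auto simp: y_def)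
  have "2 / (1 + s) \<le> 2" using assms(2) by (simp add: field_simps)
  then have "x ^ 3 / (1 + x)\<^sup>2 \<le> 4 + 4 * x / (1 + x)" using assms by linarith
  also have "\<dots> = (4 + 8 * x) * (1 + x) / (1 + x)\<^sup>2"
  proof -
    have "4 + 4 * x / (1 + x) = (4 + 8 * x) / (1 + x)" using assms(1) by (simp add: field_simps)
    then show ?thesis using assms(1) by (simp add: power2_eq_square)
  qed
  finally have "x ^ 3 \<le> (4 + 8 * x) * (1 + x)"
    using assms(1) by (simp add: divide_le_cancel)
  moreover have "(4 + 8 * x) * (1 + x) < x ^ 3"
  proof -
    have "x ^ 3 - (4 + 8 * x) * (1 + x) = y ^ 3 + 101 / 5 * y\<^sup>2 + 2567 / 25 * y + 863 / 125"
      unfolding y(2) by (simp add: field_simps eval_nat_numeral)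
    moreover have "0 < y ^ 3" "0 < y\<^sup>2" using y by auto
    ultimately show ?thesis using y(1) by linarith
  qed
  ultimately show False by simp
qed

text \<open>A tangent at 1 would be too weak for \<open>x\<close> near 47 / 5, so the power is
  factored as \<open>8 powr \<beta> * (x / 8) powr \<beta>\<close> and the tangent bound is applied
  to the second factor; the first is the cube of \<open>2 powr \<beta>\<close>. \<open>Q\<close> is
  \<open>P ^ 3\<close> with coefficients rounded up and all higher powers merged into the
  fourth.\<close>

lemma first_factor_bound:
  fixes x :: real
  assumes \<beta>: "0 < \<beta>" "\<beta> < 1" and x: "0 < x" "x \<le> 47 / 5"
  shows "x powr \<beta> \<le> (1 / (1 - \<beta>) + \<beta> * (1 + \<beta> / 2) * (x / (1 + x))) * (1 + \<beta> / 2)"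
proof -
  define P where "P = 1 + 139 / 200 * \<beta> + 483 / 2000 * \<beta>\<^sup>2 + 17 / 200 * \<beta> ^ 3"
  define Q where "Q = 1 + 417 / 200 * \<beta> + 1087 / 500 * \<beta>\<^sup>2 + 799 / 500 * \<beta> ^ 3 + 281 / 200 * \<beta> ^ 4"
  have le: "\<beta> ^ n \<le> \<beta> ^ 4" if "4 \<le> n" for n using \<beta> that by (intro power_decreasing) auto
  have nn: "0 \<le> \<beta> ^ n" for n using \<beta> by simp
  have PQ: "P ^ 3 \<le> Q"
  proof -
    have "8000000000 * P ^ 3 = (2000 + 1390 * \<beta> + 483 * \<beta>\<^sup>2 + 170 * \<beta> ^ 3) ^ 3"
    proof -
      have "2000 * P = 2000 + 1390 * \<beta> + 483 * \<beta>\<^sup>2 + 170 * \<beta> ^ 3" by (simp add: P_def)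
      then have "(2000 * P) ^ 3 = (2000 + 1390 * \<beta> + 483 * \<beta>\<^sup>2 + 170 * \<beta> ^ 3) ^ 3" by simp
      then show ?thesis by (simp add: power_mult_distrib)
    qed
    also have "\<dots> = 8000000000 + 16680000000 * \<beta> + 17388600000 * \<beta> ^ 2 + 12782059000 * \<beta> ^ 3 + 7034946900 * \<beta> ^ 4 + 2943506130 * \<beta> ^ 5 + 970875987 * \<beta> ^ 6 + 239490390 * \<beta> ^ 7 + 41876100 * \<beta> ^ 8 + 4913000 * \<beta> ^ 9"
      by (simp add: eval_nat_numeral algebra_simps)
    finally have "8000000000 * P ^ 3 = 8000000000 + 16680000000 * \<beta> + 17388600000 * \<beta> ^ 2 + 12782059000 * \<beta> ^ 3 + 7034946900 * \<beta> ^ 4 + 2943506130 * \<beta> ^ 5 + 970875987 * \<beta> ^ 6 + 239490390 * \<beta> ^ 7 + 41876100 * \<beta> ^ 8 + 4913000 * \<beta> ^ 9" .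
    then show ?thesis unfolding Q_def
      using le[of 5] le[of 6] le[of 7] le[of 8] le[of 9] nn[of 2] nn[of 3] nn[of 4] \<beta> by linarith
  qed
  have factor: "0 < 1 + \<beta> * (x / 8 - 1)"
  proof -
    have "0 < \<beta> * (x / 8)" using \<beta> x by simp
    then show ?thesis using \<beta> by (simp add: right_diff_distrib)
  qed
  have "x powr \<beta> = (2 powr \<beta>) ^ 3 * (x / 8) powr \<beta>"
  proof -
    have "8 powr \<beta> = (2 powr \<beta>) ^ 3"
      by (simp add: power3_eq_cube flip: powr_mult)
    then show ?thesis using powr_mult[of 8 "x / 8" \<beta>] x by simp
  qed
  also have "\<dots> \<le> P ^ 3 * (1 + \<beta> * (x / 8 - 1))"
    using two_powr_le[of \<beta>] powr_le_chord[of "x / 8" \<beta>] \<beta> x nn[of 2] nn[of 3]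
    by (intro mult_mono power_mono) (auto simp: P_def)
  also have "\<dots> \<le> Q * (1 + \<beta> * (x / 8 - 1))"
    using factor by (intro mult_right_mono PQ) simp
  also have "\<dots> \<le> (1 + \<beta> * (1 - \<beta>) * (1 + \<beta> / 2) * (x / (52 / 5))) * (1 + \<beta> / 2) / (1 - \<beta>)"
  proof -
    \<comment> \<open>The difference of the two sides is affine in \<open>x\<close>, so only the end points of the interval matter.\<close>
    define r where "r x = (1 + \<beta> * (1 - \<beta>) * (1 + \<beta> / 2) * (x / (52 / 5))) * (1 + \<beta> / 2)
        - (1 - \<beta>) * Q * (1 + \<beta> * (x / 8 - 1))" for x
    have Q: "1000 * Q = 1000 + 2085 * \<beta> + 2174 * \<beta>\<^sup>2 + 1598 * \<beta> ^ 3 + 1405 * \<beta> ^ 4"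
      by (simp add: Q_def)
    have r0: "0 \<le> r 0"
    proof -
      have "1000 * r 0 = 1000 + 500 * \<beta> - (1 - \<beta>) * (1 - \<beta>) * (1000 * Q)"
        by (simp add: r_def)
      also have "\<dots> = \<beta> * (415 + 996 * \<beta> + 665 * \<beta>\<^sup>2 - 383 * \<beta> ^ 3 + 1212 * \<beta> ^ 4 - 1405 * \<beta> ^ 5)"
        unfolding Q by (simp add: eval_nat_numeral algebra_simps)
      also have "\<dots> \<ge> 0"
      proof (rule mult_nonneg_nonneg)
        have "\<beta> ^ 3 \<le> \<beta>\<^sup>2" "\<beta> ^ 5 \<le> \<beta> ^ 4" "\<beta> ^ 4 \<le> \<beta>\<^sup>2" "\<beta>\<^sup>2 \<le> \<beta>"
          using \<beta> power_decreasing[of 2 3 \<beta>] power_decreasing[of 4 5 \<beta>] power_decreasing[of 2 4 \<beta>]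
            power_decreasing[of 1 2 \<beta>] by auto
        then show "0 \<le> 415 + 996 * \<beta> + 665 * \<beta>\<^sup>2 - 383 * \<beta> ^ 3 + 1212 * \<beta> ^ 4 - 1405 * \<beta> ^ 5"
          using \<beta> nn[of 2] by linarith
      qed (use \<beta> in simp)
      finally show ?thesis by simp
    qed
    have r1: "0 \<le> r (47 / 5)"
    proof -
      have "520000 * r (47 / 5) = 2500 * (104 + 47 * \<beta> * (1 - \<beta>) * (2 + \<beta>)) * (2 + \<beta>)
          - 13 * (1 - \<beta>) * (1000 * Q) * (40 + 7 * \<beta>)"
        by (simp add: r_def algebra_simps) (simp add: field_simps)
      also have "\<dots> = \<beta> * (74800 - 145015 * \<beta> - 61079 * \<beta>\<^sup>2 + 35276 * \<beta> ^ 3 + 748163 * \<beta> ^ 4 + 127855 * \<beta> ^ 5)"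
        unfolding Q by (simp add: eval_nat_numeral algebra_simps)
      also have "\<dots> \<ge> 0"
      proof (rule mult_nonneg_nonneg)
        \<comment> \<open>The bracket is smallest near \<beta> = 2 / 5, so the powers are bounded
          below by tangents there, the fourth power as a function of the square.\<close>
        have "0 \<le> (\<beta>\<^sup>2 - 4 / 25)\<^sup>2" "0 \<le> (\<beta> - 2 / 5)\<^sup>2" by auto
        then have "8 / 25 * \<beta>\<^sup>2 - 16 / 625 \<le> \<beta> ^ 4" "4 / 5 * \<beta> - 4 / 25 \<le> \<beta>\<^sup>2"
          by (auto simp: power2_eq_square power4_eq_xxxx algebra_simps)
        then show "0 \<le> 74800 - 145015 * \<beta> - 61079 * \<beta>\<^sup>2 + 35276 * \<beta> ^ 3 + 748163 * \<beta> ^ 4 + 127855 * \<beta> ^ 5"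
          using \<beta> nn[of 3] nn[of 5] by linarith
      qed (use \<beta> in simp)
      finally show ?thesis by simp
    qed
    have "r x = (1 - x * (5 / 47)) * r 0 + x * (5 / 47) * r (47 / 5)"
      unfolding r_def by (simp add: algebra_simps) (simp add: field_simps)
    also have "\<dots> \<ge> 0" using r0 r1 x by auto
    finally have "0 \<le> r x" .
    then show ?thesis using \<beta> unfolding r_def by (simp add: pos_le_divide_eq mult_ac)
  qed
  also have "\<dots> = (1 / (1 - \<beta>) + \<beta> * (1 + \<beta> / 2) * (x / (52 / 5))) * (1 + \<beta> / 2)"
    using \<beta> by (simp add: field_simps)
  \<comment> \<open>The smaller \<open>x / (52 / 5)\<close> stood in for \<open>x / (1 + x)\<close>
    to keep the comparison affine; 52 / 5 is the largest value of \<open>1 + x\<close>.\<close>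
  also have "\<dots> \<le> (1 / (1 - \<beta>) + \<beta> * (1 + \<beta> / 2) * (x / (1 + x))) * (1 + \<beta> / 2)"
    using \<beta> x by (intro mult_right_mono add_left_mono mult_left_mono divide_left_mono) auto
  finally show ?thesis .
qed

text \<open>The method of \<open>first_factor_bound\<close> around 4, since \<open>s\<close> is at
  most 2 + sqrt 6 < 89 / 20. With \<open>1 / (1 - \<beta>)\<close> replaced by
  \<open>1 + \<beta> + \<beta>\<^sup>2\<close>, and \<open>1 + 2 * x / (1 + x)\<close> by 281 / 100,
  a factor \<beta> cancels. What remains is \<open>0 \<le> q s\<close>, where \<open>q\<close> is
  concave, so that it suffices to look at 0 and 89 / 20.\<close>

lemma second_factor_bound:
  fixes x s :: real
  assumes \<beta>: "0 < \<beta>" "\<beta> < 1" and x: "0 < x" "x \<le> 47 / 5" and s: "0 < s" "s\<^sup>2 \<le> 4 * s + 2"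
  defines "B \<equiv> 1 + 2 * x / (1 + x) + 1 / (1 + s)"
  shows "(1 + \<beta> / 2) * B \<le> B + 2 * \<beta> / (1 - \<beta>) + s * (1 + \<beta> - s powr \<beta>) / (1 + s)"
proof -
  have s45: "s \<le> 89 / 20"
  proof (rule ccontr)
    assume "\<not> s \<le> 89 / 20"
    then have "9 / 20 * (89 / 20) < (s - 4) * s" by (intro mult_strict_mono) auto
    then show False using s by (simp add: power2_eq_square algebra_simps)
  qed
  have nn: "0 \<le> \<beta>\<^sup>2" "0 \<le> \<beta> ^ 3" "0 \<le> \<beta> ^ 4" using \<beta> by auto
  have le: "\<beta>\<^sup>2 \<le> \<beta>" "\<beta> ^ 3 \<le> \<beta>\<^sup>2" "\<beta> ^ 4 \<le> \<beta>\<^sup>2"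
    using \<beta> power_decreasing[of 2 3 \<beta>] power_decreasing[of 2 4 \<beta>]
          power_decreasing[of 1 2 \<beta>] by auto
  have T: "2 powr \<beta> \<le> 1 + 7 / 10 * \<beta> + 33 / 100 * \<beta>\<^sup>2"
    using two_powr_le[of \<beta>] \<beta> nn(1) le(2) by linarith
  have T2: "(2 powr \<beta>)\<^sup>2 \<le> 1 + 7 / 5 * \<beta> + 173 / 100 * \<beta>\<^sup>2"
  proof -
    have "(2 powr \<beta>)\<^sup>2 \<le> (1 + 7 / 10 * \<beta> + 33 / 100 * \<beta>\<^sup>2)\<^sup>2" by (intro power_mono T) simp
    also have "\<dots> = 1 + 7 / 5 * \<beta> + 23 / 20 * \<beta>\<^sup>2 + 231 / 500 * \<beta> ^ 3 + 1089 / 10000 * \<beta> ^ 4"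
      by (simp add: eval_nat_numeral algebra_simps)
    also have "\<dots> \<le> 1 + 7 / 5 * \<beta> + 173 / 100 * \<beta>\<^sup>2" using nn(1) le by linarith
    finally show ?thesis .
  qed
  have factor: "0 < 1 + \<beta> * (s / 4 - 1)"
  proof -
    have "0 < \<beta> * (s / 4)" using \<beta> s by simp
    then show ?thesis using \<beta> by (simp add: right_diff_distrib)
  qed
  have "s powr \<beta> = (2 powr \<beta>)\<^sup>2 * (s / 4) powr \<beta>"
  proof -
    have "4 powr \<beta> = (2 powr \<beta>)\<^sup>2"
      by (simp add: power2_eq_square flip: powr_mult)
    then show ?thesis using powr_mult[of 4 "s / 4" \<beta>] s by simp
  qed
  also have "\<dots> \<le> (1 + 7 / 5 * \<beta> + 173 / 100 * \<beta>\<^sup>2) * (1 + \<beta> * (s / 4 - 1))"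
    using T2 powr_le_chord[of "s / 4" \<beta>] \<beta> s nn by (intro mult_mono) auto
  finally have sp: "s powr \<beta> \<le> (1 + 7 / 5 * \<beta> + 173 / 100 * \<beta>\<^sup>2) * (1 + \<beta> * (s / 4 - 1))" .
  define q where "q s = 2 * (1 + s) * (1 + \<beta> + \<beta>\<^sup>2)
      + s * (- (2 / 5) - (173 / 100 * \<beta> + (s / 4 - 1) * (1 + 7 / 5 * \<beta> + 173 / 100 * \<beta>\<^sup>2))) - (281 / 100 * (1 + s) + 1) / 2" for s
  have q0: "0 \<le> q 0" unfolding q_def using \<beta> nn by simp
  have q1: "0 \<le> q (89 / 20)" unfolding q_def using \<beta> nn(1) le(1) by (simp add: algebra_simps; linarith)
  \<comment> \<open>Linear interpolation between the endpoints, plus the nonnegative term due to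
    concavity.\<close>
  have "q s = (1 - s * (20 / 89)) * q 0 + s * (20 / 89) * q (89 / 20) + s * (89 / 20 - s) / 4 * (1 + 7 / 5 * \<beta> + 173 / 100 * \<beta>\<^sup>2)"
    unfolding q_def by (simp add: algebra_simps) (simp add: field_simps)
  also have "\<dots> \<ge> 0" using q0 q1 s s45 \<beta> by auto
  finally have "0 \<le> q s" .
  then have main: "\<beta> / 2 * (281 / 100 * (1 + s) + 1) \<le> 2 * \<beta> * (1 + \<beta> + \<beta>\<^sup>2) * (1 + s) + s * (1 + \<beta> - s powr \<beta>)"
  proof -
    define c z Y where "c = 7 / 5 + 173 / 100 * \<beta>" and "z = s / 4 - 1" and "Y = 1 + \<beta> * c"
    have Y: "1 + 7 / 5 * \<beta> + 173 / 100 * \<beta>\<^sup>2 = Y"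
      by (simp add: Y_def c_def algebra_simps power2_eq_square)
    have q: "q s = 2 * (1 + s) * (1 + \<beta> + \<beta>\<^sup>2) + s * (1 - c - z * Y) - (281 / 100 * (1 + s) + 1) / 2"
      unfolding q_def Y z_def[symmetric] by (simp add: c_def)
    have "1 + \<beta> - Y * (1 + \<beta> * z) = \<beta> * (1 - c - z * Y)"
      by (simp add: Y_def algebra_simps)
    moreover have "s * (1 + \<beta> - Y * (1 + \<beta> * z)) \<le> s * (1 + \<beta> - s powr \<beta>)"
      using sp s unfolding Y z_def by (intro mult_left_mono) auto
    moreover have "0 \<le> \<beta> * q s" using \<beta> \<open>0 \<le> q s\<close> by simp
    moreover have "\<beta> * q s = 2 * \<beta> * (1 + \<beta> + \<beta>\<^sup>2) * (1 + s) + s * (\<beta> * (1 - c - z * Y))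
        - \<beta> / 2 * (281 / 100 * (1 + s) + 1)"
    proof -
      have "\<beta> * (2 * (1 + s) * g + s * v - h / 2) = 2 * \<beta> * g * (1 + s) + s * (\<beta> * v) - \<beta> / 2 * h" for g v h
        by (simp add: algebra_simps)
      then show ?thesis unfolding q .
    qed
    ultimately show ?thesis by simp
  qed
  have "x / (1 + x) \<le> 113 / 125" using x by (simp add: field_simps)
  then have "B \<le> 281 / 100 + 1 / (1 + s)" unfolding B_def by simp
  also have "\<dots> = (281 / 100 * (1 + s) + 1) / (1 + s)" using s by (simp add: field_simps)
  finally have "\<beta> / 2 * B \<le> \<beta> / 2 * ((281 / 100 * (1 + s) + 1) / (1 + s))"
    using \<beta> by (intro mult_left_mono) auto
  also have "\<dots> \<le> (2 * \<beta> * (1 + \<beta> + \<beta>\<^sup>2) * (1 + s) + s * (1 + \<beta> - s powr \<beta>)) / (1 + s)"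
    using divide_right_mono[OF main, of "1 + s"] s by simp
  also have "\<dots> = 2 * \<beta> * (1 + \<beta> + \<beta>\<^sup>2) + s * (1 + \<beta> - s powr \<beta>) / (1 + s)"
    using s by (simp add: add_divide_distrib)
  also have "2 * \<beta> * (1 + \<beta> + \<beta>\<^sup>2) \<le> 2 * \<beta> / (1 - \<beta>)"
  proof -
    have "(1 + \<beta> + \<beta>\<^sup>2) * (1 - \<beta>) \<le> 1" using nn by (simp add: algebra_simps power2_eq_square power3_eq_cube)
    then have "2 * \<beta> * ((1 + \<beta> + \<beta>\<^sup>2) * (1 - \<beta>)) \<le> 2 * \<beta> * 1" using \<beta> by (intro mult_left_mono) auto
    then show ?thesis using \<beta> by (simp add: pos_le_divide_eq mult_ac)
  qed
  finally show ?thesis by (simp add: algebra_simps)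
qed

text \<open>By \<open>cond\<close> the fraction on the left is at most \<open>2 * B\<close>, so a
  factor \<open>x powr \<beta>\<close> has to be absorbed. The work is divided by means of
  \<open>1 + \<beta> / 2\<close>: the first factor on the right absorbs
  \<open>x powr \<beta>\<close> up to this number, and the second factor absorbs the number.\<close>

lemma leading_block_determinant:
  fixes x s :: real
  assumes \<beta>: "0 < \<beta>" "\<beta> < 1" and x: "0 < x" and s: "0 < s" "s\<^sup>2 \<le> 4 * s + 2"
    and cond: "0 \<le> 2 + 2 / (1 + s) + 4 * x / (1 + x) - x ^ 3 / (1 + x)\<^sup>2"
  shows "x powr \<beta> * (x ^ 3 / (1 + x)\<^sup>2)
    \<le> (2 / (1 - \<beta>) + \<beta> * (2 + \<beta>) * (x / (1 + x)))
      * (1 + 2 * x / (1 + x) + 1 / (1 + s) + 2 * \<beta> / (1 - \<beta>) + s * (1 + \<beta> - s powr \<beta>) / (1 + s))"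
proof -
  define B where "B = 1 + 2 * x / (1 + x) + 1 / (1 + s)"
  define A where "A = 1 / (1 - \<beta>) + \<beta> * (1 + \<beta> / 2) * (x / (1 + x))"
  have x94: "x \<le> 47 / 5" using second_ratio_le[OF x s(1) cond] .
  have B0: "0 \<le> B" unfolding B_def using x s by simp
  have A0: "0 \<le> A" unfolding A_def using x \<beta> by simp
  have "x powr \<beta> * (x ^ 3 / (1 + x)\<^sup>2) \<le> x powr \<beta> * (2 * B)"
    using cond unfolding B_def by (intro mult_left_mono) auto
  also have "\<dots> \<le> (A * (1 + \<beta> / 2)) * (2 * B)"
    unfolding A_def using B0 by (intro mult_right_mono first_factor_bound \<beta> x x94) auto
  also have "\<dots> = 2 * A * ((1 + \<beta> / 2) * B)" by simp
  also have "\<dots> \<le> 2 * A * (B + 2 * \<beta> / (1 - \<beta>) + s * (1 + \<beta> - s powr \<beta>) / (1 + s))"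
    unfolding B_def using A0 by (intro mult_left_mono second_factor_bound \<beta> x x94 s) auto
  also have "2 * A = 2 / (1 - \<beta>) + \<beta> * (2 + \<beta>) * (x / (1 + x))"
    unfolding A_def distrib_left by (simp add: mult_ac)
  finally show ?thesis unfolding B_def .
qed

section \<open>Positivity of the L2 operator\<close>

lemma binary_form_nonneg:
  fixes p q r x y :: real
  assumes "0 \<le> p" "0 \<le> q" "r\<^sup>2 \<le> p * q"
  shows "2 * r * y * x \<le> p * x\<^sup>2 + q * y\<^sup>2"
proof (cases "p = 0")
  case True
  then show ?thesis using assms by simp
next
  case False
  have "0 \<le> (p * x - r * y)\<^sup>2 + (p * q - r\<^sup>2) * y\<^sup>2" using assms by simp
  also have "\<dots> = p * (p * x\<^sup>2 + q * y\<^sup>2 - 2 * r * y * x)"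
    by (simp add: power2_eq_square algebra_simps)
  finally show ?thesis using False assms by (simp add: zero_le_mult_iff)
qed

text \<open>The induction carries the surplus \<open>off (Suc n) * (d n)\<^sup>2\<close>, with which
  row \<open>n\<close> pays its share of the next mixed term. Rows 1 and 2 enter together, through
  their determinant.\<close>

lemma tridiagonal_form_nonneg:
  fixes R off d :: "nat \<Rightarrow> real"
  assumes "off 1 = 0" and off: "\<And>k. 3 \<le> k \<Longrightarrow> 0 \<le> off k"
    and R: "\<And>k. 3 \<le> k \<Longrightarrow> off k + off (Suc k) \<le> R k"
    and R1: "0 \<le> R 1" and R2: "0 \<le> R 2 - off 3" and det: "(off 2)\<^sup>2 \<le> R 1 * (R 2 - off 3)"
  shows "0 \<le> (\<Sum>k=1..n. R k * (d k)\<^sup>2 - 2 * off k * d k * d (k - 1))"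
proof (cases "2 \<le> n")
  case True
  then have "off (Suc n) * (d n)\<^sup>2 \<le> (\<Sum>k=1..n. R k * (d k)\<^sup>2 - 2 * off k * d k * d (k - 1))"
  proof (induction n rule: nat_induct_at_least)
    case base
    have "{1..2::nat} = {1, 2}" by auto
    then show ?case
      using binary_form_nonneg[OF R1 R2 det, of "d 2" "d 1"] \<open>off 1 = 0\<close>
      by (simp add: numeral_2_eq_2 numeral_3_eq_3 algebra_simps)
  next
    case (Suc n)
    have "2 * (off (Suc n) * d (Suc n) * d n) \<le> off (Suc n) * (d n)\<^sup>2 + off (Suc n) * (d (Suc n))\<^sup>2"
      using binary_form_nonneg[of "off (Suc n)" "off (Suc n)" "off (Suc n)" "d (Suc n)" "d n"] off[of "Suc n"] Suc
      by (simp add: power2_eq_square)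
    moreover have "(off (Suc n) + off (Suc (Suc n))) * (d (Suc n))\<^sup>2 \<le> R (Suc n) * (d (Suc n))\<^sup>2"
      using R[of "Suc n"] Suc by (intro mult_right_mono) auto
    ultimately show ?case using Suc by (simp add: algebra_simps)
  qed
  moreover have "0 \<le> off (Suc n) * (d n)\<^sup>2" using off[of "Suc n"] True by simp
  ultimately show ?thesis by linarith
next
  case False
  then have "n = 0 \<or> n = 1" by auto
  then show ?thesis using R1 \<open>off 1 = 0\<close> by auto
qed

text \<open>The density has numerator \<open>(v + h - s) + (v - s)\<close>. In a share \<alpha> of
  the second summand the kernel is replaced by the larger \<open>(v - s) powr - \<alpha>\<close>;
  the share 1 - \<alpha> combines with the first summand to the exact derivative of
  \<open>- ((v - s) * (v + h - s) powr (1 - \<alpha>))\<close>.\<close>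

lemma weighted_mean_shifted_powr_le:
  fixes \<alpha> :: real
  assumes \<alpha>: "0 < \<alpha>" "\<alpha> < 1" and "u < v" "0 < h"
  shows "integral {u..v} (\<lambda>s. (v + h - s) powr - \<alpha>) / (v - u)
      - integral {u..v} (\<lambda>s. (2 * s - u - v) * (v + h - s) powr - \<alpha>) / ((v - u) * ((v - u) + h))
    \<le> ((v - u) + h) powr - \<alpha> + \<alpha> * (v - u) powr (1 - \<alpha>) / ((2 - \<alpha>) * ((v - u) + h))"
proof -
  define l where "l = v - u"
  have l: "0 < l" using assms by (simp add: l_def)
  let ?k = "\<lambda>s. (v + h - s) powr - \<alpha>"
  let ?g = "\<lambda>s. (v + h - s) powr (1 - \<alpha>) + (v - s) * ((1 - \<alpha>) * (v + h - s) powr - \<alpha>) + \<alpha> * (v - s) powr (1 - \<alpha>)"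
  have int: "?k integrable_on {u..v}" "(\<lambda>s. (2 * s - u - v) * ?k s) integrable_on {u..v}"
    using has_integral_reflected_powr[of u v "v + h" "- \<alpha>"]
      has_integral_centered_mult_reflected_powr[of u v "v + h" \<alpha>] assms by (auto simp: has_integral_iff)
  have "((\<lambda>s. (l + h) * ?k s - (2 * s - u - v) * ?k s) has_integral
      (l + h) * integral {u..v} ?k - integral {u..v} (\<lambda>s. (2 * s - u - v) * ?k s)) {u..v}"
    by (intro has_integral_diff has_integral_mult_right integrable_integral int)
  moreover have "(?g has_integral l * (l + h) powr (1 - \<alpha>) + \<alpha> * l powr (2 - \<alpha>) / (2 - \<alpha>)) {u..v}"
  proof -
    have "(?g has_integral
        - ((v - v) * (v + h - v) powr (1 - \<alpha>) + \<alpha> * (v - v) powr (2 - \<alpha>) / (2 - \<alpha>))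
        - (- ((v - u) * (v + h - u) powr (1 - \<alpha>) + \<alpha> * (v - u) powr (2 - \<alpha>) / (2 - \<alpha>)))) {u..v}"
    proof (rule fundamental_theorem_of_calculus_interior)
      show "continuous_on {u..v} (\<lambda>s. - ((v - s) * (v + h - s) powr (1 - \<alpha>) + \<alpha> * (v - s) powr (2 - \<alpha>) / (2 - \<alpha>)))"
        using assms by (intro continuous_intros continuous_on_powr') auto
      fix s assume "s \<in> {u<..<v}"
      then have s: "s < v" "0 < v + h - s" using assms by auto
      have "(1 - \<alpha>) * (v + h - s) powr - \<alpha> * (v - s) = (v - s) * ((1 - \<alpha>) * (v + h - s) powr - \<alpha>)" by simp
      then show "((\<lambda>s. - ((v - s) * (v + h - s) powr (1 - \<alpha>) + \<alpha> * (v - s) powr (2 - \<alpha>) / (2 - \<alpha>)))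
          has_vector_derivative ?g s) (at s)"
        unfolding has_real_derivative_iff_has_vector_derivative[symmetric] using s assms
        by (auto intro!: derivative_eq_intros)
    qed (use assms in auto)
    then show ?thesis using assms by (simp add: l_def algebra_simps)
  qed
  moreover have "(l + h) * ?k s - (2 * s - u - v) * ?k s \<le> ?g s" if s: "s \<in> {u..v}" for s
  proof -
    have p: "0 < v + h - s" using s assms by auto
    have "(v + h - s) powr (1 - \<alpha>) = (v + h - s) * ?k s"
      using powr_mult_base[of "v + h - s" "- \<alpha>"] p by simp
    moreover have "(v - s) * ?k s \<le> (v - s) powr (1 - \<alpha>)"
    proof (cases "s = v")
      case False
      then have "(v - s) powr (1 - \<alpha>) = (v - s) * (v - s) powr - \<alpha>"
        using powr_mult_base[of "v - s" "- \<alpha>"] s by simp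
      moreover have "?k s \<le> (v - s) powr - \<alpha>"
        using s False assms by (intro powr_mono2') auto
      ultimately show ?thesis using s by (simp add: mult_left_mono)
    qed simp
    then have "\<alpha> * ((v - s) * ?k s) \<le> \<alpha> * (v - s) powr (1 - \<alpha>)"
      using \<alpha> by (intro mult_left_mono) auto
    ultimately show ?thesis by (simp add: l_def algebra_simps)
  qed
  ultimately have "(l + h) * integral {u..v} ?k - integral {u..v} (\<lambda>s. (2 * s - u - v) * ?k s)
      \<le> l * (l + h) powr (1 - \<alpha>) + \<alpha> * l powr (2 - \<alpha>) / (2 - \<alpha>)"
    by (rule has_integral_le)
  then have "((l + h) * integral {u..v} ?k - integral {u..v} (\<lambda>s. (2 * s - u - v) * ?k s)) / (l * (l + h))
      \<le> (l * (l + h) powr (1 - \<alpha>) + \<alpha> * l powr (2 - \<alpha>) / (2 - \<alpha>)) / (l * (l + h))"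
    using l assms by (intro divide_right_mono) auto
  also have "(l * (l + h) powr (1 - \<alpha>) + \<alpha> * l powr (2 - \<alpha>) / (2 - \<alpha>)) / (l * (l + h))
      = (l + h) powr - \<alpha> + \<alpha> * l powr (1 - \<alpha>) / ((2 - \<alpha>) * (l + h))"
  proof -
    have "l powr (2 - \<alpha>) = l * l powr (1 - \<alpha>)" "(l + h) powr (1 - \<alpha>) = (l + h) * (l + h) powr - \<alpha>"
      using powr_mult_base[of l "1 - \<alpha>"] powr_mult_base[of "l + h" "- \<alpha>"] l assms by simp_all
    moreover have "l + h \<noteq> 0" "2 - \<alpha> \<noteq> 0" "l \<noteq> 0" using l assms by auto
    ultimately show ?thesis by (simp add: add_divide_distrib)
  qed
  also have "((l + h) * integral {u..v} ?k - integral {u..v} (\<lambda>s. (2 * s - u - v) * ?k s)) / (l * (l + h))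
     = integral {u..v} ?k / l - integral {u..v} (\<lambda>s. (2 * s - u - v) * ?k s) / (l * (l + h))"
    using l assms by (simp add: diff_divide_distrib)
  finally show ?thesis by (simp add: l_def)
qed

section \<open>Lower bounds for the diagonal entries\<close>

context caputo_mesh begin

lemma kappa_powr: "\<tau> k powr - \<alpha> = kappa k * ((1 - \<alpha>) * (2 - \<alpha>) / \<alpha>)"
  using \<alpha> by (simp add: kappa_def)

lemma kappa_Suc: "1 \<le> k \<Longrightarrow> kappa (Suc k) = kappa k * \<rho> (Suc k) powr - \<alpha>"
  using step_eq_ratio_mult[of "Suc k"] step_ratio_pos[of "Suc k"] step_nonneg[of k]
  by (simp add: kappa_def powr_mult)

text \<open>The part with \<open>kernel k\<close> is exact, and only \<open>kernel (Suc k)\<close>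
  is estimated. The power of \<open>\<tau> k + \<tau> (Suc k)\<close> in that estimate cancels
  against the one in \<open>kernel_increment k (t (k - 1))\<close>, so that just
  \<open>kappa k\<close> times a rational function of the next ratio is left.\<close>

lemma cell_kernel_increment_diag_ge:
  assumes k: "1 \<le> k"
  shows "kappa k * ((2 - \<alpha>) * \<rho> (Suc k) / (1 + \<rho> (Suc k)))
    \<le> cell_mean t k (kernel_increment k) - cell_moment t k (kernel_increment k) / (\<tau> k * (\<tau> k + \<tau> (Suc k)))
      - kernel_increment k (t (k - 1))"
proof -
  define x where "x = \<rho> (Suc k)"
  have x: "0 < x" "\<tau> (Suc k) = x * \<tau> k"
    using step_ratio_pos[of "Suc k"] step_eq_ratio_mult[of "Suc k"] k by (auto simp: x_def)
  have pos: "0 < \<tau> k" using k by (rule step_pos)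
  have steps: "t k - t (k - 1) = \<tau> k" "t k + \<tau> (Suc k) = t (Suc k)" "t (Suc k) - t (k - 1) = \<tau> k + \<tau> (Suc k)"
    by (auto simp: step_def)
  have next_le: "cell_mean t k (kernel (Suc k)) - cell_moment t k (kernel (Suc k)) / (\<tau> k * (\<tau> k + \<tau> (Suc k)))
      \<le> (\<tau> k + \<tau> (Suc k)) powr - \<alpha> + \<alpha> * \<tau> k powr (1 - \<alpha>) / ((2 - \<alpha>) * (\<tau> k + \<tau> (Suc k)))"
    using weighted_mean_shifted_powr_le[of \<alpha> "t (k - 1)" "t k" "\<tau> (Suc k)"] \<alpha> step_pos[of "Suc k"] mesh_less[of "k - 1" k] k
    unfolding steps by (simp add: cell_mean_def cell_moment_def kernel_def[abs_def])
  have "\<tau> k powr (1 - \<alpha>) = \<tau> k * \<tau> k powr - \<alpha>"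
    using powr_mult_base[of "\<tau> k" "- \<alpha>"] pos by simp
  then have "\<alpha> * \<tau> k powr (1 - \<alpha>) / ((2 - \<alpha>) * (\<tau> k + \<tau> (Suc k))) = \<alpha> * (\<tau> k * \<tau> k powr - \<alpha>) / ((2 - \<alpha>) * ((1 + x) * \<tau> k))"
    by (simp add: x algebra_simps)
  also have "\<dots> = kappa k * ((1 - \<alpha>) / (1 + x))"
    using pos x \<alpha> by (simp add: kappa_def)
  finally have e1: "\<alpha> * \<tau> k powr (1 - \<alpha>) / ((2 - \<alpha>) * (\<tau> k + \<tau> (Suc k))) = kappa k * ((1 - \<alpha>) / (1 + x))" .
  have "cell_moment t k (kernel k) / (\<tau> k * (\<tau> k + \<tau> (Suc k))) = kappa k * (\<tau> k)\<^sup>2 / ((1 + x) * (\<tau> k)\<^sup>2)"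
    unfolding cell_moment_kernel_diag[OF k] by (simp add: x algebra_simps power2_eq_square)
  then have e2: "cell_moment t k (kernel k) / (\<tau> k * (\<tau> k + \<tau> (Suc k))) = kappa k / (1 + x)"
    using pos by simp
  have e3: "cell_mean t k (kernel k) = kappa k * ((2 - \<alpha>) / \<alpha>)"
    unfolding cell_mean_kernel_diag[OF k] kappa_powr using \<alpha> by simp
  have e4: "kernel_increment k (t (k - 1)) = kappa k * ((1 - \<alpha>) * (2 - \<alpha>) / \<alpha>) - (\<tau> k + \<tau> (Suc k)) powr - \<alpha>"
    unfolding kernel_increment_def kernel_def steps kappa_powr ..
  have int: "cell_integrable t k (kernel k)" "cell_integrable t k (kernel (Suc k))"
    by (auto intro: cell_integrable_kernel)
  have "cell_mean t k (kernel_increment k) - cell_moment t k (kernel_increment k) / (\<tau> k * (\<tau> k + \<tau> (Suc k)))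
      - kernel_increment k (t (k - 1))
    = (cell_mean t k (kernel k) - cell_moment t k (kernel k) / (\<tau> k * (\<tau> k + \<tau> (Suc k))))
    - (cell_mean t k (kernel (Suc k)) - cell_moment t k (kernel (Suc k)) / (\<tau> k * (\<tau> k + \<tau> (Suc k))))
    - kernel_increment k (t (k - 1))"
    unfolding kernel_increment_def[abs_def] cell_mean_diff[OF int] cell_moment_diff[OF int]
    by (simp add: diff_divide_distrib)
  also have "\<dots> \<ge> kappa k * ((2 - \<alpha>) / \<alpha>) - kappa k / (1 + x) - kappa k * ((1 - \<alpha>) / (1 + x))
      - kappa k * ((1 - \<alpha>) * (2 - \<alpha>) / \<alpha>)"
    using next_le unfolding e1 e2 e3 e4 by simp
  also have "kappa k * ((2 - \<alpha>) / \<alpha>) - kappa k / (1 + x) - kappa k * ((1 - \<alpha>) / (1 + x))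
      - kappa k * ((1 - \<alpha>) * (2 - \<alpha>) / \<alpha>)
     = kappa k * ((2 - \<alpha>) / \<alpha> - 1 / (1 + x) - (1 - \<alpha>) / (1 + x) - (1 - \<alpha>) * (2 - \<alpha>) / \<alpha>)"
    by (simp add: algebra_simps)
  also have "(2 - \<alpha>) / \<alpha> - 1 / (1 + x) - (1 - \<alpha>) / (1 + x) - (1 - \<alpha>) * (2 - \<alpha>) / \<alpha> = (2 - \<alpha>) * x / (1 + x)"
    using \<alpha> x by (simp add: divide_simps) (simp add: algebra_simps)
  finally show ?thesis unfolding x_def .
qed

text \<open>The added term cancels the fictitious moment of the last cell; besides the mean there
  remains the moment of cell \<open>k - 1\<close>, nonnegative because the kernel increases.\<close>

lemma cell_weight_kernel_diag_ge:
  assumes k: "1 \<le> k"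
  shows "kappa k * ((2 - \<alpha>) / \<alpha>) \<le> cell_weight t k (kernel k) + kappa k / (1 + \<rho> (Suc k))"
proof -
  have pos: "0 < \<tau> k" using k by (rule step_pos)
  have "\<tau> k * (\<tau> k + \<tau> (Suc k)) = (1 + \<rho> (Suc k)) * (\<tau> k)\<^sup>2"
    using step_eq_ratio_mult[of "Suc k"] k by (simp add: algebra_simps power2_eq_square)
  then have e: "cell_moment t k (kernel k) / (\<tau> k * (\<tau> k + \<tau> (Suc k))) = kappa k / (1 + \<rho> (Suc k))"
    using pos by (simp add: cell_moment_kernel_diag[OF k])
  have m: "cell_mean t k (kernel k) = kappa k * ((2 - \<alpha>) / \<alpha>)"
    unfolding cell_mean_kernel_diag[OF k] kappa_powr using \<alpha> by simp
  have "0 \<le> cell_moment t (k - 1) (kernel k)"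
  proof -
    have s: "s < t k" if "s \<in> {t (k - 1 - 1)..t (k - 1)}" for s
      using that mesh_less[of "k - 1" k] k by auto
    have "continuous_on {t (k - 1 - 1)..t (k - 1)} (kernel k)"
      using s by (meson DERIV_isCont continuous_at_imp_continuous_on kernel_has_derivative)
    moreover have "mono_on {t (k - 1 - 1)..t (k - 1)} (kernel k)"
      using s by (intro mono_onI kernel_mono) auto
    ultimately show ?thesis
      unfolding cell_moment_def by (intro integral_centered_mult_mono mesh_le) auto
  qed
  then have "0 \<le> cell_moment t (k - 1) (kernel k) / (\<tau> k * (\<tau> (k - 1) + \<tau> k))"
    using pos step_nonneg by (intro divide_nonneg_nonneg mult_nonneg_nonneg add_nonneg_nonneg) auto
  then show ?thesis unfolding cell_weight_def e m by simp
qed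

end

context admissible_mesh begin

text \<open>Up to the factor \<open>Gamma (1 - \<alpha>)\<close>, the coefficient left for
  \<open>(d k)\<^sup>2\<close> in twice the form: the mixed difference kept by
  \<open>quadratic_form_lower_bound\<close>, the entry that the Abel form subtracts, and twice the
  diagonal corrections of \<open>L2_op_eq\<close>.\<close>

definition diagonal :: "nat \<Rightarrow> real" where
  "diagonal k = (cell_weight t k (kernel k) - cell_weight t (k - 1) (kernel k))
     - (cell_weight t k (kernel (Suc k)) - cell_weight t (k - 1) (kernel (Suc k)))
     + cell_weight t k (kernel k) + 2 * (kappa k / (1 + \<rho> (Suc k)) + correction k)"

lemma diagonal_eq:
  "diagonal k = (cell_weight t k (kernel_increment k) - cell_weight t (k - 1) (kernel_increment k))
     + (cell_weight t k (kernel k) + kappa k / (1 + \<rho> (Suc k))) + kappa k / (1 + \<rho> (Suc k)) + 2 * correction k"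
  using cell_weight_kernel_increment[of k k] cell_weight_kernel_increment[of "k - 1" k]
  by (simp add: diagonal_def)

lemma diagonal_ge:
  assumes k: "1 \<le> k"
  shows "kappa k * ((2 - \<alpha>) / \<alpha> + (2 - \<alpha>) * \<rho> (Suc k) / (1 + \<rho> (Suc k)) + 1 / (1 + \<rho> (Suc k))) + 2 * correction k
    \<le> diagonal k"
  using cell_kernel_increment_diag_ge[OF k] cell_weight_kernel_increment_ge[of k k]
    cell_weight_kernel_diag_ge[OF k] k
  unfolding diagonal_eq by (simp add: distrib_left)

text \<open>Row 1 has no preceding cell, so \<open>kernel_increment 1 (t 0)\<close>, given away in
  \<open>diagonal_ge\<close>, can be kept. Its contribution
  \<open>(1 - \<alpha>) * (2 - \<alpha>)\<close> times \<open>\<rho> 2 / (1 + \<rho> 2)\<close>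
  enters the determinant estimate.\<close>

lemma first_diagonal_ge:
  "kappa 1 * (2 / \<alpha> + (1 - \<alpha>) * (3 - \<alpha>) * (\<rho> 2 / (1 + \<rho> 2))) \<le> diagonal 1"
proof -
  define x where "x = \<rho> 2"
  have x: "0 < x" using step_ratio_pos[of 2] by (simp add: x_def)
  have pos: "0 < \<tau> 1" by (rule step_pos) simp
  have steps: "t 1 - t 0 = \<tau> 1" "t 2 - t 0 = \<tau> 1 * (1 + x)"
    using step_eq_ratio_mult[of 2] by (auto simp: step_def x_def algebra_simps)
  have "(1 / (1 + x)) powr \<alpha> \<le> 1 + \<alpha> * (1 / (1 + x) - 1)"
    using x \<alpha> by (intro powr_le_chord) auto
  also have "1 / (1 + x) - 1 = - (x / (1 + x))" using x by (simp add: field_simps)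
  finally have "(1 + x) powr - \<alpha> \<le> 1 - \<alpha> * (x / (1 + x))"
    using x powr_divide[of 1 "1 + x" \<alpha>] by (simp add: powr_minus_divide)
  then have "\<tau> 1 powr - \<alpha> * (\<alpha> * (x / (1 + x))) \<le> \<tau> 1 powr - \<alpha> * (1 - (1 + x) powr - \<alpha>)"
    by (intro mult_left_mono) auto
  also have "\<dots> = (t 1 - t 0) powr - \<alpha> - (t 2 - t 0) powr - \<alpha>"
    unfolding steps using x pos by (simp add: powr_mult right_diff_distrib)
  also have "\<dots> = kernel_increment 1 (t 0)"
    by (simp add: kernel_increment_def kernel_def numeral_2_eq_2)
  also have "\<tau> 1 powr - \<alpha> * (\<alpha> * (x / (1 + x))) = kappa 1 * ((1 - \<alpha>) * (2 - \<alpha>) * (x / (1 + x)))"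
    using \<alpha> unfolding kappa_powr by simp
  finally have inc: "kappa 1 * ((1 - \<alpha>) * (2 - \<alpha>) * (x / (1 + x))) \<le> kernel_increment 1 (t 0)" .
  have "cell_weight t 1 (kernel_increment 1) = cell_mean t 1 (kernel_increment 1)
      - cell_moment t 1 (kernel_increment 1) / (\<tau> 1 * (\<tau> 1 + \<tau> (Suc 1)))"
    by (simp add: cell_weight_def)
  then have "kappa 1 * ((2 - \<alpha>) * x / (1 + x)) + kappa 1 * ((1 - \<alpha>) * (2 - \<alpha>) * (x / (1 + x)))
      \<le> cell_weight t 1 (kernel_increment 1)"
    using cell_kernel_increment_diag_ge[of 1] inc by (simp add: x_def numeral_2_eq_2)
  then have le: "kappa 1 * ((2 - \<alpha>) * x / (1 + x)) + kappa 1 * ((1 - \<alpha>) * (2 - \<alpha>) * (x / (1 + x)))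
      + kappa 1 * ((2 - \<alpha>) / \<alpha>) + kappa 1 / (1 + x) \<le> diagonal 1"
    using cell_weight_kernel_diag_ge[of 1] unfolding diagonal_eq
    by (simp add: correction_def x_def numeral_2_eq_2)
  have e: "(2 - \<alpha>) * x / (1 + x) = (2 - \<alpha>) * (x / (1 + x))" "kappa 1 / (1 + x) = kappa 1 * (1 - x / (1 + x))"
    "(2 - \<alpha>) / \<alpha> + 1 = 2 / \<alpha>"
    using x \<alpha> by (simp_all add: field_simps)
  have "k * ((2 - \<alpha>) * z) + k * ((1 - \<alpha>) * (2 - \<alpha>) * z) + k * p + k * (1 - z)
      = k * (p + 1 + (1 - \<alpha>) * (3 - \<alpha>) * z)" for k z p
    by (simp add: algebra_simps)
  with le show ?thesis unfolding e x_def[symmetric] by (simp only: e)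
qed

definition off_diagonal :: "nat \<Rightarrow> real" where
  "off_diagonal k = \<rho> k * correction k"

lemma off_diagonal_1 [simp]: "off_diagonal (Suc 0) = 0"
  by (simp add: off_diagonal_def correction_def)

lemma off_diagonal_nonneg: "3 \<le> k \<Longrightarrow> 0 \<le> off_diagonal k"
  using step_ratio_pos[of k] kappa_pos[of k] by (simp add: off_diagonal_def correction_def)

text \<open>Expressed in the unit \<open>kappa k\<close> of the preceding row, which makes it
  comparable with \<open>diagonal k\<close>.\<close>

lemma off_diagonal_Suc:
  assumes "1 \<le> k"
  shows "off_diagonal (Suc k) = kappa k * (\<rho> (Suc k) * \<rho> (Suc k) powr (1 - \<alpha>) / (1 + \<rho> (Suc k)))"
proof -
  have "\<rho> (Suc k) powr (1 - \<alpha>) = \<rho> (Suc k) * \<rho> (Suc k) powr - \<alpha>"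
    using powr_mult_base[of "\<rho> (Suc k)" "- \<alpha>"] step_ratio_pos[of "Suc k"] assms by simp
  then show ?thesis using assms by (simp add: off_diagonal_def correction_def kappa_Suc)
qed

lemma off_diagonal_Suc_le:
  assumes k: "2 \<le> k"
  shows "off_diagonal (Suc k) \<le> kappa k * ((2 - \<alpha>) / \<alpha> - 1 + (2 - \<alpha>) * \<rho> (Suc k) / (1 + \<rho> (Suc k)))"
proof -
  define s where "s = \<rho> (Suc k)"
  have s: "0 < s" "s\<^sup>2 \<le> 4 * s + 2"
    using step_ratio_pos[of "Suc k"] ratio_bound[of "Suc k"] k by (auto simp: s_def)
  have "s * s powr (1 - \<alpha>) / (1 + s) \<le> 2 * (1 - \<alpha>) / (1 - (1 - \<alpha>)) + (1 + (1 - \<alpha>)) * s / (1 + s)"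
    using \<alpha> s by (intro off_diagonal_bound) auto
  also have "\<dots> = (2 - \<alpha>) / \<alpha> - 1 + (2 - \<alpha>) * s / (1 + s)"
    using \<alpha> by (simp add: field_simps)
  finally have "kappa k * (s * s powr (1 - \<alpha>) / (1 + s)) \<le> kappa k * ((2 - \<alpha>) / \<alpha> - 1 + (2 - \<alpha>) * s / (1 + s))"
    using kappa_pos[of k] k by (intro mult_left_mono) auto
  moreover have "1 \<le> k" using k by simp
  ultimately show ?thesis by (simp only: off_diagonal_Suc s_def)
qed

text \<open>The lower bound for \<open>diagonal k\<close> is divided without remainder:
  \<open>off_diagonal_Suc_le\<close> consumes all of it except \<open>1 + 1 / (1 + y)\<close> and
  the correction, and \<open>ratio_upper\<close> compares precisely these with
  \<open>off_diagonal k\<close>.\<close>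

lemma diagonal_dominates:
  assumes k: "3 \<le> k"
  shows "off_diagonal k + off_diagonal (Suc k) \<le> diagonal k"
proof -
  define x y where "x = \<rho> k" and "y = \<rho> (Suc k)"
  have c: "correction k = kappa k * (x / (1 + x))" "off_diagonal k = kappa k * (x\<^sup>2 / (1 + x))"
    using k by (simp_all add: correction_def off_diagonal_def x_def power2_eq_square)
  have "kappa k * (x\<^sup>2 / (1 + x)) \<le> kappa k * (1 + 1 / (1 + y) + 2 * (x / (1 + x)))"
    using ratio_upper[OF k] kappa_pos[of k] k by (intro mult_left_mono) (auto simp: x_def y_def)
  then show ?thesis
    using diagonal_ge[of k] off_diagonal_Suc_le[of k] k
    unfolding c x_def[symmetric] y_def[symmetric] by (simp add: algebra_simps)
qed

lemma leading_block:
  "0 \<le> diagonal 1" "0 \<le> diagonal 2 - off_diagonal 3"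
  "(off_diagonal 2)\<^sup>2 \<le> diagonal 1 * (diagonal 2 - off_diagonal 3)"
proof -
  define x s where "x = \<rho> 2" and "s = \<rho> 3"
  have x: "0 < x" and s: "0 < s" "s\<^sup>2 \<le> 4 * s + 2"
    using step_ratio_pos[of 2] step_ratio_pos[of 3] ratio_bound[of 3] by (auto simp: x_def s_def)
  define A where "A = 2 / \<alpha> + (1 - \<alpha>) * (3 - \<alpha>) * (x / (1 + x))"
  define B where "B = 1 + 2 * x / (1 + x) + 1 / (1 + s) + 2 * (1 - \<alpha>) / \<alpha> + s * (2 - \<alpha> - s powr (1 - \<alpha>)) / (1 + s)"
  have A: "0 \<le> A" unfolding A_def using \<alpha> x by (intro add_nonneg_nonneg mult_nonneg_nonneg) auto
  have d1: "kappa 1 * A \<le> diagonal 1" using first_diagonal_ge by (simp add: A_def x_def)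
  have o3: "off_diagonal 3 = kappa 2 * (s * s powr (1 - \<alpha>) / (1 + s))"
    using off_diagonal_Suc[of 2] by (simp add: s_def numeral_3_eq_3 numeral_2_eq_2)
  have "(2 - \<alpha>) / \<alpha> = 1 + 2 * (1 - \<alpha>) / \<alpha>" using \<alpha> by (simp add: field_simps)
  then have "kappa 2 * B = kappa 2 * ((2 - \<alpha>) / \<alpha> + (2 - \<alpha>) * s / (1 + s) + 1 / (1 + s))
      + 2 * (kappa 2 * x / (1 + x)) - kappa 2 * (s * s powr (1 - \<alpha>) / (1 + s))"
    by (simp add: B_def algebra_simps diff_divide_distrib add_divide_distrib)
  then have d2: "kappa 2 * B \<le> diagonal 2 - off_diagonal 3"
    using diagonal_ge[of 2] unfolding o3 by (simp add: correction_def x_def s_def)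
  have k: "0 < kappa 1" "0 < kappa 2" by (auto intro: kappa_pos)
  have det: "x powr (1 - \<alpha>) * (x ^ 3 / (1 + x)\<^sup>2) \<le> A * B"
  proof -
    have e: "1 - (1 - \<alpha>) = \<alpha>" "2 + (1 - \<alpha>) = 3 - \<alpha>" "1 + (1 - \<alpha>) = 2 - \<alpha>" by simp_all
    show ?thesis
      using leading_block_determinant[of "1 - \<alpha>" x s] \<alpha> x s second_ratio_upper
      unfolding A_def B_def e x_def[symmetric] s_def[symmetric] by simp
  qed
  \<comment> \<open>The sign of \<open>B\<close> is not visible from its definition, where
    \<open>s powr (1 - \<alpha>)\<close> is subtracted; it is read off from the determinant
    inequality.\<close>
  have "0 < A" unfolding A_def using \<alpha> x by (intro add_pos_nonneg mult_nonneg_nonneg) auto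
  moreover have "0 \<le> A * B" using x by (intro order_trans[OF _ det]) simp
  ultimately have B: "0 \<le> B" by (simp add: zero_le_mult_iff)
  show "0 \<le> diagonal 1" using A k by (intro order_trans[OF _ d1]) simp
  show "0 \<le> diagonal 2 - off_diagonal 3" using B k by (intro order_trans[OF _ d2]) simp
  have o2: "off_diagonal 2 = kappa 1 * (x * x powr (1 - \<alpha>) / (1 + x))"
    using off_diagonal_Suc[of 1] by (simp add: x_def numeral_2_eq_2)
  have k2: "kappa 2 = kappa 1 * x powr - \<alpha>"
    using kappa_Suc[of 1] by (simp add: x_def numeral_2_eq_2)
  have px: "x powr (1 - \<alpha>) = x * x powr - \<alpha>"
    using powr_mult_base[of x "- \<alpha>"] x by simp
  have "(off_diagonal 2)\<^sup>2 = kappa 1 * kappa 2 * (x powr (1 - \<alpha>) * (x ^ 3 / (1 + x)\<^sup>2))"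
    unfolding o2 k2 px by (simp add: power2_eq_square power3_eq_cube)
  also have "\<dots> \<le> kappa 1 * kappa 2 * (A * B)"
    using k by (intro mult_left_mono det) auto
  also have "\<dots> = (kappa 1 * A) * (kappa 2 * B)" by simp
  also have "\<dots> \<le> diagonal 1 * (diagonal 2 - off_diagonal 3)"
    using d1 d2 A B k \<open>0 \<le> diagonal 1\<close> by (intro mult_mono) auto
  finally show "(off_diagonal 2)\<^sup>2 \<le> diagonal 1 * (diagonal 2 - off_diagonal 3)" .
qed

theorem L2_op_increment_form_nonneg:
  "0 \<le> (\<Sum>k=1..n. L2_op \<alpha> t w k * (w k - w (k - 1)))"
proof -
  define d where "d k = w k - w (k - 1)" for k
  define a where "a k j = cell_weight t j (kernel k)" for k j
  define e where "e k = kappa k / (1 + \<rho> (Suc k)) + correction k" for k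
  have G: "0 < Gamma (1 - \<alpha>)" using \<alpha> by (intro Gamma_real_pos) auto
  have row: "2 * (Gamma (1 - \<alpha>) * (L2_op \<alpha> t w k * d k)) =
      d k * (2 * (\<Sum>j=1..k. a k j * d j) - a k k * d k)
      + ((a k k + 2 * e k) * (d k)\<^sup>2 - 2 * off_diagonal k * d k * d (k - 1))" if "1 \<le> k" for k
  proof -
    have "k - 1 - 1 = k - 2" by simp
    then have "Gamma (1 - \<alpha>) * L2_op \<alpha> t w k = (\<Sum>j=1..k. a k j * d j) + e k * d k - off_diagonal k * d (k - 1)"
      using L2_op_eq[OF that, of w] by (simp add: a_def d_def e_def off_diagonal_def)
    then have "2 * (Gamma (1 - \<alpha>) * L2_op \<alpha> t w k) * d k =
        2 * ((\<Sum>j=1..k. a k j * d j) + e k * d k - off_diagonal k * d (k - 1)) * d k" by simp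
    then show ?thesis by (simp add: algebra_simps power2_eq_square)
  qed
  have "0 \<le> (\<Sum>k=1..n. diagonal k * (d k)\<^sup>2 - 2 * off_diagonal k * d k * d (k - 1))"
    by (rule tridiagonal_form_nonneg[OF _ off_diagonal_nonneg diagonal_dominates leading_block]) simp
  also have "\<dots> = (\<Sum>k=1..n. ((a k k - a k (k - 1)) - (a (Suc k) k - a (Suc k) (k - 1))) * (d k)\<^sup>2)
      + (\<Sum>k=1..n. (a k k + 2 * e k) * (d k)\<^sup>2 - 2 * off_diagonal k * d k * d (k - 1))"
    unfolding sum.distrib[symmetric]
    by (intro sum.cong refl) (simp add: diagonal_def a_def e_def algebra_simps)
  also have "\<dots> \<le> (\<Sum>k=1..n. d k * (2 * (\<Sum>j=1..k. a k j * d j) - a k k * d k))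
      + (\<Sum>k=1..n. (a k k + 2 * e k) * (d k)\<^sup>2 - 2 * off_diagonal k * d k * d (k - 1))"
  proof (intro add_right_mono quadratic_form_lower_bound)
    show "a k 0 = 0" for k by (simp add: a_def)
    show "1 \<le> i \<Longrightarrow> i < k \<Longrightarrow> a k (i - 1) \<le> a k i" for k i
      unfolding a_def by (rule cell_weight_kernel_mono)
    show "1 \<le> i \<Longrightarrow> i < k \<Longrightarrow> a (Suc k) i - a (Suc k) (i - 1) \<le> a k i - a k (i - 1)" for k i
      unfolding a_def by (rule cell_weight_kernel_mixed)
  qed
  also have "\<dots> = (\<Sum>k=1..n. 2 * (Gamma (1 - \<alpha>) * (L2_op \<alpha> t w k * d k)))"
    unfolding sum.distrib[symmetric] by (intro sum.cong refl) (simp only: row atLeastAtMost_iff)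
  also have "\<dots> = 2 * Gamma (1 - \<alpha>) * (\<Sum>k=1..n. L2_op \<alpha> t w k * d k)"
    by (simp add: sum_distrib_left mult_ac)
  finally have "0 \<le> (\<Sum>k=1..n. L2_op \<alpha> t w k * d k)"
    using G by (simp only: zero_le_mult_iff) linarith
  then show ?thesis unfolding d_def .
qed

end

section \<open>Test functions\<close>

lemma frechet_derivative_eq: "(f has_derivative f') (at x) \<Longrightarrow> frechet_derivative f (at x) = f'"
  by (rule frechet_derivative_at[symmetric])

lemma Ck_imp_continuous: "Ck k \<phi> \<Longrightarrow> continuous_on UNIV \<phi>"
  by (cases k) (auto intro!: continuous_at_imp_continuous_on differentiable_imp_continuous_within)

lemma Ck_Suc_imp: "Ck (Suc k) \<phi> \<Longrightarrow> Ck k \<phi>"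
proof (induction k arbitrary: \<phi>)
  case 0
  then show ?case using Ck_imp_continuous[OF 0] by simp
next
  case (Suc k)
  then show ?case unfolding Ck.simps(2)[of "Suc k"] Ck.simps(2)[of k \<phi>] by blast
qed

lemma Ck_const: "Ck k (\<lambda>x. c)"
proof (induction k arbitrary: c)
  case (Suc k)
  have "frechet_derivative (\<lambda>x::'a. c) (at x) = (\<lambda>_. 0)" for x
    by (intro frechet_derivative_eq derivative_intros)
  then show ?case using Suc[of 0] by simp
qed simp

lemma Ck_add: "Ck k \<phi> \<Longrightarrow> Ck k \<psi> \<Longrightarrow> Ck k (\<lambda>x. \<phi> x + \<psi> x)"
proof (induction k arbitrary: \<phi> \<psi>)
  case (Suc k)
  have "frechet_derivative (\<lambda>x. \<phi> x + \<psi> x) (at x)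
      = (\<lambda>h. frechet_derivative \<phi> (at x) h + frechet_derivative \<psi> (at x) h)" for x
    using Suc.prems by (intro frechet_derivative_eq derivative_intros) (auto simp: frechet_derivative_works[symmetric])
  then show ?case using Suc by simp
qed (auto intro: continuous_on_add)

lemma frechet_derivative_mult:
  fixes \<phi> \<psi> :: "'a::euclidean_space \<Rightarrow> real"
  assumes "\<phi> differentiable (at x)" "\<psi> differentiable (at x)"
  shows "frechet_derivative (\<lambda>x. \<phi> x * \<psi> x) (at x)
    = (\<lambda>h. \<phi> x * frechet_derivative \<psi> (at x) h + frechet_derivative \<phi> (at x) h * \<psi> x)"
  using assms by (intro frechet_derivative_eq derivative_intros) (auto simp: frechet_derivative_works[symmetric])

lemma Ck_mult: "Ck k \<phi> \<Longrightarrow> Ck k \<psi> \<Longrightarrow> Ck k (\<lambda>x. \<phi> x * \<psi> x)"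
proof (induction k arbitrary: \<phi> \<psi>)
  case (Suc k)
  have d: "\<phi> differentiable (at x)" "\<psi> differentiable (at x)" for x
    using Suc.prems by auto
  have "Ck k (\<lambda>x. \<phi> x * frechet_derivative \<psi> (at x) i + frechet_derivative \<phi> (at x) i * \<psi> x)" if "i \<in> Basis" for i
    using Suc.prems that Ck_Suc_imp[OF Suc.prems(1)] Ck_Suc_imp[OF Suc.prems(2)]
    by (intro Ck_add Suc.IH) auto
  then show ?case using d by (simp add: frechet_derivative_mult differentiable_mult)
qed (auto intro: continuous_on_mult)

lemma Ck_prod: "(\<And>i. i \<in> I \<Longrightarrow> Ck k (\<phi> i)) \<Longrightarrow> Ck k (\<lambda>x. \<Prod>i\<in>I. \<phi> i x)"
  by (induction I rule: infinite_finite_induct) (auto intro: Ck_const Ck_mult)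

lemma Ck_minus: "Ck k \<phi> \<Longrightarrow> Ck k \<psi> \<Longrightarrow> Ck k (\<lambda>x. \<phi> x - \<psi> x)"
  using Ck_add[of k \<phi> "\<lambda>x. (-1) * \<psi> x"] Ck_mult[OF Ck_const[of k "-1"], of \<psi>] by simp

lemma Ck_inner: "Ck k (\<lambda>x. x \<bullet> a)"
proof (cases k)
  case (Suc m)
  have "frechet_derivative (\<lambda>x. x \<bullet> a) (at x) = (\<lambda>h. h \<bullet> a)" for x
    by (intro frechet_derivative_eq derivative_intros)
  moreover have "(\<lambda>x. x \<bullet> a) differentiable (at x)" for x
    by (auto intro!: derivative_eq_intros simp: differentiable_def)
  ultimately show ?thesis using Suc by (simp add: Ck_const)
qed (auto intro: continuous_intros)

text \<open>The classical smooth function \<open>exp (- 1 / s)\<close>, flat at \<open>0\<close>, together with all its derivatives,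
  which are of the form \<open>poly p (1 / s) * exp (- 1 / s)\<close>.\<close>

definition flat :: "real poly \<Rightarrow> real \<Rightarrow> real" where
  "flat p s = (if 0 < s then poly p (1 / s) * exp (- (1 / s)) else 0)"

lemma poly_exp_tendsto_0: "((\<lambda>y::real. poly p y * exp (- y)) \<longlongrightarrow> 0) at_top"
proof -
  have "((\<lambda>y. \<Sum>i\<le>degree p. coeff p i * (y ^ i / exp y)) \<longlongrightarrow> (\<Sum>i\<le>degree p. coeff p i * 0)) at_top"
    by (intro tendsto_sum tendsto_mult tendsto_const tendsto_power_div_exp_0)
  moreover have "(\<Sum>i\<le>degree p. coeff p i * (y ^ i / exp y)) = poly p y * exp (- y)" for y
    by (simp add: poly_altdef sum_distrib_right exp_minus divide_inverse mult.assoc)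
  ultimately show ?thesis by simp
qed

text \<open>The inner derivative of \<open>- 1 / s\<close> is the factor \<open>[:0, 0, 1:]\<close>,
  i.e. 1 / s^2. The family \<open>flat\<close> is thus closed under differentiation, on which the
  induction for smoothness relies.\<close>

lemma flat_has_derivative:
  "(flat p has_real_derivative flat ([:0, 0, 1:] * (p - pderiv p)) s) (at s)"
proof -
  consider "0 < s" | "s < 0" | "s = 0" by linarith
  then show ?thesis
  proof cases
    case 1
    have "((\<lambda>s. poly p (1 / s) * exp (- (1 / s))) has_real_derivative
        flat ([:0, 0, 1:] * (p - pderiv p)) s) (at s)"
      using 1 by (auto intro!: derivative_eq_intros DERIV_chain2[OF poly_DERIV]
          simp: flat_def field_simps power2_eq_square)
    then show ?thesis
      by (rule has_field_derivative_transform_within_open[where S = "{0<..}"]) (use 1 in \<open>auto simp: flat_def\<close>)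
  next
    case 2
    have "((\<lambda>s. 0) has_real_derivative flat ([:0, 0, 1:] * (p - pderiv p)) s) (at s)"
      using 2 by (simp add: flat_def)
    then show ?thesis
      by (rule has_field_derivative_transform_within_open[where S = "{..<0}"]) (use 2 in \<open>auto simp: flat_def\<close>)
  next
    case 3
    have "((\<lambda>y. flat p y / y) \<longlongrightarrow> 0) (at_left 0)"
      by (rule tendsto_eventually) (auto simp: eventually_at_left_field flat_def intro: exI[of _ "-1"])
    \<comment> \<open>Inverting the variable turns the difference quotient at 0 into a polynomial
      times \<open>exp (- y)\<close> at infinity.\<close>
    moreover have "((\<lambda>y. flat p y / y) \<longlongrightarrow> 0) (at_right 0)"
      unfolding filterlim_at_right_to_top
    proof (rule Lim_transform_eventually)
      show "((\<lambda>y. poly (pCons 0 p) y * exp (- y)) \<longlongrightarrow> 0) at_top"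
        by (rule poly_exp_tendsto_0)
      show "eventually (\<lambda>y. poly (pCons 0 p) y * exp (- y) = flat p (inverse y) / inverse y) at_top"
        using eventually_gt_at_top[of 0] by eventually_elim (simp add: flat_def divide_inverse mult_ac)
    qed
    ultimately have "((\<lambda>y. flat p y / y) \<longlongrightarrow> 0) (at 0)"
      by (rule filterlim_split_at)
    then show ?thesis using 3 by (simp add: has_field_derivative_iff flat_def)
  qed
qed

lemma Ck_flat: "Ck k (\<lambda>x. flat p (x \<bullet> a + b))"
proof (induction k arbitrary: p)
  case 0
  have "continuous_on UNIV (flat p)"
    by (meson DERIV_isCont continuous_at_imp_continuous_on flat_has_derivative)
  then have "continuous_on UNIV (\<lambda>x. flat p (x \<bullet> a + b))"
    by (rule continuous_on_compose2) (auto intro!: continuous_intros)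
  then show ?case by simp
next
  case (Suc k)
  let ?p = "[:0, 0, 1:] * (p - pderiv p)"
  have d: "((\<lambda>x. flat p (x \<bullet> a + b)) has_derivative (\<lambda>h. flat ?p (x \<bullet> a + b) * (h \<bullet> a))) (at x)" for x
  proof -
    have "((\<lambda>x. x \<bullet> a + b) has_derivative (\<lambda>h. h \<bullet> a)) (at x)"
      by (auto intro!: derivative_eq_intros)
    from has_derivative_compose[OF this has_field_derivative_imp_has_derivative[OF flat_has_derivative]]
    show ?thesis by simp
  qed
  then have "Ck k (\<lambda>x. frechet_derivative (\<lambda>x. flat p (x \<bullet> a + b)) (at x) i)" for i
    unfolding frechet_derivative_eq[OF d] by (intro Ck_mult Suc.IH Ck_const)
  then show ?case using d by (auto simp: differentiable_def)
qed

text \<open>Smooth functions supported in a box that tend to the indicator of the open box as the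
  arguments are stretched by \<open>Suc n\<close>. The arguments are written as inner products plus
  constants to match \<open>Ck_flat\<close>.\<close>

definition box_bump :: "'a::euclidean_space \<Rightarrow> 'a \<Rightarrow> nat \<Rightarrow> 'a \<Rightarrow> real" where
  "box_bump a b n x = (\<Prod>i\<in>Basis. flat 1 (x \<bullet> (real (Suc n) *\<^sub>R i) + - (real (Suc n) * (a \<bullet> i)))
      * flat 1 (x \<bullet> (- (real (Suc n) *\<^sub>R i)) + real (Suc n) * (b \<bullet> i)))"

lemma Ck_box_bump: "Ck k (box_bump a b n)"
  unfolding box_bump_def[abs_def] by (intro Ck_prod Ck_mult Ck_flat)

lemma flat_1: "flat 1 s = (if 0 < s then exp (- (1 / s)) else 0)"
  by (simp add: flat_def)

lemma box_bump_eq: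
  "box_bump a b n x = (\<Prod>i\<in>Basis. flat 1 (real (Suc n) * (x \<bullet> i - a \<bullet> i)) * flat 1 (real (Suc n) * (b \<bullet> i - x \<bullet> i)))"
  unfolding box_bump_def by (intro prod.cong refl) (simp add: algebra_simps)

lemma box_bump_bounds: "0 \<le> box_bump a b n x" "box_bump a b n x \<le> 1"
proof -
  have f: "0 \<le> flat 1 s" "flat 1 s \<le> 1" for s by (auto simp: flat_1)
  show "0 \<le> box_bump a b n x"
    unfolding box_bump_eq by (intro prod_nonneg ballI mult_nonneg_nonneg f)
  show "box_bump a b n x \<le> 1"
    unfolding box_bump_eq by (intro prod_le_1 conjI mult_nonneg_nonneg mult_le_one f)
qed

lemma box_bump_eq_0:
  assumes "x \<notin> box a b"
  shows "box_bump a b n x = 0"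
proof -
  obtain i where "i \<in> Basis" "\<not> (a \<bullet> i < x \<bullet> i \<and> x \<bullet> i < b \<bullet> i)"
    using assms by (auto simp: mem_box)
  then show ?thesis
    unfolding box_bump_eq by (intro prod_zero bexI[of _ i]) (auto simp: flat_1 zero_less_mult_iff)
qed

lemma box_bump_tendsto: "(\<lambda>n. box_bump a b n x) \<longlonglongrightarrow> indicator (box a b) x"
proof (cases "x \<in> box a b")
  case True
  have f: "(\<lambda>n. flat 1 (real (Suc n) * s)) \<longlonglongrightarrow> 1" if "0 < s" for s :: real
  proof -
    have "(\<lambda>n. exp (- (inverse s * inverse (real (Suc n))))) \<longlonglongrightarrow> exp (- (inverse s * 0))"
      by (intro tendsto_intros LIMSEQ_inverse_real_of_nat)
    moreover have "flat 1 (real (Suc n) * s) = exp (- (inverse s * inverse (real (Suc n))))" for n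
      using that by (simp add: flat_1 zero_less_mult_iff divide_inverse mult_ac del: of_nat_Suc)
    ultimately show ?thesis by simp
  qed
  have "(\<lambda>n. box_bump a b n x) \<longlonglongrightarrow> (\<Prod>i\<in>(Basis::'a set). 1 * 1)"
    unfolding box_bump_eq using True by (intro tendsto_prod tendsto_mult f) (auto simp: mem_box)
  then show ?thesis using True by simp
qed (simp add: box_bump_eq_0)

text \<open>The bumps may be nonzero arbitrarily close to the faces of the box, so it is the closed
  box that has to fit into \<Omega>.\<close>

lemma box_bump_test_function:
  assumes "cbox a b \<subseteq> \<Omega>"
  shows "box_bump a b n \<in> test_functions \<Omega>"
proof -
  have "{x. box_bump a b n x \<noteq> 0} \<subseteq> cbox a b"
    using box_bump_eq_0 box_subset_cbox by blast
  then have c: "closure {x. box_bump a b n x \<noteq> 0} \<subseteq> cbox a b"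
    by (rule closure_minimal) (rule closed_cbox)
  then have "compact (closure {x. box_bump a b n x \<noteq> 0})"
    using compact_cbox[of a b] by (meson bounded_cbox bounded_subset compact_eq_bounded_closed closed_closure)
  then show ?thesis using c assms by (auto simp: test_functions_def Ck_box_bump)
qed

section \<open>Inner product and norm of square integrable functions\<close>

lemma L2_inner_integrable:
  fixes v w :: "'a::euclidean_space \<Rightarrow> 'b::euclidean_space"
  assumes "v square_integrable_on \<Omega>" "w square_integrable_on \<Omega>"
  shows "integrable (lebesgue_on \<Omega>) (\<lambda>x. v x \<bullet> w x)"
proof (rule Bochner_Integration.integrable_bound)
  show "integrable (lebesgue_on \<Omega>) (\<lambda>x. (norm (v x))\<^sup>2 + (norm (w x))\<^sup>2)"
    using assms by (auto simp: square_integrable_on_def)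
  show "(\<lambda>x. v x \<bullet> w x) \<in> borel_measurable (lebesgue_on \<Omega>)"
    using assms by (auto simp: square_integrable_on_def)
  have "\<bar>a \<bullet> b\<bar> \<le> (norm a)\<^sup>2 + (norm b)\<^sup>2" for a b :: 'b
  proof -
    have "0 \<le> (norm a - norm b)\<^sup>2" "0 \<le> norm a * norm b" by auto
    then have "norm a * norm b \<le> (norm a)\<^sup>2 + (norm b)\<^sup>2"
      unfolding power2_diff by linarith
    with Cauchy_Schwarz_ineq2[of a b] show ?thesis by linarith
  qed
  then show "AE x in lebesgue_on \<Omega>. norm (v x \<bullet> w x) \<le> norm ((norm (v x))\<^sup>2 + (norm (w x))\<^sup>2)"
    by simp
qed

lemma square_integrable_scale:
  "v square_integrable_on \<Omega> \<Longrightarrow> (\<lambda>x. c *\<^sub>R v x) square_integrable_on \<Omega>"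
  by (auto simp: square_integrable_on_def power_mult_distrib)

lemma square_integrable_cmult:
  fixes v :: "'a::euclidean_space \<Rightarrow> real"
  shows "v square_integrable_on \<Omega> \<Longrightarrow> (\<lambda>x. c * v x) square_integrable_on \<Omega>"
  using square_integrable_scale[of v \<Omega> c] by simp

lemma square_integrable_add:
  assumes v: "v square_integrable_on \<Omega>" and w: "w square_integrable_on \<Omega>"
  shows "(\<lambda>x. v x + w x) square_integrable_on \<Omega>"
proof -
  have "(norm (v x + w x))\<^sup>2 = (norm (v x))\<^sup>2 + 2 * (v x \<bullet> w x) + (norm (w x))\<^sup>2" for x
    by (simp add: power2_norm_eq_inner inner_add inner_commute)
  then show ?thesis
    using v w L2_inner_integrable[OF v w] by (auto simp: square_integrable_on_def)
qed

lemma square_integrable_diff: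
  assumes "v square_integrable_on \<Omega>" "w square_integrable_on \<Omega>"
  shows "(\<lambda>x. v x - w x) square_integrable_on \<Omega>"
  using square_integrable_add[OF assms(1) square_integrable_scale[OF assms(2), of "-1"]] by simp

lemma square_integrable_sum:
  "(\<And>i. i \<in> I \<Longrightarrow> v i square_integrable_on \<Omega>) \<Longrightarrow> (\<lambda>x. \<Sum>i\<in>I. v i x) square_integrable_on \<Omega>"
proof (induction I rule: infinite_finite_induct)
  case (insert i I)
  then show ?case using square_integrable_add[of "v i" \<Omega>] by simp
qed (auto simp: square_integrable_on_def)

lemma L2_inner_commute: "L2_inner \<Omega> v w = L2_inner \<Omega> w v"
  by (simp add: L2_inner_def inner_commute)

lemma L2_inner_diff_left:
  assumes "v square_integrable_on \<Omega>" "w square_integrable_on \<Omega>" "z square_integrable_on \<Omega>"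
  shows "L2_inner \<Omega> (\<lambda>x. v x - w x) z = L2_inner \<Omega> v z - L2_inner \<Omega> w z"
  using L2_inner_integrable[OF assms(1,3)] L2_inner_integrable[OF assms(2,3)]
  by (simp add: L2_inner_def inner_diff_left)

lemma L2_inner_diff_right:
  assumes "v square_integrable_on \<Omega>" "w square_integrable_on \<Omega>" "z square_integrable_on \<Omega>"
  shows "L2_inner \<Omega> z (\<lambda>x. v x - w x) = L2_inner \<Omega> z v - L2_inner \<Omega> z w"
  using L2_inner_diff_left[OF assms] by (simp add: L2_inner_commute)

lemma L2_inner_scale_left: "L2_inner \<Omega> (\<lambda>x. c *\<^sub>R v x) w = c * L2_inner \<Omega> v w"
  by (simp add: L2_inner_def)

lemma L2_inner_scale_right: "L2_inner \<Omega> v (\<lambda>x. c *\<^sub>R w x) = c * L2_inner \<Omega> v w"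
  by (simp add: L2_inner_def)

lemma L2_inner_cong_AE:
  assumes "AE x in lebesgue_on \<Omega>. v x = v' x" "AE x in lebesgue_on \<Omega>. w x = w' x"
    "v square_integrable_on \<Omega>" "w square_integrable_on \<Omega>" "v' square_integrable_on \<Omega>" "w' square_integrable_on \<Omega>"
  shows "L2_inner \<Omega> v w = L2_inner \<Omega> v' w'"
  unfolding L2_inner_def
proof (rule integral_cong_AE)
  show "(\<lambda>x. v x \<bullet> w x) \<in> borel_measurable (lebesgue_on \<Omega>)" "(\<lambda>x. v' x \<bullet> w' x) \<in> borel_measurable (lebesgue_on \<Omega>)"
    using assms(3-6) by (auto simp: square_integrable_on_def)
  show "AE x in lebesgue_on \<Omega>. v x \<bullet> w x = v' x \<bullet> w' x"
    using assms(1,2) by eventually_elim simp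
qed

lemma L2_norm_nonneg [simp]: "0 \<le> L2_norm \<Omega> v"
  by (simp add: L2_norm_def)

lemma L2_inner_self: "L2_inner \<Omega> v v = (L2_norm \<Omega> v)\<^sup>2"
  by (simp add: L2_inner_def L2_norm_def power2_norm_eq_inner[symmetric])

lemma L2_norm_cong_AE:
  assumes "AE x in lebesgue_on \<Omega>. v x = w x" "v square_integrable_on \<Omega>" "w square_integrable_on \<Omega>"
  shows "L2_norm \<Omega> v = L2_norm \<Omega> w"
  using L2_inner_cong_AE[OF assms(1) assms(1) assms(2,2,3,3)]
  by (simp add: L2_inner_self)

lemma L2_Cauchy_Schwarz:
  assumes v: "v square_integrable_on \<Omega>" and w: "w square_integrable_on \<Omega>"
  shows "\<bar>L2_inner \<Omega> v w\<bar> \<le> L2_norm \<Omega> v * L2_norm \<Omega> w"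
proof -
  define a b c where "a = (L2_norm \<Omega> v)\<^sup>2" and "b = L2_inner \<Omega> v w" and "c = (L2_norm \<Omega> w)\<^sup>2"
  have sq: "0 \<le> p\<^sup>2 * a - 2 * p * q * b + q\<^sup>2 * c" for p q
  proof -
    let ?v = "\<lambda>x. p *\<^sub>R v x" and ?w = "\<lambda>x. q *\<^sub>R w x"
    have i: "?v square_integrable_on \<Omega>" "?w square_integrable_on \<Omega>"
      by (intro square_integrable_scale v w)+
    have "0 \<le> L2_inner \<Omega> (\<lambda>x. ?v x - ?w x) (\<lambda>x. ?v x - ?w x)" by (simp add: L2_inner_self)
    also have "\<dots> = L2_inner \<Omega> ?v ?v - 2 * L2_inner \<Omega> ?v ?w + L2_inner \<Omega> ?w ?w"
      using L2_inner_diff_left[OF i square_integrable_diff[OF i]] L2_inner_diff_right[OF i i(1)] L2_inner_diff_right[OF i i(2)]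
        L2_inner_commute[of \<Omega> ?w ?v] by simp
    also have "\<dots> = p\<^sup>2 * a - 2 * p * q * b + q\<^sup>2 * c"
      unfolding L2_inner_scale_left L2_inner_scale_right
      by (simp add: a_def b_def c_def L2_inner_self power2_eq_square)
    finally show ?thesis .
  qed
  have "0 \<le> a" "0 \<le> c" by (auto simp: a_def c_def)
  have "b\<^sup>2 \<le> a * c"
  proof (cases "c = 0")
    case False
    have "0 \<le> c * (a * c - b\<^sup>2)" using sq[of c b] by (simp add: power2_eq_square algebra_simps)
    then show ?thesis using False \<open>0 \<le> c\<close> by (simp add: zero_le_mult_iff)
  next
    case True
    have "0 \<le> a - 2 * q * b" for q using sq[of 1 q] True by simp
    \<comment> \<open>For nonzero \<open>b\<close> the affine expression would equal -1 at this
      point.\<close>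
    from this[of "(a + 1) / (2 * b)"] have "b = 0" by (cases "b = 0") auto
    then show ?thesis using True by simp
  qed
  then have "\<bar>b\<bar>\<^sup>2 \<le> (L2_norm \<Omega> v * L2_norm \<Omega> w)\<^sup>2" by (simp add: a_def c_def power_mult_distrib)
  then show ?thesis unfolding b_def by (rule power2_le_imp_le) simp
qed

lemma L2_norm_triangle:
  assumes v: "v square_integrable_on \<Omega>" and w: "w square_integrable_on \<Omega>"
  shows "L2_norm \<Omega> (\<lambda>x. v x - w x) \<le> L2_norm \<Omega> v + L2_norm \<Omega> w"
proof (rule power2_le_imp_le)
  have "(L2_norm \<Omega> (\<lambda>x. v x - w x))\<^sup>2 = (L2_norm \<Omega> v)\<^sup>2 - 2 * L2_inner \<Omega> v w + (L2_norm \<Omega> w)\<^sup>2"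
    unfolding L2_inner_self[symmetric]
    using L2_inner_diff_left[OF v w square_integrable_diff[OF v w]] L2_inner_diff_right[OF v w v] L2_inner_diff_right[OF v w w]
      L2_inner_commute[of \<Omega> w v] by simp
  also have "\<dots> \<le> (L2_norm \<Omega> v + L2_norm \<Omega> w)\<^sup>2"
    using L2_Cauchy_Schwarz[OF v w] by (simp add: power2_sum abs_le_iff)
  finally show "(L2_norm \<Omega> (\<lambda>x. v x - w x))\<^sup>2 \<le> (L2_norm \<Omega> v + L2_norm \<Omega> w)\<^sup>2" .
qed simp

lemma L2_norm_minus: "L2_norm \<Omega> (\<lambda>x. - v x) = L2_norm \<Omega> v"
  by (simp add: L2_norm_def)

lemma L2_norm_le_add_diff:
  assumes v: "v square_integrable_on \<Omega>" and w: "w square_integrable_on \<Omega>"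
  shows "L2_norm \<Omega> v \<le> L2_norm \<Omega> w + L2_norm \<Omega> (\<lambda>x. v x - w x)"
  using L2_norm_triangle[OF square_integrable_diff[OF v w] square_integrable_scale[OF w, of "-1"]]
  by (simp add: L2_norm_minus)

section \<open>Integrals of compactly supported functions over open sets\<close>

lemma integrable_continuous_compact_support:
  fixes f :: "'a::euclidean_space \<Rightarrow> 'b::euclidean_space"
  assumes "continuous_on UNIV f" "compact K" "\<And>x. x \<notin> K \<Longrightarrow> f x = 0"
  shows "integrable lborel f"
proof -
  have "integrable lborel (\<lambda>x. indicator K x *\<^sub>R f x)"
    by (rule borel_integrable_compact[OF assms(2) continuous_on_subset[OF assms(1)]]) simp
  moreover have "(\<lambda>x. indicator K x *\<^sub>R f x) = f" using assms(3) by (auto simp: indicator_def)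
  ultimately show ?thesis by simp
qed

lemma open_imp_sets_lebesgue: "open \<Omega> \<Longrightarrow> \<Omega> \<in> sets lebesgue"
  using borel_open[of \<Omega>] by (simp add: sets_completionI_sets)

lemma integrable_lebesgue_on_open:
  fixes f :: "'a::euclidean_space \<Rightarrow> 'b::euclidean_space"
  assumes "open \<Omega>" "integrable lborel f"
  shows "integrable (lebesgue_on \<Omega>) f"
proof -
  have "integrable lebesgue f"
    using integrable_completion[of f lborel] borel_measurable_integrable[OF assms(2)] assms(2) by blast
  then have "integrable lebesgue (\<lambda>x. indicator \<Omega> x *\<^sub>R f x)"
    by (rule integrable_mult_indicator[OF open_imp_sets_lebesgue[OF assms(1)]])
  then show ?thesis
    using integrable_restrict_space[of \<Omega> lebesgue f] open_imp_sets_lebesgue[OF assms(1)] by simp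
qed

lemma integral_lebesgue_on_open:
  fixes f :: "'a::euclidean_space \<Rightarrow> 'b::euclidean_space"
  assumes "open \<Omega>" "f \<in> borel_measurable borel" "\<And>x. x \<notin> \<Omega> \<Longrightarrow> f x = 0"
  shows "(\<integral>x. f x \<partial>lebesgue_on \<Omega>) = (\<integral>x. f x \<partial>lborel)"
proof -
  have "(\<integral>x. f x \<partial>lebesgue_on \<Omega>) = (\<integral>x. indicator \<Omega> x *\<^sub>R f x \<partial>lebesgue)"
    using integral_restrict_space[of \<Omega> lebesgue f] open_imp_sets_lebesgue[OF assms(1)] by simp
  also have "(\<lambda>x. indicator \<Omega> x *\<^sub>R f x) = f" using assms(3) by (auto simp: indicator_def)
  also have "(\<integral>x. f x \<partial>lebesgue) = (\<integral>x. f x \<partial>lborel)"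
    using assms(2) by (intro integral_completion) simp
  finally show ?thesis .
qed

lemma square_integrable_continuous_compact_support:
  fixes f :: "'a::euclidean_space \<Rightarrow> 'b::euclidean_space"
  assumes "open \<Omega>" "continuous_on UNIV f" "compact K" "\<And>x. x \<notin> K \<Longrightarrow> f x = 0"
  shows "f square_integrable_on \<Omega>"
proof -
  have "continuous_on UNIV (\<lambda>x. (norm (f x))\<^sup>2)"
    by (intro continuous_intros assms(2))
  then have "integrable lborel (\<lambda>x. (norm (f x))\<^sup>2)"
    by (rule integrable_continuous_compact_support[OF _ assms(3)]) (simp add: assms(4))
  then have "integrable (lebesgue_on \<Omega>) (\<lambda>x. (norm (f x))\<^sup>2)"
    by (rule integrable_lebesgue_on_open[OF assms(1)])
  moreover have "f \<in> borel_measurable (lebesgue_on \<Omega>)"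
    using integrable_lebesgue_on_open[OF assms(1) integrable_continuous_compact_support[OF assms(2-4)]]
    by (rule borel_measurable_integrable)
  ultimately show ?thesis
    unfolding square_integrable_on_def by simp
qed

section \<open>Supports and closure properties of test functions\<close>

lemma test_function_Ck: "\<phi> \<in> test_functions \<Omega> \<Longrightarrow> Ck k \<phi>"
  by (simp add: test_functions_def)

lemma test_function_differentiable: "\<phi> \<in> test_functions \<Omega> \<Longrightarrow> \<phi> differentiable (at x)"
  using test_function_Ck[of \<phi> \<Omega> "Suc 0"] by simp

lemma test_function_continuous: "\<phi> \<in> test_functions \<Omega> \<Longrightarrow> continuous_on UNIV \<phi>"
  using test_function_Ck[of \<phi> \<Omega> 0] by simp

lemma test_function_partial_continuous:
  "\<phi> \<in> test_functions \<Omega> \<Longrightarrow> i \<in> Basis \<Longrightarrow> continuous_on UNIV (\<lambda>x. frechet_derivative \<phi> (at x) i)"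
  using test_function_Ck[of \<phi> \<Omega> "Suc 0"] by simp

lemma test_function_support:
  assumes "\<phi> \<in> test_functions \<Omega>"
  obtains K where "compact K" "K \<subseteq> \<Omega>" "\<And>x. x \<notin> K \<Longrightarrow> \<phi> x = 0"
    "\<And>x. x \<notin> K \<Longrightarrow> frechet_derivative \<phi> (at x) = (\<lambda>_. 0)"
proof -
  define K where "K = closure {x. \<phi> x \<noteq> 0}"
  have K: "compact K" "K \<subseteq> \<Omega>" using assms by (simp_all add: test_functions_def K_def)
  have z: "\<phi> x = 0" if "x \<notin> K" for x
    using that closure_subset[of "{x. \<phi> x \<noteq> 0}"] by (auto simp: K_def)
  have d: "frechet_derivative \<phi> (at x) = (\<lambda>_. 0)" if x: "x \<notin> K" for x
  proof (rule frechet_derivative_eq)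
    have "open (- K)" using K(1) by (simp add: compact_imp_closed open_Compl)
    then show "(\<phi> has_derivative (\<lambda>_. 0)) (at x)"
      using x z by (intro has_derivative_transform_within_open[OF has_derivative_const[of 0], of "- K"]) simp_all
  qed
  show thesis by (rule that[OF K z d])
qed

lemma test_function_square_integrable:
  assumes "open \<Omega>" "\<phi> \<in> test_functions \<Omega>"
  shows "\<phi> square_integrable_on \<Omega>" "gradient \<phi> square_integrable_on \<Omega>"
proof -
  obtain K where K: "compact K" "\<And>x. x \<notin> K \<Longrightarrow> \<phi> x = 0"
    "\<And>x. x \<notin> K \<Longrightarrow> frechet_derivative \<phi> (at x) = (\<lambda>_. 0)"
    by (rule test_function_support[OF assms(2)]) (rule that; assumption)
  show "\<phi> square_integrable_on \<Omega>"
    by (rule square_integrable_continuous_compact_support[OF assms(1) test_function_continuous[OF assms(2)] K(1)]) (rule K(2))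
  have "continuous_on UNIV (gradient \<phi>)"
    unfolding gradient_def[abs_def]
    by (intro continuous_intros test_function_partial_continuous[OF assms(2)])
  then show "gradient \<phi> square_integrable_on \<Omega>"
    by (rule square_integrable_continuous_compact_support[OF assms(1) _ K(1)]) (simp add: gradient_def K(3))
qed

lemma test_functionI:
  assumes "\<And>k. Ck k \<phi>" "compact K" "K \<subseteq> \<Omega>" "\<And>x. x \<notin> K \<Longrightarrow> \<phi> x = 0"
  shows "\<phi> \<in> test_functions \<Omega>"
proof -
  have "{x. \<phi> x \<noteq> 0} \<subseteq> K" using assms(4) by blast
  then have c: "closure {x. \<phi> x \<noteq> 0} \<subseteq> K"
    by (rule closure_minimal) (rule compact_imp_closed[OF assms(2)])
  then have "compact (closure {x. \<phi> x \<noteq> 0})"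
    using compact_Int_closed[OF assms(2) closed_closure, of "{x. \<phi> x \<noteq> 0}"] by (simp add: inf.absorb2)
  then show ?thesis using c assms(1,3) unfolding test_functions_def by simp
qed

lemma test_function_mult:
  assumes "\<phi> \<in> test_functions \<Omega>" and "\<And>k. Ck k \<psi>"
  shows "(\<lambda>x. \<psi> x * \<phi> x) \<in> test_functions \<Omega>"
proof (rule test_function_support[OF assms(1)])
  fix K assume K: "compact K" "K \<subseteq> \<Omega>" "\<And>x. x \<notin> K \<Longrightarrow> \<phi> x = 0"
  show ?thesis
    by (rule test_functionI[OF Ck_mult[OF assms(2) test_function_Ck[OF assms(1)]] K(1,2)]) (simp add: K(3))
qed

lemma test_function_diff:
  assumes "\<phi> \<in> test_functions \<Omega>" "\<psi> \<in> test_functions \<Omega>"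
  shows "(\<lambda>x. \<phi> x - \<psi> x) \<in> test_functions \<Omega>"
proof (rule test_function_support[OF assms(1)], rule test_function_support[OF assms(2)])
  fix K L assume K: "compact K" "K \<subseteq> \<Omega>" "\<And>x. x \<notin> K \<Longrightarrow> \<phi> x = 0"
    and L: "compact L" "L \<subseteq> \<Omega>" "\<And>x. x \<notin> L \<Longrightarrow> \<psi> x = 0"
  show ?thesis
    by (rule test_functionI[OF Ck_minus[OF test_function_Ck[OF assms(1)] test_function_Ck[OF assms(2)]] compact_Un[OF K(1) L(1)]])
       (use K L in auto)
qed

section \<open>Vanishing integrals of partial derivatives\<close>

lemma lborel_translate:
  fixes f :: "'a::euclidean_space \<Rightarrow> real"
  assumes f: "integrable lborel f"
  shows "integrable lborel (\<lambda>x. f (x + c))" "(\<integral>x. f (x + c) \<partial>lborel) = (\<integral>x. f x \<partial>lborel)"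
proof -
  have L: "distr lborel borel (\<lambda>x. c + x) = lborel"
    using lborel_affine[of 1 c] by (simp add: density_1)
  have m: "f \<in> borel_measurable borel" using f by auto
  have "integrable (distr lborel borel (\<lambda>x. c + x)) f" unfolding L by (rule f)
  then show "integrable lborel (\<lambda>x. f (x + c))"
    using m by (subst (asm) integrable_distr_eq) (auto simp: add.commute)
  have "(\<integral>x. f x \<partial>distr lborel borel (\<lambda>x. c + x)) = (\<integral>x. f (c + x) \<partial>lborel)"
    using m by (intro integral_distr) auto
  then show "(\<integral>x. f (x + c) \<partial>lborel) = (\<integral>x. f x \<partial>lborel)" unfolding L by (simp add: add.commute)
qed

lemma integral_partial_test_function:
  fixes \<psi> :: "'a::euclidean_space \<Rightarrow> real"
  assumes "\<psi> \<in> test_functions \<Omega>" and i: "i \<in> Basis"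
  shows "(\<integral>x. frechet_derivative \<psi> (at x) i \<partial>lborel) = 0"
proof -
  obtain K where K: "compact K" "\<And>x. x \<notin> K \<Longrightarrow> \<psi> x = 0"
    "\<And>x. x \<notin> K \<Longrightarrow> frechet_derivative \<psi> (at x) = (\<lambda>_. 0)"
    by (rule test_function_support[OF assms(1)]) (rule that; assumption)
  obtain r where r: "K \<subseteq> cball 0 r"
    using compact_imp_bounded[OF K(1)] by (auto simp: bounded_iff subset_eq)
  let ?D = "\<lambda>x. frechet_derivative \<psi> (at x) i"
  have contD: "continuous_on UNIV ?D" using test_function_partial_continuous[OF assms] .
  have cont: "continuous_on UNIV \<psi>" using test_function_continuous[OF assms(1)] .
  obtain B where B: "\<And>x. \<bar>?D x\<bar> \<le> B"
  proof -
    have "bounded (?D ` K)"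
      by (rule compact_imp_bounded[OF compact_continuous_image[OF continuous_on_subset[OF contD] K(1)]]) simp
    then obtain B where B: "\<forall>x\<in>K. \<bar>?D x\<bar> \<le> B" unfolding bounded_iff by auto
    have "\<bar>?D x\<bar> \<le> max B 0" for x
    proof (cases "x \<in> K")
      case True
      then show ?thesis using B by (simp add: le_max_iff_disj)
    qed (simp add: K(3))
    then show ?thesis by (rule that)
  qed
  have line: "((\<lambda>s. \<psi> (x + s *\<^sub>R i)) has_real_derivative ?D (x + s *\<^sub>R i)) (at s)" for x s
  proof -
    have lin: "linear (frechet_derivative \<psi> (at y))" for y
      using test_function_differentiable[OF assms(1)] by (rule linear_frechet_derivative)
    have "((\<lambda>s. x + s *\<^sub>R i) has_derivative (\<lambda>h. h *\<^sub>R i)) (at s)"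
      by (auto intro!: derivative_eq_intros)
    from has_derivative_compose[OF this frechet_derivative_works[THEN iffD1, OF test_function_differentiable[OF assms(1)]]]
    have "((\<lambda>s. \<psi> (x + s *\<^sub>R i)) has_derivative (\<lambda>h. h * ?D (x + s *\<^sub>R i))) (at s)"
      by (simp add: linear_scale[OF lin])
    moreover have "(\<lambda>h. h * ?D (x + s *\<^sub>R i)) = (*) (?D (x + s *\<^sub>R i))" by (simp add: fun_eq_iff)
    ultimately show ?thesis unfolding has_field_derivative_def by simp
  qed
  \<comment> \<open>Difference quotients of an integrable function have integral \<open>0\<close> by translation invariance.\<close>
  define q where "q n x = (\<psi> (x + (1 / real (Suc n)) *\<^sub>R i) - \<psi> x) / (1 / real (Suc n))" for n x
  have int\<psi>: "integrable lborel \<psi>" using integrable_continuous_compact_support[OF cont K(1,2)] .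
  have q0: "(\<integral>x. q n x \<partial>lborel) = 0" for n
  proof -
    let ?c = "(1 / real (Suc n)) *\<^sub>R i"
    have "integrable lborel (\<lambda>x. \<psi> (x + ?c))" "(\<integral>x. \<psi> (x + ?c) \<partial>lborel) = (\<integral>x. \<psi> x \<partial>lborel)"
      using int\<psi> by (rule lborel_translate)+
    then show ?thesis unfolding q_def using int\<psi> by simp
  qed
  have "(\<lambda>n. \<integral>x. q n x \<partial>lborel) \<longlonglongrightarrow> (\<integral>x. ?D x \<partial>lborel)"
  proof (rule integral_dominated_convergence)
    show "?D \<in> borel_measurable lborel"
      using borel_measurable_continuous_onI[OF contD] by simp
    show "q n \<in> borel_measurable lborel" for n
    proof -
      have "continuous_on UNIV (\<lambda>x. \<psi> (x + (1 / real (Suc n)) *\<^sub>R i))"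
        by (rule continuous_on_compose2[OF cont]) (auto intro!: continuous_intros)
      then have "continuous_on UNIV (q n)"
        unfolding q_def by (intro continuous_on_divide continuous_on_diff cont continuous_on_const) simp_all
      from borel_measurable_continuous_onI[OF this] show ?thesis by simp
    qed
    \<comment> \<open>The shifts have length at most 1, so all quotients vanish outside the enlarged
      ball; inside, the mean value theorem bounds them by \<open>B\<close>.\<close>
    show "integrable lborel (\<lambda>x. indicator (cball 0 (r + 1)) x *\<^sub>R B :: real)"
      by (intro borel_integrable_compact continuous_intros compact_cball)
    show "AE x in lborel. (\<lambda>n. q n x) \<longlonglongrightarrow> ?D x"
    proof (rule AE_I2)
      fix x
      have "((\<lambda>h. (\<psi> (x + h *\<^sub>R i) - \<psi> x) / h) \<longlongrightarrow> ?D x) (at 0)"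
        using line[of x 0] by (simp add: has_field_derivative_iff)
      moreover have "filterlim (\<lambda>n. 1 / real (Suc n)) (at 0) sequentially"
      proof (rule filterlim_atI)
        show "(\<lambda>n. 1 / real (Suc n)) \<longlonglongrightarrow> 0"
          using LIMSEQ_inverse_real_of_nat by (simp only: inverse_eq_divide)
      qed simp
      ultimately show "(\<lambda>n. q n x) \<longlonglongrightarrow> ?D x"
        unfolding q_def by (rule filterlim_compose)
    qed
    show "AE x in lborel. norm (q n x) \<le> indicator (cball 0 (r + 1)) x *\<^sub>R B" for n
    proof (rule AE_I2)
      fix x :: 'a
      define h where "h = 1 / real (Suc n)"
      have h: "0 < h" "h \<le> 1" by (auto simp: h_def)
      show "norm (q n x) \<le> indicator (cball 0 (r + 1)) x *\<^sub>R B"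
      proof (cases "x \<in> cball 0 (r + 1)")
        case True
        obtain z where "\<psi> (x + h *\<^sub>R i) - \<psi> (x + 0 *\<^sub>R i) = (h - 0) * ?D (x + z *\<^sub>R i)"
          using MVT2[OF h(1), of "\<lambda>s. \<psi> (x + s *\<^sub>R i)" "\<lambda>s. ?D (x + s *\<^sub>R i)"] line by blast
        then have "q n x = ?D (x + z *\<^sub>R i)" using h unfolding q_def h_def[symmetric] by simp
        then show ?thesis using True B by simp
      next
        case False
        have "norm (h *\<^sub>R i) \<le> 1" using h i by simp
        then have "norm x \<le> norm (x + h *\<^sub>R i) + 1" using norm_triangle_ineq4[of "x + h *\<^sub>R i" "h *\<^sub>R i"] by simp
        then have "x \<notin> K" "x + h *\<^sub>R i \<notin> K" using r False by auto
        then have "q n x = 0" unfolding q_def h_def[symmetric] by (simp add: K(2))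
        then show ?thesis using False by simp
      qed
    qed
  qed
  then show ?thesis using q0 by (simp add: LIMSEQ_const_iff)
qed

section \<open>Weak gradients\<close>

lemma gradient_inner: "i \<in> Basis \<Longrightarrow> gradient \<phi> x \<bullet> i = frechet_derivative \<phi> (at x) i"
  unfolding gradient_def by (simp add: inner_sum_left inner_Basis if_distrib sum.delta' cong: if_cong)

lemma test_function_gradient_continuous:
  "\<phi> \<in> test_functions \<Omega> \<Longrightarrow> continuous_on UNIV (gradient \<phi>)"
  unfolding gradient_def[abs_def] by (intro continuous_intros test_function_partial_continuous)

text \<open>Integration by parts: the product of two test functions is a test function, so the
  integrals of its partial derivatives vanish.\<close>

lemma has_weak_gradient_test_function:
  fixes \<Omega> :: "'a::euclidean_space set"
  assumes "open \<Omega>" and \<phi>: "\<phi> \<in> test_functions \<Omega>"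
  shows "has_weak_gradient \<Omega> \<phi> (gradient \<phi>)"
  unfolding has_weak_gradient_def
proof (intro conjI ballI test_function_square_integrable[OF assms])
  fix \<eta> assume \<eta>: "\<eta> \<in> test_functions \<Omega>"
  obtain K where K: "compact K" "K \<subseteq> \<Omega>" "\<And>x. x \<notin> K \<Longrightarrow> \<phi> x = 0"
    "\<And>x. x \<notin> K \<Longrightarrow> frechet_derivative \<phi> (at x) = (\<lambda>_. 0)"
    by (rule test_function_support[OF \<phi>]) (rule that; assumption)
  have c1: "continuous_on UNIV (\<lambda>x. \<phi> x *\<^sub>R gradient \<eta> x)" and c2: "continuous_on UNIV (\<lambda>x. \<eta> x *\<^sub>R gradient \<phi> x)"
    by (intro continuous_on_scaleR test_function_continuous[OF \<phi>] test_function_continuous[OF \<eta>]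
        test_function_gradient_continuous[OF \<phi>] test_function_gradient_continuous[OF \<eta>])+
  have z1: "\<phi> x *\<^sub>R gradient \<eta> x = 0" if "x \<notin> K" for x using K(3)[OF that] by simp
  have z2: "\<eta> x *\<^sub>R gradient \<phi> x = 0" if "x \<notin> K" for x using K(4)[OF that] by (simp add: gradient_def)
  have i1: "integrable lborel (\<lambda>x. \<phi> x *\<^sub>R gradient \<eta> x)"
    by (rule integrable_continuous_compact_support[OF c1 K(1) z1])
  have i2: "integrable lborel (\<lambda>x. \<eta> x *\<^sub>R gradient \<phi> x)"
    by (rule integrable_continuous_compact_support[OF c2 K(1) z2])
  have e1: "(\<integral>x. \<phi> x *\<^sub>R gradient \<eta> x \<partial>lebesgue_on \<Omega>) = (\<integral>x. \<phi> x *\<^sub>R gradient \<eta> x \<partial>lborel)"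
    by (rule integral_lebesgue_on_open[OF assms(1)])
       (use borel_measurable_continuous_onI[OF c1] z1 K(2) in auto)
  have e2: "(\<integral>x. \<eta> x *\<^sub>R gradient \<phi> x \<partial>lebesgue_on \<Omega>) = (\<integral>x. \<eta> x *\<^sub>R gradient \<phi> x \<partial>lborel)"
    by (rule integral_lebesgue_on_open[OF assms(1)])
       (use borel_measurable_continuous_onI[OF c2] z2 K(2) in auto)
  have "(\<integral>x. \<phi> x *\<^sub>R gradient \<eta> x + \<eta> x *\<^sub>R gradient \<phi> x \<partial>lborel) = 0"
  proof (rule euclidean_eqI)
    fix i :: 'a assume i: "i \<in> Basis"
    have "(\<integral>x. \<phi> x *\<^sub>R gradient \<eta> x + \<eta> x *\<^sub>R gradient \<phi> x \<partial>lborel) \<bullet> i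
        = (\<integral>x. (\<phi> x *\<^sub>R gradient \<eta> x + \<eta> x *\<^sub>R gradient \<phi> x) \<bullet> i \<partial>lborel)"
      using Bochner_Integration.integrable_add[OF i1 i2] by (intro integral_inner_left[symmetric]) simp
    also have "\<dots> = (\<integral>x. frechet_derivative (\<lambda>x. \<phi> x * \<eta> x) (at x) i \<partial>lborel)"
      by (simp add: inner_add_left gradient_inner[OF i] frechet_derivative_mult
          test_function_differentiable[OF \<phi>] test_function_differentiable[OF \<eta>] mult.commute add.commute)
    also have "\<dots> = 0"
      by (rule integral_partial_test_function[OF test_function_mult[OF \<eta> test_function_Ck[OF \<phi>]] i])
    finally show "(\<integral>x. \<phi> x *\<^sub>R gradient \<eta> x + \<eta> x *\<^sub>R gradient \<phi> x \<partial>lborel) \<bullet> i = 0 \<bullet> i" by simp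
  qed
  then show "(\<integral>x. \<phi> x *\<^sub>R gradient \<eta> x \<partial>lebesgue_on \<Omega>) = - (\<integral>x. \<eta> x *\<^sub>R gradient \<phi> x \<partial>lebesgue_on \<Omega>)"
    unfolding e1 e2 using i1 i2 by (simp add: eq_neg_iff_add_eq_0)
qed

section \<open>The fundamental lemma of the calculus of variations\<close>

lemma square_integrable_integrable_on_box:
  fixes g :: "'a::euclidean_space \<Rightarrow> 'b::euclidean_space"
  assumes "open \<Omega>" "g square_integrable_on \<Omega>" "box p q \<subseteq> \<Omega>"
  shows "integrable lebesgue (\<lambda>x. indicator (box p q) x *\<^sub>R g x)"
proof (rule Bochner_Integration.integrable_bound)
  have \<Omega>: "\<Omega> \<inter> space lebesgue \<in> sets lebesgue" using open_imp_sets_lebesgue[OF assms(1)] by simp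
  have box: "box p q \<in> sets lebesgue" by (rule open_imp_sets_lebesgue[OF open_box])
  have "integrable lborel (\<lambda>x. indicator (box p q) x :: real)"
    using emeasure_lborel_box_finite[of p q] by (intro integrable_real_indicator) auto
  then have 1: "integrable lebesgue (\<lambda>x. indicator (box p q) x :: real)"
    by (subst integrable_completion) auto
  have 2: "integrable lebesgue (\<lambda>x. indicator \<Omega> x *\<^sub>R (norm (g x))\<^sup>2)"
    using assms(2) integrable_restrict_space[OF \<Omega>, of "\<lambda>x. (norm (g x))\<^sup>2"]
    unfolding square_integrable_on_def by blast
  show "integrable lebesgue (\<lambda>x. indicator (box p q) x + indicator \<Omega> x *\<^sub>R (norm (g x))\<^sup>2 :: real)"
    by (rule Bochner_Integration.integrable_add[OF 1 2])
  have "(\<lambda>x. indicator \<Omega> x *\<^sub>R g x) \<in> borel_measurable lebesgue"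
    using assms(2) borel_measurable_restrict_space_iff[OF \<Omega>, of g]
    unfolding square_integrable_on_def by blast
  then have "(\<lambda>x. indicator (box p q) x *\<^sub>R (indicator \<Omega> x *\<^sub>R g x)) \<in> borel_measurable lebesgue"
    by (rule borel_measurable_scaleR[OF borel_measurable_indicator[OF box]])
  moreover have "(\<lambda>x. indicator (box p q) x *\<^sub>R (indicator \<Omega> x *\<^sub>R g x)) = (\<lambda>x. indicator (box p q) x *\<^sub>R g x)"
    using assms(3) by (auto simp: indicator_def fun_eq_iff)
  ultimately show "(\<lambda>x. indicator (box p q) x *\<^sub>R g x) \<in> borel_measurable lebesgue" by simp
  \<comment> \<open>On the box, which has finite measure, this makes a square integrable function
    integrable.\<close>
  have "norm (g x) \<le> 1 + (norm (g x))\<^sup>2" for x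
  proof -
    have "0 \<le> (norm (g x) - 1)\<^sup>2" by simp
    then have "2 * norm (g x) \<le> (norm (g x))\<^sup>2 + 1" by (simp add: power2_diff)
    then show ?thesis using norm_ge_zero[of "g x"] by linarith
  qed
  then show "AE x in lebesgue. norm (indicator (box p q) x *\<^sub>R g x)
      \<le> norm (indicator (box p q) x + indicator \<Omega> x *\<^sub>R (norm (g x))\<^sup>2 :: real)"
    using assms(3) by (intro AE_I2) (auto simp: indicator_def)
qed

text \<open>The bumps of the box are legitimate test functions; in the limit they become its
  indicator, with \<open>g\<close> restricted to the box as dominating function.\<close>

lemma integral_box_eq_0:
  fixes g :: "'a::euclidean_space \<Rightarrow> 'b::euclidean_space"
  assumes \<Omega>: "open \<Omega>" and g: "g square_integrable_on \<Omega>"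
    and 0: "\<And>\<eta>. \<eta> \<in> test_functions \<Omega> \<Longrightarrow> (\<integral>x. \<eta> x *\<^sub>R g x \<partial>lebesgue_on \<Omega>) = 0"
    and box: "cbox a b \<subseteq> \<Omega>"
  shows "(\<integral>x. indicator (box a b) x *\<^sub>R g x \<partial>lebesgue) = 0"
proof -
  have sub: "box a b \<subseteq> \<Omega>" using box box_subset_cbox by blast
  have int: "integrable lebesgue (\<lambda>x. indicator (box a b) x *\<^sub>R g x)"
    by (rule square_integrable_integrable_on_box[OF \<Omega> g sub])
  have bump_box: "box_bump a b n x *\<^sub>R g x = box_bump a b n x *\<^sub>R (indicator (box a b) x *\<^sub>R g x)" for n x
    using box_bump_eq_0[of x a b n] by (auto simp: indicator_def)
  have zero: "(\<integral>x. box_bump a b n x *\<^sub>R g x \<partial>lebesgue) = 0" for n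
  proof -
    have "(\<integral>x. box_bump a b n x *\<^sub>R g x \<partial>lebesgue_on \<Omega>) = (\<integral>x. indicator \<Omega> x *\<^sub>R (box_bump a b n x *\<^sub>R g x) \<partial>lebesgue)"
      using open_imp_sets_lebesgue[OF \<Omega>] by (intro integral_restrict_space) simp
    also have "(\<lambda>x. indicator \<Omega> x *\<^sub>R (box_bump a b n x *\<^sub>R g x)) = (\<lambda>x. box_bump a b n x *\<^sub>R g x)"
      using sub box_bump_eq_0[of _ a b n] by (fastforce simp: indicator_def fun_eq_iff)
    finally show ?thesis using 0[OF box_bump_test_function[OF box]] by simp
  qed
  have "(\<lambda>n. \<integral>x. box_bump a b n x *\<^sub>R g x \<partial>lebesgue) \<longlonglongrightarrow> (\<integral>x. indicator (box a b) x *\<^sub>R g x \<partial>lebesgue)"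
  proof (rule integral_dominated_convergence)
    show "(\<lambda>x. indicator (box a b) x *\<^sub>R g x) \<in> borel_measurable lebesgue"
      using int by (rule borel_measurable_integrable)
    show "(\<lambda>x. box_bump a b n x *\<^sub>R g x) \<in> borel_measurable lebesgue" for n
    proof -
      have "box_bump a b n \<in> borel_measurable lebesgue"
        using borel_measurable_continuous_onI[OF Ck_imp_continuous[OF Ck_box_bump[of 0 a b n]]]
        by (intro measurable_completion) simp
      then show ?thesis
        unfolding bump_box by (intro borel_measurable_scaleR borel_measurable_integrable[OF int])
    qed
    show "integrable lebesgue (\<lambda>x. norm (indicator (box a b) x *\<^sub>R g x))"
      using int by (rule integrable_norm)
    show "AE x in lebesgue. (\<lambda>n. box_bump a b n x *\<^sub>R g x) \<longlonglongrightarrow> indicator (box a b) x *\<^sub>R g x"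
      by (intro AE_I2 tendsto_scaleR box_bump_tendsto tendsto_const)
    show "AE x in lebesgue. norm (box_bump a b n x *\<^sub>R g x) \<le> norm (indicator (box a b) x *\<^sub>R g x)" for n
      unfolding bump_box using box_bump_bounds[of a b n]
      by (intro AE_I2) (auto simp: indicator_def mult_left_le_one_le)
  qed
  then show ?thesis unfolding zero by (simp add: LIMSEQ_const_iff)
qed

lemma sigma_finite_lebesgue: "sigma_finite_measure (lebesgue :: 'a::euclidean_space measure)"
proof
  obtain A :: "'a set set" where A: "countable A" "A \<subseteq> sets lborel" "\<Union>A = space lborel" "\<forall>a\<in>A. emeasure lborel a \<noteq> \<infinity>"
    using lborel.sigma_finite_countable by metis
  have "A \<subseteq> sets lebesgue" using A(2) by (auto intro: sets_completionI_sets)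
  moreover have "\<forall>a\<in>A. emeasure lebesgue a \<noteq> \<infinity>" using A(2,4) by (auto simp: subset_eq)
  moreover have "\<Union>A = space lebesgue" using A(3) by simp
  ultimately show "\<exists>A::'a set set. countable A \<and> A \<subseteq> sets lebesgue \<and> \<Union>A = space lebesgue \<and> (\<forall>a\<in>A. emeasure lebesgue a \<noteq> \<infinity>)"
    using A(1) by blast
qed

text \<open>Open boxes form an intersection-stable generator of the Borel sets, so vanishing
  integrals extend from boxes to Borel sets by Dynkin's theorem, and to Lebesgue sets because these
  differ from Borel sets by null sets only. A function whose integral over every measurable set is
  zero vanishes almost everywhere.\<close>

lemma AE_zero_on_box:
  fixes g :: "'a::euclidean_space \<Rightarrow> 'b::euclidean_space"
  assumes \<Omega>: "open \<Omega>" and g: "g square_integrable_on \<Omega>"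
    and 0: "\<And>\<eta>. \<eta> \<in> test_functions \<Omega> \<Longrightarrow> (\<integral>x. \<eta> x *\<^sub>R g x \<partial>lebesgue_on \<Omega>) = 0"
    and box: "cbox p q \<subseteq> \<Omega>"
  shows "AE x in lebesgue. x \<in> box p q \<longrightarrow> g x = 0"
proof -
  define f where "f x = indicator (box p q) x *\<^sub>R g x" for x
  have sub: "box p q \<subseteq> \<Omega>" using box box_subset_cbox by blast
  have int: "integrable lebesgue f"
    unfolding f_def by (rule square_integrable_integrable_on_box[OF \<Omega> g sub])
  have intA: "integrable lebesgue (\<lambda>x. indicator A x *\<^sub>R f x)" if "A \<in> sets lebesgue" for A
    using that int by (rule integrable_mult_indicator)
  have basic: "(\<integral>x. indicator (box a b) x *\<^sub>R f x \<partial>lebesgue) = 0" for a b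
  proof -
    obtain c d where cd: "box a b \<inter> box p q = box c d" using box_Int_box by blast
    have "(\<lambda>x. indicator (box a b) x *\<^sub>R f x) = (\<lambda>x. indicator (box c d) x *\<^sub>R g x)"
      unfolding cd[symmetric] f_def by (auto simp: indicator_def fun_eq_iff)
    moreover have "(\<integral>x. indicator (box c d) x *\<^sub>R g x \<partial>lebesgue) = 0"
    \<comment> \<open>An empty \<open>box c d\<close> can have a nonempty \<open>cbox c d\<close>
      outside \<Omega>; for a nonempty one the closed box is the closure.\<close>
    proof (cases "box c d = {}")
      case False
      have "cbox c d \<subseteq> closure (box p q)"
        unfolding closure_box[OF False, symmetric] cd[symmetric] by (intro closure_mono) auto
      also have "\<dots> \<subseteq> cbox p q" by (intro closure_minimal box_subset_cbox closed_cbox)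
      finally have "cbox c d \<subseteq> \<Omega>" using box by blast
      from 0 this show ?thesis by (rule integral_box_eq_0[OF \<Omega> g])
    qed simp
    ultimately show ?thesis by simp
  qed
  have total: "(\<integral>x. f x \<partial>lebesgue) = 0"
  proof -
    have "(\<lambda>x. indicator (box p q) x *\<^sub>R f x) = f" unfolding f_def by (auto simp: indicator_def fun_eq_iff)
    then show ?thesis using basic[of p q] by simp
  qed
  let ?E = "range (\<lambda>(a, b). box a b :: 'a set)"
  have borel_eq: "sets borel = sigma_sets UNIV ?E"
    by (subst borel_eq_box) simp
  have borel0: "(\<integral>x. indicator A x *\<^sub>R f x \<partial>lebesgue) = 0" if "A \<in> sets borel" for A
  proof -
    have "Int_stable ?E"
      unfolding Int_stable_def by (auto simp: box_Int_box)
    moreover have "?E \<subseteq> Pow UNIV" by simp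
    ultimately show ?thesis
      using that unfolding borel_eq
    proof (induction rule: sigma_sets_induct_disjoint)
      case (basic A)
      then show ?case using \<open>\<And>a b. (\<integral>x. indicator (box a b) x *\<^sub>R f x \<partial>lebesgue) = 0\<close> by auto
    next
      case (compl A)
      have A: "A \<in> sets lebesgue" using compl(1) borel_eq by (simp add: sets_completionI_sets)
      have "(\<lambda>x. indicator (UNIV - A) x *\<^sub>R f x) = (\<lambda>x. f x - indicator A x *\<^sub>R f x)"
        by (auto simp: indicator_def fun_eq_iff)
      then show ?case using int intA[OF A] compl total by simp
    next
      case (union A)
      have A: "A i \<in> sets lebesgue" for i
      proof -
        have "A i \<in> sets borel" unfolding borel_eq using union(2) by blast
        then show ?thesis by (simp add: sets_completionI_sets)
      qed
      have "(\<integral>x\<in>(\<Union>i. A i). f x \<partial>lebesgue) = (\<Sum>i. (\<integral>x\<in>A i. f x \<partial>lebesgue))"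
        using union(1) A intA[of "\<Union>i. A i"]
        by (intro lebesgue_integral_countable_add) (auto simp: disjoint_family_on_def set_integrable_def)
      then show ?case using union(3) by (simp add: set_lebesgue_integral_def)
    qed simp
  qed
  have "AE x in lebesgue. f x = 0"
  proof (rule sigma_finite_measure.density_zero[OF sigma_finite_lebesgue int])
    fix A :: "'a set" assume "A \<in> sets lebesgue"
    then obtain S N N' where A: "A = S \<union> N" "N \<subseteq> N'" "N' \<in> null_sets lborel" "S \<in> sets lborel"
      by (rule sets_completionE)
    have "AE x in lebesgue. x \<notin> N'"
      using A(3) by (intro AE_not_in null_sets_completionI)
    then have "AE x in lebesgue. indicator A x *\<^sub>R f x = indicator S x *\<^sub>R f x"
      by eventually_elim (use A(1,2) in \<open>auto simp: indicator_def\<close>)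
    moreover have "S \<in> sets lebesgue" using A(4) by (rule sets_completionI_sets)
    ultimately have "(\<integral>x. indicator A x *\<^sub>R f x \<partial>lebesgue) = (\<integral>x. indicator S x *\<^sub>R f x \<partial>lebesgue)"
      using \<open>A \<in> sets lebesgue\<close> by (intro integral_cong_AE borel_measurable_integrable intA)
    then show "set_lebesgue_integral lebesgue A f = 0"
      using borel0[of S] A(4) by (simp add: set_lebesgue_integral_def)
  qed
  then show ?thesis by eventually_elim (auto simp: f_def)
qed

text \<open>By Lindelof's theorem countably many boxes cover \<Omega>, so the exceptional null sets
  still form a null set.\<close>

lemma fundamental_lemma_calculus_of_variations:
  fixes g :: "'a::euclidean_space \<Rightarrow> 'b::euclidean_space"
  assumes \<Omega>: "open \<Omega>" and g: "g square_integrable_on \<Omega>"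
    and 0: "\<And>\<eta>. \<eta> \<in> test_functions \<Omega> \<Longrightarrow> (\<integral>x. \<eta> x *\<^sub>R g x \<partial>lebesgue_on \<Omega>) = 0"
  shows "AE x in lebesgue_on \<Omega>. g x = 0"
proof -
  define F where "F = {(a, b). cbox a b \<subseteq> \<Omega>}"
  have cover: "\<Omega> \<subseteq> (\<Union>(a, b)\<in>F. box a b)"
  proof
    fix x assume "x \<in> \<Omega>"
    then obtain a b where "cbox a b \<subseteq> \<Omega>" "x \<in> box a b" by (rule open_contains_cbox[OF \<Omega>])
    then show "x \<in> (\<Union>(a, b)\<in>F. box a b)" unfolding F_def by blast
  qed
  have op: "open S" if "S \<in> (\<lambda>(a, b). box a b) ` F" for S using that by auto
  obtain F' where F': "F' \<subseteq> (\<lambda>(a, b). box a b) ` F" "countable F'" "\<Union>F' = \<Union>((\<lambda>(a, b). box a b) ` F)"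
    by (rule Lindelof[OF op])
  have "AE x in lebesgue. \<forall>B\<in>F'. x \<in> B \<longrightarrow> g x = 0"
    unfolding AE_ball_countable[OF F'(2)]
  proof
    fix B assume "B \<in> F'"
    then obtain a b where B: "B = box a b" "cbox a b \<subseteq> \<Omega>" using F'(1) by (auto simp: F_def)
    from 0 B(2) show "AE x in lebesgue. x \<in> B \<longrightarrow> g x = 0"
      unfolding B(1) by (rule AE_zero_on_box[OF \<Omega> g])
  qed
  then have "AE x in lebesgue. x \<in> \<Omega> \<longrightarrow> g x = 0"
    by eventually_elim (use cover F'(3) in auto)
  then show ?thesis
    using open_imp_sets_lebesgue[OF \<Omega>] by (subst AE_restrict_space_iff) auto
qed

section \<open>Linearity and uniqueness in the Sobolev spaces\<close>

lemma weak_gradient_works: "v \<in> H1 \<Omega> \<Longrightarrow> has_weak_gradient \<Omega> v (weak_gradient \<Omega> v)"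
  by (simp add: H1_def weak_gradient_def someI_ex)

lemma has_weak_gradient_imp_H1: "has_weak_gradient \<Omega> v g \<Longrightarrow> v \<in> H1 \<Omega>"
  unfolding H1_def by blast

lemma H1_square_integrable:
  assumes "v \<in> H1 \<Omega>"
  shows "v square_integrable_on \<Omega>" "weak_gradient \<Omega> v square_integrable_on \<Omega>"
  using weak_gradient_works[OF assms] by (auto simp: has_weak_gradient_def)

lemma integrable_scaleR_square_integrable:
  fixes g :: "'a::euclidean_space \<Rightarrow> 'b::euclidean_space"
  assumes v: "v square_integrable_on \<Omega>" and g: "g square_integrable_on \<Omega>"
  shows "integrable (lebesgue_on \<Omega>) (\<lambda>x. v x *\<^sub>R g x)"
proof (rule Bochner_Integration.integrable_bound)
  have "(\<lambda>x. norm (v x)) square_integrable_on \<Omega>" "(\<lambda>x. norm (g x)) square_integrable_on \<Omega>"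
    using v g by (auto simp: square_integrable_on_def)
  from L2_inner_integrable[OF this]
  show "integrable (lebesgue_on \<Omega>) (\<lambda>x. norm (v x) * norm (g x))" by simp
  show "(\<lambda>x. v x *\<^sub>R g x) \<in> borel_measurable (lebesgue_on \<Omega>)"
    using v g by (intro borel_measurable_scaleR) (auto simp: square_integrable_on_def)
qed (auto intro!: AE_I2)

lemma has_weak_gradient_diff:
  assumes \<Omega>: "open \<Omega>" and v: "has_weak_gradient \<Omega> v g" and w: "has_weak_gradient \<Omega> w h"
  shows "has_weak_gradient \<Omega> (\<lambda>x. v x - w x) (\<lambda>x. g x - h x)"
  unfolding has_weak_gradient_def
proof (intro conjI ballI)
  have sq: "v square_integrable_on \<Omega>" "g square_integrable_on \<Omega>" "w square_integrable_on \<Omega>" "h square_integrable_on \<Omega>"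
    using v w by (auto simp: has_weak_gradient_def)
  then show "(\<lambda>x. v x - w x) square_integrable_on \<Omega>" "(\<lambda>x. g x - h x) square_integrable_on \<Omega>"
    by (auto intro: square_integrable_diff)
  fix \<phi> assume \<phi>: "\<phi> \<in> test_functions \<Omega>"
  have e: "(\<integral>x. v x *\<^sub>R gradient \<phi> x \<partial>lebesgue_on \<Omega>) = - (\<integral>x. \<phi> x *\<^sub>R g x \<partial>lebesgue_on \<Omega>)"
    "(\<integral>x. w x *\<^sub>R gradient \<phi> x \<partial>lebesgue_on \<Omega>) = - (\<integral>x. \<phi> x *\<^sub>R h x \<partial>lebesgue_on \<Omega>)"
    using v w \<phi> by (auto simp: has_weak_gradient_def)
  note t = test_function_square_integrable[OF \<Omega> \<phi>]
  show "(\<integral>x. (v x - w x) *\<^sub>R gradient \<phi> x \<partial>lebesgue_on \<Omega>) = - (\<integral>x. \<phi> x *\<^sub>R (g x - h x) \<partial>lebesgue_on \<Omega>)"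
    using e integrable_scaleR_square_integrable[OF sq(1) t(2)] integrable_scaleR_square_integrable[OF sq(3) t(2)]
      integrable_scaleR_square_integrable[OF t(1) sq(2)] integrable_scaleR_square_integrable[OF t(1) sq(4)]
    by (simp add: scaleR_left_diff_distrib scaleR_right_diff_distrib)
qed

text \<open>The difference of two weak gradients of \<open>v\<close> is a weak gradient of
  \<open>v - v\<close>, so it annihilates all test functions.\<close>

lemma has_weak_gradient_unique:
  assumes \<Omega>: "open \<Omega>" and g: "has_weak_gradient \<Omega> v g" and h: "has_weak_gradient \<Omega> v h"
  shows "AE x in lebesgue_on \<Omega>. g x = h x"
proof -
  have d: "has_weak_gradient \<Omega> (\<lambda>x. v x - v x) (\<lambda>x. g x - h x)"
    by (rule has_weak_gradient_diff[OF assms])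
  have "AE x in lebesgue_on \<Omega>. g x - h x = 0"
  proof (rule fundamental_lemma_calculus_of_variations[OF \<Omega>])
    show "(\<lambda>x. g x - h x) square_integrable_on \<Omega>" using d by (simp add: has_weak_gradient_def)
    fix \<eta> assume "\<eta> \<in> test_functions \<Omega>"
    then show "(\<integral>x. \<eta> x *\<^sub>R (g x - h x) \<partial>lebesgue_on \<Omega>) = 0"
      using d by (simp add: has_weak_gradient_def)
  qed
  then show ?thesis by simp
qed

lemma L2_norm_weak_gradient_eq:
  assumes "open \<Omega>" "has_weak_gradient \<Omega> v g"
  shows "L2_norm \<Omega> (weak_gradient \<Omega> v) = L2_norm \<Omega> g"
  using has_weak_gradient_unique[OF assms(1) weak_gradient_works[OF has_weak_gradient_imp_H1[OF assms(2)]] assms(2)]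
    H1_square_integrable(2)[OF has_weak_gradient_imp_H1[OF assms(2)]] assms(2)
  by (intro L2_norm_cong_AE) (simp_all add: has_weak_gradient_def)

text \<open>The chosen gradient of a difference agrees with the difference of the chosen gradients
  only almost everywhere, which is all that an inner product sees.\<close>

lemma L2_inner_weak_gradient_diff:
  assumes \<Omega>: "open \<Omega>" and v: "v \<in> H1 \<Omega>" and w: "w \<in> H1 \<Omega>" and z: "z square_integrable_on \<Omega>"
  shows "L2_inner \<Omega> z (weak_gradient \<Omega> (\<lambda>x. v x - w x)) = L2_inner \<Omega> z (weak_gradient \<Omega> v) - L2_inner \<Omega> z (weak_gradient \<Omega> w)"
proof -
  have d: "has_weak_gradient \<Omega> (\<lambda>x. v x - w x) (\<lambda>x. weak_gradient \<Omega> v x - weak_gradient \<Omega> w x)"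
    by (intro has_weak_gradient_diff \<Omega> weak_gradient_works v w)
  have H: "(\<lambda>x. v x - w x) \<in> H1 \<Omega>" using d by (rule has_weak_gradient_imp_H1)
  have "L2_inner \<Omega> z (weak_gradient \<Omega> (\<lambda>x. v x - w x)) = L2_inner \<Omega> z (\<lambda>x. weak_gradient \<Omega> v x - weak_gradient \<Omega> w x)"
    by (intro L2_inner_cong_AE has_weak_gradient_unique[OF \<Omega> weak_gradient_works[OF H] d] z H1_square_integrable[OF H]
        square_integrable_diff H1_square_integrable[OF v] H1_square_integrable[OF w]) simp
  then show ?thesis
    using L2_inner_diff_right[OF H1_square_integrable(2)[OF v] H1_square_integrable(2)[OF w] z] by simp
qed

lemma H1_norm_bounds:
  "L2_norm \<Omega> v \<le> H1_norm \<Omega> v" "L2_norm \<Omega> (weak_gradient \<Omega> v) \<le> H1_norm \<Omega> v"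
  "H1_norm \<Omega> v \<le> L2_norm \<Omega> v + L2_norm \<Omega> (weak_gradient \<Omega> v)"
  unfolding H1_norm_def
  by (simp_all add: real_sqrt_sum_squares_ge1 real_sqrt_sum_squares_ge2 sqrt_sum_squares_le_sum)

lemma H10_imp_H1: "v \<in> H10 \<Omega> \<Longrightarrow> v \<in> H1 \<Omega>"
  by (simp add: H10_def)

lemma H10_approx: "v \<in> H10 \<Omega> \<Longrightarrow> 0 < \<epsilon> \<Longrightarrow> \<exists>\<phi>\<in>test_functions \<Omega>. H1_norm \<Omega> (\<lambda>x. v x - \<phi> x) < \<epsilon>"
  by (simp add: H10_def)

lemma test_function_imp_H1: "open \<Omega> \<Longrightarrow> \<phi> \<in> test_functions \<Omega> \<Longrightarrow> \<phi> \<in> H1 \<Omega>"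
  by (rule has_weak_gradient_imp_H1[OF has_weak_gradient_test_function])

lemma H1_diff: "open \<Omega> \<Longrightarrow> v \<in> H1 \<Omega> \<Longrightarrow> w \<in> H1 \<Omega> \<Longrightarrow> (\<lambda>x. v x - w x) \<in> H1 \<Omega>"
  by (rule has_weak_gradient_imp_H1[OF has_weak_gradient_diff[OF _ weak_gradient_works weak_gradient_works]])

lemma H1_norm_triangle:
  assumes \<Omega>: "open \<Omega>" and v: "v \<in> H1 \<Omega>" and w: "w \<in> H1 \<Omega>"
  shows "H1_norm \<Omega> (\<lambda>x. v x - w x) \<le> 2 * (H1_norm \<Omega> v + H1_norm \<Omega> w)"
proof -
  have "L2_norm \<Omega> (weak_gradient \<Omega> (\<lambda>x. v x - w x)) = L2_norm \<Omega> (\<lambda>x. weak_gradient \<Omega> v x - weak_gradient \<Omega> w x)"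
    by (intro L2_norm_weak_gradient_eq has_weak_gradient_diff \<Omega> weak_gradient_works v w)
  then have "H1_norm \<Omega> (\<lambda>x. v x - w x) \<le> (L2_norm \<Omega> v + L2_norm \<Omega> w)
      + (L2_norm \<Omega> (weak_gradient \<Omega> v) + L2_norm \<Omega> (weak_gradient \<Omega> w))"
    using H1_norm_bounds(3)[of \<Omega> "\<lambda>x. v x - w x"]
      L2_norm_triangle[OF H1_square_integrable(1)[OF v] H1_square_integrable(1)[OF w]]
      L2_norm_triangle[OF H1_square_integrable(2)[OF v] H1_square_integrable(2)[OF w]] by linarith
  then show ?thesis
    using H1_norm_bounds(1,2)[of \<Omega> v] H1_norm_bounds(1,2)[of \<Omega> w] by simp
qed

lemma H10_diff:
  assumes \<Omega>: "open \<Omega>" and v: "v \<in> H10 \<Omega>" and w: "w \<in> H10 \<Omega>"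
  shows "(\<lambda>x. v x - w x) \<in> H10 \<Omega>"
  unfolding H10_def
proof (intro CollectI conjI allI impI)
  show "(\<lambda>x. v x - w x) \<in> H1 \<Omega>" by (intro H1_diff \<Omega> H10_imp_H1 v w)
  fix \<epsilon> :: real assume "0 < \<epsilon>"
  \<comment> \<open>Two approximation errors, and the factor 2 lost in
    \<open>H1_norm_triangle\<close>.\<close>
  then have e: "0 < \<epsilon> / 4" by simp
  obtain \<phi> where \<phi>: "\<phi> \<in> test_functions \<Omega>" "H1_norm \<Omega> (\<lambda>x. v x - \<phi> x) < \<epsilon> / 4"
    using H10_approx[OF v e] by blast
  obtain \<psi> where \<psi>: "\<psi> \<in> test_functions \<Omega>" "H1_norm \<Omega> (\<lambda>x. w x - \<psi> x) < \<epsilon> / 4"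
    using H10_approx[OF w e] by blast
  have "H1_norm \<Omega> (\<lambda>x. (v x - \<phi> x) - (w x - \<psi> x)) \<le> 2 * (H1_norm \<Omega> (\<lambda>x. v x - \<phi> x) + H1_norm \<Omega> (\<lambda>x. w x - \<psi> x))"
    by (intro H1_norm_triangle H1_diff \<Omega> H10_imp_H1 v w test_function_imp_H1 \<phi>(1) \<psi>(1))
  also have "\<dots> < \<epsilon>" using \<phi>(2) \<psi>(2) by simp
  also have "(\<lambda>x. (v x - \<phi> x) - (w x - \<psi> x)) = (\<lambda>x. (v x - w x) - (\<phi> x - \<psi> x))"
    by (simp add: fun_eq_iff)
  finally show "\<exists>\<phi>\<in>test_functions \<Omega>. H1_norm \<Omega> (\<lambda>x. (v x - w x) - \<phi> x) < \<epsilon>"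
    by (intro bexI[of _ "\<lambda>x. \<phi> x - \<psi> x"] test_function_diff \<phi>(1) \<psi>(1))
qed

text \<open>Integrating \<open>\<partial>\<^sub>i ((x \<bullet> i) \<phi>\<^sup>2) = \<phi>\<^sup>2 + 2 (x \<bullet> i) \<phi> \<partial>\<^sub>i \<phi>\<close> reduces the Poincare inequality to the
  Cauchy-Schwarz inequality.\<close>

lemma Poincare_test_function:
  fixes \<Omega> :: "'a::euclidean_space set"
  assumes \<Omega>: "open \<Omega>" and R: "\<And>x. x \<in> \<Omega> \<Longrightarrow> norm x \<le> R" and \<phi>: "\<phi> \<in> test_functions \<Omega>"
  shows "L2_norm \<Omega> \<phi> \<le> 2 * \<bar>R\<bar> * L2_norm \<Omega> (gradient \<phi>)"
proof -
  obtain i :: 'a where i: "i \<in> Basis" using nonempty_Basis by blast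
  obtain K where K: "compact K" "K \<subseteq> \<Omega>" "\<And>x. x \<notin> K \<Longrightarrow> \<phi> x = 0"
    "\<And>x. x \<notin> K \<Longrightarrow> frechet_derivative \<phi> (at x) = (\<lambda>_. 0)"
    by (rule test_function_support[OF \<phi>]) (rule that; assumption)
  let ?D = "\<lambda>x. frechet_derivative \<phi> (at x) i"
  note cont = test_function_continuous[OF \<phi>] and contD = test_function_partial_continuous[OF \<phi> i]
    and diff = test_function_differentiable[OF \<phi>]
  define a where "a x = \<bar>\<phi> x\<bar>" for x
  define b where "b x = norm (gradient \<phi> x)" for x
  have sq: "a square_integrable_on \<Omega>" "b square_integrable_on \<Omega>"
    using test_function_square_integrable[OF \<Omega> \<phi>] unfolding a_def[abs_def] b_def[abs_def]
    by (auto simp: square_integrable_on_def)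
  have norms: "L2_norm \<Omega> a = L2_norm \<Omega> \<phi>" "L2_norm \<Omega> b = L2_norm \<Omega> (gradient \<phi>)"
    by (simp_all add: L2_norm_def a_def b_def)
  have c1: "continuous_on UNIV (\<lambda>x. (\<phi> x)\<^sup>2)" by (intro continuous_intros cont)
  have c2: "continuous_on UNIV (\<lambda>x. 2 * (x \<bullet> i) * \<phi> x * ?D x)" by (intro continuous_intros cont contD)
  have i1: "integrable lborel (\<lambda>x. (\<phi> x)\<^sup>2)"
    by (rule integrable_continuous_compact_support[OF c1 K(1)]) (simp add: K(3))
  have i2: "integrable lborel (\<lambda>x. 2 * (x \<bullet> i) * \<phi> x * ?D x)"
    by (rule integrable_continuous_compact_support[OF c2 K(1)]) (simp add: K(3))
  have "(\<integral>x. frechet_derivative (\<lambda>x. (x \<bullet> i) * (\<phi> x * \<phi> x)) (at x) i \<partial>lborel) = 0"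
    by (rule integral_partial_test_function[OF test_function_mult[OF test_function_mult[OF \<phi> test_function_Ck[OF \<phi>]] Ck_inner] i])
  moreover have "frechet_derivative (\<lambda>x. (x \<bullet> i) * (\<phi> x * \<phi> x)) (at x) i = (\<phi> x)\<^sup>2 + 2 * (x \<bullet> i) * \<phi> x * ?D x" for x
  proof -
    have "((\<lambda>x. x \<bullet> i) has_derivative (\<lambda>h. h \<bullet> i)) (at x)" by (auto intro!: derivative_eq_intros)
    then have 1: "(\<lambda>x. x \<bullet> i) differentiable (at x)" "frechet_derivative (\<lambda>x. x \<bullet> i) (at x) = (\<lambda>h. h \<bullet> i)"
      unfolding differentiable_def using frechet_derivative_eq by blast+
    show ?thesis
      using i by (simp add: frechet_derivative_mult differentiable_mult 1 diff power2_eq_square algebra_simps inner_Basis)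
  qed
  ultimately have eq: "(\<integral>x. (\<phi> x)\<^sup>2 \<partial>lborel) = - (\<integral>x. 2 * (x \<bullet> i) * \<phi> x * ?D x \<partial>lborel)"
    using i1 i2 by simp
  have z: "\<phi> x = 0" if "x \<notin> \<Omega>" for x using K(2,3) that by blast
  have pw: "- (2 * (x \<bullet> i) * \<phi> x * ?D x) \<le> 2 * \<bar>R\<bar> * (a x * b x)" for x
  proof (cases "x \<in> K")
    case True
    have "norm x \<le> R" using R K(2) True by blast
    then have "\<bar>x \<bullet> i\<bar> \<le> \<bar>R\<bar>" using Basis_le_norm[OF i, of x] by linarith
    moreover have "\<bar>?D x\<bar> \<le> b x" using Basis_le_norm[OF i, of "gradient \<phi> x"] by (simp add: gradient_inner[OF i] b_def)
    ultimately have "\<bar>x \<bullet> i\<bar> * (\<bar>\<phi> x\<bar> * \<bar>?D x\<bar>) \<le> \<bar>R\<bar> * (\<bar>\<phi> x\<bar> * b x)"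
      by (intro mult_mono mult_left_mono mult_nonneg_nonneg abs_ge_zero)
    then have "\<bar>(x \<bullet> i) * \<phi> x * ?D x\<bar> \<le> \<bar>R\<bar> * (a x * b x)" by (simp add: abs_mult a_def mult.assoc)
    then show ?thesis by (simp only: abs_le_iff mult.assoc) linarith
  qed (simp add: K(3) a_def)
  have cab: "continuous_on UNIV (\<lambda>x. 2 * \<bar>R\<bar> * (a x * b x))"
    unfolding a_def b_def by (intro continuous_intros cont test_function_gradient_continuous[OF \<phi>])
  have iab: "integrable lborel (\<lambda>x. 2 * \<bar>R\<bar> * (a x * b x))"
    by (rule integrable_continuous_compact_support[OF cab K(1)]) (simp add: K(3) a_def)
  have "(L2_norm \<Omega> \<phi>)\<^sup>2 = (\<integral>x. (\<phi> x)\<^sup>2 \<partial>lebesgue_on \<Omega>)"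
    by (simp add: L2_norm_def)
  also have "\<dots> = (\<integral>x. (\<phi> x)\<^sup>2 \<partial>lborel)"
    by (rule integral_lebesgue_on_open[OF \<Omega> borel_measurable_continuous_onI[OF c1]]) (simp add: z)
  also have "\<dots> \<le> (\<integral>x. 2 * \<bar>R\<bar> * (a x * b x) \<partial>lborel)"
  proof -
    have "(\<integral>x. (\<phi> x)\<^sup>2 \<partial>lborel) = (\<integral>x. - (2 * (x \<bullet> i) * \<phi> x * ?D x) \<partial>lborel)"
      using eq by simp
    also have "\<dots> \<le> (\<integral>x. 2 * \<bar>R\<bar> * (a x * b x) \<partial>lborel)"
      by (rule integral_mono[OF integrable_minus[OF i2] iab pw])
    finally show ?thesis .
  qed
  also have "\<dots> = (\<integral>x. 2 * \<bar>R\<bar> * (a x * b x) \<partial>lebesgue_on \<Omega>)"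
    by (rule integral_lebesgue_on_open[OF \<Omega> borel_measurable_continuous_onI[OF cab], symmetric]) (simp add: z a_def)
  also have "\<dots> = 2 * \<bar>R\<bar> * L2_inner \<Omega> a b" by (simp add: L2_inner_def)
  also have "\<dots> \<le> 2 * \<bar>R\<bar> * (L2_norm \<Omega> a * L2_norm \<Omega> b)"
    using L2_Cauchy_Schwarz[OF sq] by (intro mult_left_mono) auto
  finally have le: "L2_norm \<Omega> \<phi> * L2_norm \<Omega> \<phi> \<le> (2 * \<bar>R\<bar> * L2_norm \<Omega> (gradient \<phi>)) * L2_norm \<Omega> \<phi>"
    by (simp add: norms power2_eq_square mult_ac)
  show ?thesis
  proof (cases "L2_norm \<Omega> \<phi> = 0")
    case False
    then have "0 < L2_norm \<Omega> \<phi>" using L2_norm_nonneg[of \<Omega> \<phi>] by linarith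
    from mult_right_le_imp_le[OF le this] show ?thesis .
  qed simp
qed

lemma sobolev_embedding_constant_exists:
  fixes \<Omega> :: "'a::euclidean_space set"
  assumes "open \<Omega>" "bounded \<Omega>"
  shows "\<exists>C. sobolev_embedding_constant \<Omega> C"
proof -
  obtain R where R: "\<And>x. x \<in> \<Omega> \<Longrightarrow> norm x \<le> R" using assms(2) unfolding bounded_iff by blast
  define C where "C = 2 * \<bar>R\<bar>"
  have "L2_norm \<Omega> v \<le> C * L2_norm \<Omega> (weak_gradient \<Omega> v)" if v: "v \<in> H10 \<Omega>" for v
  proof (rule field_le_epsilon)
    fix \<epsilon> :: real assume "0 < \<epsilon>"
    \<comment> \<open>The approximation error occurs once by itself and once multiplied by
      \<open>C\<close>.\<close>
    then have "0 < \<epsilon> / (C + 1)" by (simp add: C_def)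
    from H10_approx[OF v this]
    obtain \<phi> where \<phi>: "\<phi> \<in> test_functions \<Omega>" "H1_norm \<Omega> (\<lambda>x. v x - \<phi> x) < \<epsilon> / (C + 1)"
      by blast
    note H = H10_imp_H1[OF v] and T = test_function_imp_H1[OF assms(1) \<phi>(1)]
    have g: "L2_norm \<Omega> (gradient \<phi>) = L2_norm \<Omega> (weak_gradient \<Omega> \<phi>)"
      by (rule L2_norm_weak_gradient_eq[OF assms(1) has_weak_gradient_test_function[OF assms(1) \<phi>(1)], symmetric])
    have d: "L2_norm \<Omega> (weak_gradient \<Omega> (\<lambda>x. v x - \<phi> x)) = L2_norm \<Omega> (\<lambda>x. weak_gradient \<Omega> v x - weak_gradient \<Omega> \<phi> x)"
      by (intro L2_norm_weak_gradient_eq has_weak_gradient_diff assms(1) weak_gradient_works H T)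
    have "L2_norm \<Omega> (\<lambda>x. - (weak_gradient \<Omega> v x - weak_gradient \<Omega> \<phi> x)) < \<epsilon> / (C + 1)"
      unfolding L2_norm_minus using H1_norm_bounds(2)[of \<Omega> "\<lambda>x. v x - \<phi> x"] \<phi>(2) d by linarith
    then have 1: "L2_norm \<Omega> (weak_gradient \<Omega> \<phi>) \<le> L2_norm \<Omega> (weak_gradient \<Omega> v) + \<epsilon> / (C + 1)"
      using L2_norm_le_add_diff[OF H1_square_integrable(2)[OF T] H1_square_integrable(2)[OF H]] by simp
    have "L2_norm \<Omega> v \<le> L2_norm \<Omega> \<phi> + \<epsilon> / (C + 1)"
      using L2_norm_le_add_diff[OF H1_square_integrable(1)[OF H] H1_square_integrable(1)[OF T]]
        H1_norm_bounds(1)[of \<Omega> "\<lambda>x. v x - \<phi> x"] \<phi>(2) by linarith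
    also have "L2_norm \<Omega> \<phi> \<le> C * L2_norm \<Omega> (weak_gradient \<Omega> \<phi>)"
      unfolding g[symmetric] C_def by (rule Poincare_test_function[OF assms(1) R \<phi>(1)])
    also have "\<dots> \<le> C * (L2_norm \<Omega> (weak_gradient \<Omega> v) + \<epsilon> / (C + 1))"
      using 1 by (intro mult_left_mono) (auto simp: C_def)
    also have "\<dots> + \<epsilon> / (C + 1) = C * L2_norm \<Omega> (weak_gradient \<Omega> v) + \<epsilon>"
    proof -
      have "C + 1 \<noteq> 0" by (simp add: C_def)
      then have "(C + 1) * (\<epsilon> / (C + 1)) = \<epsilon>" by simp
      then have "C * (\<epsilon> / (C + 1)) + \<epsilon> / (C + 1) = \<epsilon>" by (simp only: distrib_right mult_1)
      then show ?thesis by (simp only: distrib_left add.assoc)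
    qed
    finally show "L2_norm \<Omega> v \<le> C * L2_norm \<Omega> (weak_gradient \<Omega> v) + \<epsilon>" by simp
  qed
  then show ?thesis unfolding sobolev_embedding_constant_def by (intro exI[of _ C]) (simp add: C_def)
qed

section \<open>The mesh conditions\<close>

lemma ex1_positive_root:
  fixes g :: "real \<Rightarrow> real"
  assumes cont: "continuous_on UNIV g" and "g 0 < c" "c < g 1"
    and mono: "\<And>x y. 0 < x \<Longrightarrow> x < y \<Longrightarrow> g x < g y"
  shows "\<exists>!x. 0 < x \<and> g x = c"
proof -
  obtain x where x: "0 \<le> x" "x \<le> 1" "g x = c"
    using IVT'[of g 0 c 1] assms(2,3) continuous_on_subset[OF cont subset_UNIV] by auto
  then have "0 < x" using assms(2) by (cases "x = 0") auto
  moreover have "y = x" if "0 < y" "g y = c" for y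
    using mono[of x y] mono[of y x] that x \<open>0 < x\<close> by (cases x y rule: linorder_cases) auto
  ultimately show ?thesis using x by blast
qed

lemma cubic_strict_mono: "0 < x \<Longrightarrow> x < y \<Longrightarrow> x\<^sup>2 * (1 + x) < y\<^sup>2 * (1 + y)" for x y :: real
  by (intro mult_strict_mono power_strict_mono) auto

text \<open>\<open>rho_lower\<close> is the positive fixed point of x^2 (1 + x) / (1 - 3 x^2 (1 +
  x)), the bound on the ratio following a small ratio \<open>x\<close>. With all terms on one side
  the equation becomes monotone, which gives uniqueness.\<close>

lemma rho_lower_props: "0 < rho_lower" "rho_lower * (1 + rho_lower) = 1 - 3 * rho_lower\<^sup>2 * (1 + rho_lower)"
proof -
  have "\<exists>!x. 0 < x \<and> x * (1 + x) + 3 * (x\<^sup>2 * (1 + x)) = (1::real)"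
  proof (rule ex1_positive_root)
    show "continuous_on UNIV (\<lambda>x::real. x * (1 + x) + 3 * (x\<^sup>2 * (1 + x)))" by (intro continuous_intros)
    fix x y :: real assume xy: "0 < x" "x < y"
    have "x * (1 + x) < y * (1 + y)" using xy by (intro mult_strict_mono) auto
    then show "x * (1 + x) + 3 * (x\<^sup>2 * (1 + x)) < y * (1 + y) + 3 * (y\<^sup>2 * (1 + y))"
      using cubic_strict_mono[OF xy] by simp
  qed auto
  moreover have "(0 < x \<and> x * (1 + x) + 3 * (x\<^sup>2 * (1 + x)) = 1) \<longleftrightarrow> (0 < x \<and> x * (1 + x) = 1 - 3 * x\<^sup>2 * (1 + x))" for x :: real
    by (auto simp: algebra_simps)
  ultimately have "\<exists>!x. 0 < x \<and> x * (1 + x) = 1 - 3 * x\<^sup>2 * (1 + (x::real))" by simp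
  from theI'[OF this] show "0 < rho_lower" "rho_lower * (1 + rho_lower) = 1 - 3 * rho_lower\<^sup>2 * (1 + rho_lower)"
    unfolding rho_lower_def by auto
qed

text \<open>Used for \<open>xi1\<close> with \<open>c = rho_upper\<close> and for
  \<open>rho_L\<close> with \<open>c = rho_R\<close>. Cleared of its denominator, the equation has a
  monotone left-hand side. A zero of the denominator is no solution: there that side is
  \<open>1 / 3 + c\<close>.\<close>

lemma the_lower_root:
  fixes c :: real
  assumes c: "0 < c"
  defines "r \<equiv> (THE \<rho>. 0 < \<rho> \<and> \<rho>\<^sup>2 * (1 + \<rho>) / (1 - 3 * \<rho>\<^sup>2 * (1 + \<rho>)) = c)"
  shows "0 < r" "0 < 1 - 3 * r\<^sup>2 * (1 + r)" "r\<^sup>2 * (1 + r) = c * (1 - 3 * r\<^sup>2 * (1 + r))"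
proof -
  have ex: "\<exists>!x. 0 < x \<and> (1 + 3 * c) * (x\<^sup>2 * (1 + x)) = c"
  proof (rule ex1_positive_root)
    show "continuous_on UNIV (\<lambda>x::real. (1 + 3 * c) * (x\<^sup>2 * (1 + x)))" by (intro continuous_intros)
    show "0 < x \<Longrightarrow> x < y \<Longrightarrow> (1 + 3 * c) * (x\<^sup>2 * (1 + x)) < (1 + 3 * c) * (y\<^sup>2 * (1 + y))" for x y
      using c by (intro mult_strict_left_mono cubic_strict_mono) auto
  qed (use c in auto)
  have iff: "(0 < x \<and> x\<^sup>2 * (1 + x) / (1 - 3 * x\<^sup>2 * (1 + x)) = c) \<longleftrightarrow> (0 < x \<and> (1 + 3 * c) * (x\<^sup>2 * (1 + x)) = c)" for x :: real
  proof (cases "1 - 3 * x\<^sup>2 * (1 + x) = 0")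
    case True
    then have "x\<^sup>2 * (1 + x) = 1 / 3" unfolding mult.assoc by linarith
    then have "(1 + 3 * c) * (x\<^sup>2 * (1 + x)) = (1 + 3 * c) * (1 / 3)" by (rule arg_cong)
    also have "\<dots> = 1 / 3 + c" by (simp add: field_simps)
    finally have "(1 + 3 * c) * (x\<^sup>2 * (1 + x)) = 1 / 3 + c" .
    then show ?thesis using c True by simp
  next
    case False
    then have "x\<^sup>2 * (1 + x) / (1 - 3 * x\<^sup>2 * (1 + x)) = c \<longleftrightarrow> x\<^sup>2 * (1 + x) = c * (1 - 3 * x\<^sup>2 * (1 + x))"
      by (rule nonzero_divide_eq_eq)
    then show ?thesis by (auto simp: algebra_simps)
  qed
  have r: "0 < r \<and> r\<^sup>2 * (1 + r) / (1 - 3 * r\<^sup>2 * (1 + r)) = c"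
    unfolding r_def by (rule theI') (simp only: iff ex)
  then show "0 < r" by simp
  show eq: "r\<^sup>2 * (1 + r) = c * (1 - 3 * r\<^sup>2 * (1 + r))"
    using r iff[of r] by (auto simp: algebra_simps)
  have "0 < r\<^sup>2 * (1 + r)" using r by simp
  then show "0 < 1 - 3 * r\<^sup>2 * (1 + r)" unfolding eq using c by (simp add: zero_less_mult_iff)
qed

text \<open>At \<open>rho_upper\<close> the bound (- x^2 + 4 x + 2) / (x^2 - 3 x - 1) on the
  following ratio has come down to \<open>rho_lower\<close>. Equivalently x^2 = c x + d with
  \<open>c \<le> 4\<close> and \<open>d \<le> 2\<close>, whence the inequality behind
  \<open>ratio_bound\<close>.\<close>

lemma rho_upper_props:
  "0 < rho_upper" "rho_upper\<^sup>2 \<le> 4 * rho_upper + 2"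
proof -
  define y where "y = rho_lower"
  define c d where "c = (4 + 3 * y) / (1 + y)" and "d = (2 + y) / (1 + y)"
  have y: "0 < y" using rho_lower_props(1) by (simp add: y_def)
  have cd: "0 < c" "c \<le> 4" "0 < d" "d \<le> 2" using y by (auto simp: c_def d_def field_simps)
  have R: "rho_upper = 1 / 2 * (c + sqrt (c\<^sup>2 + 4 * d))"
    unfolding rho_upper_def c_def d_def y_def ..
  have s: "0 < sqrt (c\<^sup>2 + 4 * d)" using cd by (simp add: add_nonneg_pos)
  then show pos: "0 < rho_upper" using add_pos_pos[OF cd(1) s] unfolding R by simp
  have "rho_upper\<^sup>2 = c * rho_upper + d"
  proof -
    have "(sqrt (c\<^sup>2 + 4 * d))\<^sup>2 = c\<^sup>2 + 4 * d" using cd by simp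
    then show ?thesis unfolding R by (simp add: power2_eq_square field_simps)
  qed
  also have "\<dots> \<le> 4 * rho_upper + 2" using cd pos by (intro add_mono mult_right_mono) auto
  finally show "rho_upper\<^sup>2 \<le> 4 * rho_upper + 2" .
qed

text \<open>Clearing the denominator leaves a quadratic whose roots have a negative product, so only
  one of them is positive. A zero of the denominator would solve it only for
  \<open>x = -1\<close>.\<close>

lemma xi2_props: "0 < xi2" "(1 + rho_upper) * xi2\<^sup>2 = (4 + 3 * rho_upper) * xi2 + (2 + rho_upper)"
proof -
  define c where "c = rho_upper"
  have c: "0 < c" using rho_upper_props by (simp add: c_def)
  define D where "D = (4 + 3 * c)\<^sup>2 + 4 * (1 + c) * (2 + c)"
  define r where "r = ((4 + 3 * c) + sqrt D) / (2 * (1 + c))"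
  have D: "0 < D" using c unfolding D_def by (intro add_nonneg_pos) auto
  have r0: "0 < r" unfolding r_def using c D by (intro divide_pos_pos add_pos_pos) auto
  have req: "(1 + c) * r\<^sup>2 = (4 + 3 * c) * r + (2 + c)"
  proof -
    have "2 * (1 + c) * r = (4 + 3 * c) + sqrt D" using c by (simp add: r_def)
    then have "(2 * (1 + c) * r - (4 + 3 * c))\<^sup>2 = D" using D by simp
    then have "4 * (1 + c) * ((1 + c) * r\<^sup>2) = 4 * (1 + c) * ((4 + 3 * c) * r + (2 + c))"
      unfolding D_def by (simp add: power2_eq_square algebra_simps)
    then show ?thesis using c by simp
  qed
  have iff: "(0 < x \<and> (- x\<^sup>2 + 4 * x + 2) / (x\<^sup>2 - 3 * x - 1) = c) \<longleftrightarrow> (0 < x \<and> (1 + c) * x\<^sup>2 = (4 + 3 * c) * x + (2 + c))" for x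
  proof (cases "x\<^sup>2 - 3 * x - 1 = 0")
    case True
    then have "x\<^sup>2 = 3 * x + 1" by simp
    then show ?thesis using c True by (auto simp: algebra_simps)
  next
    case False
    then have "(- x\<^sup>2 + 4 * x + 2) / (x\<^sup>2 - 3 * x - 1) = c \<longleftrightarrow> - x\<^sup>2 + 4 * x + 2 = c * (x\<^sup>2 - 3 * x - 1)"
      by (rule nonzero_divide_eq_eq)
    then show ?thesis by (auto simp: algebra_simps)
  qed
  have uniq: "x = r" if "0 < x" "(1 + c) * x\<^sup>2 = (4 + 3 * c) * x + (2 + c)" for x
  proof (rule ccontr)
    assume "x \<noteq> r"
    have "(x - r) * ((1 + c) * (x * r) + (2 + c)) = ((1 + c) * x\<^sup>2 - (4 + 3 * c) * x - (2 + c)) * r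
        - ((1 + c) * r\<^sup>2 - (4 + 3 * c) * r - (2 + c)) * x"
      by (simp add: algebra_simps power2_eq_square)
    also have "\<dots> = 0" using that(2) req by simp
    finally have "(1 + c) * (x * r) + (2 + c) = 0" using \<open>x \<noteq> r\<close> by simp
    moreover have "0 < (1 + c) * (x * r) + (2 + c)" using c r0 that(1) by (intro add_pos_pos mult_pos_pos) auto
    ultimately show False by simp
  qed
  have "xi2 = r"
    unfolding xi2_def c_def[symmetric] iff
  proof (rule the_equality)
    show "0 < r \<and> (1 + c) * r\<^sup>2 = (4 + 3 * c) * r + (2 + c)" using r0 req by blast
    show "x = r" if "0 < x \<and> (1 + c) * x\<^sup>2 = (4 + 3 * c) * x + (2 + c)" for x
      using that by (intro uniq) blast+
  qed
  then show "0 < xi2" "(1 + rho_upper) * xi2\<^sup>2 = (4 + 3 * rho_upper) * xi2 + (2 + rho_upper)"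
    using r0 req unfolding c_def by simp_all
qed

section \<open>The ratio conditions without denominators\<close>

lemma ratio_lower_iff:
  fixes x y :: real
  assumes "0 < x" "0 < y"
  shows "1 / (x\<^sup>2 * (1 + x)) - 3 \<le> 1 / y \<longleftrightarrow> y * (1 - 3 * x\<^sup>2 * (1 + x)) \<le> x\<^sup>2 * (1 + x)"
proof -
  define z where "z = x\<^sup>2 * (1 + x)"
  have z: "0 < z" using assms by (simp add: z_def)
  have "1 / z - 3 \<le> 1 / y \<longleftrightarrow> y * (1 - 3 * z) \<le> z"
    using z assms(2) by (simp add: field_simps)
  then show ?thesis by (simp add: z_def mult.assoc)
qed

lemma ratio_upper_iff:
  fixes x y :: real
  assumes "0 < x" "0 < y"
  shows "0 \<le> 1 + 1 / (1 + y) + 2 * x / (1 + x) - x\<^sup>2 / (1 + x) \<longleftrightarrow> y * (x\<^sup>2 - 3 * x - 1) \<le> - x\<^sup>2 + 4 * x + 2"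
proof -
  have "1 + 1 / (1 + y) + 2 * x / (1 + x) - x\<^sup>2 / (1 + x)
      = ((1 + x) * (1 + y) + (1 + x) + 2 * x * (1 + y) - x\<^sup>2 * (1 + y)) / ((1 + x) * (1 + y))"
    using assms by (simp add: divide_simps) (simp add: algebra_simps)
  moreover have "0 < (1 + x) * (1 + y)" using assms by simp
  ultimately show ?thesis by (simp add: zero_le_divide_iff algebra_simps)
qed

text \<open>Equality holds at \<open>x = r\<close>, \<open>y = c\<close>; raising \<open>x\<close>
  or lowering \<open>y\<close> helps as long as the bracket is nonnegative, and otherwise the
  left-hand side is at most 0.\<close>

lemma ratio_lower_of_root:
  fixes x y r c :: real
  assumes r: "0 < r" "0 < 1 - 3 * r\<^sup>2 * (1 + r)" "r\<^sup>2 * (1 + r) = c * (1 - 3 * r\<^sup>2 * (1 + r))"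
    and x: "r \<le> x" and y: "0 < y" "y \<le> c"
  shows "y * (1 - 3 * x\<^sup>2 * (1 + x)) \<le> x\<^sup>2 * (1 + x)"
proof (cases "0 \<le> 1 - 3 * x\<^sup>2 * (1 + x)")
  case True
  have le: "r\<^sup>2 * (1 + r) \<le> x\<^sup>2 * (1 + x)" using r x by (intro mult_mono power_mono) auto
  have "y * (1 - 3 * x\<^sup>2 * (1 + x)) \<le> c * (1 - 3 * r\<^sup>2 * (1 + r))"
    using True y le by (intro mult_mono) (auto simp: mult.assoc)
  then show ?thesis using r(3) le by linarith
next
  case False
  then have "y * (1 - 3 * x\<^sup>2 * (1 + x)) \<le> 0" using y by (simp add: mult_le_0_iff)
  also have "0 \<le> x\<^sup>2 * (1 + x)" using r x by simp
  finally show ?thesis .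
qed

text \<open>The second root is \<open>- s / (p * r)\<close>; multiplying by \<open>r\<close> gives
  the factorization without fractions.\<close>

lemma quadratic_le_below_root:
  fixes p q s r x :: real
  assumes "0 < p" "0 < s" "0 < r" "p * r\<^sup>2 = q * r + s" "0 \<le> x" "x \<le> r"
  shows "p * x\<^sup>2 \<le> q * x + s"
proof -
  have "r * (q * x + s - p * x\<^sup>2) = (r - x) * (s + p * r * x)"
  proof -
    have "r * (q * x + s - p * x\<^sup>2) = (q * r + s) * x - s * x + r * s - p * r * x\<^sup>2"
      by (simp add: algebra_simps)
    also have "\<dots> = p * r\<^sup>2 * x - s * x + r * s - p * r * x\<^sup>2" using assms(4) by simp
    also have "\<dots> = (r - x) * (s + p * r * x)" by (simp add: algebra_simps power2_eq_square)
    finally show ?thesis .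
  qed
  also have "\<dots> \<ge> 0" using assms by (intro mult_nonneg_nonneg add_nonneg_nonneg) auto
  finally show ?thesis using assms(3) by (simp add: zero_le_mult_iff)
qed

lemma quadratic_gt_above_root:
  fixes p q s r x :: real
  assumes "0 < p" "0 < s" "0 < r" "p * r\<^sup>2 = q * r + s" "r < x"
  shows "q * x + s < p * x\<^sup>2"
proof -
  have "r * (q * x + s - p * x\<^sup>2) = (q * r + s) * x - s * x + r * s - p * r * x\<^sup>2"
    by (simp add: algebra_simps)
  also have "\<dots> = p * r\<^sup>2 * x - s * x + r * s - p * r * x\<^sup>2" using assms(4) by simp
  also have "\<dots> = (r - x) * (s + p * r * x)" by (simp add: algebra_simps power2_eq_square)
  also have "\<dots> < 0" using assms by (intro mult_neg_pos add_pos_nonneg mult_nonneg_nonneg) auto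
  finally show ?thesis using assms(3) by (simp add: mult_less_0_iff)
qed

text \<open>\<open>rho_R\<close> is the positive fixed point of (- x^2 + 4 x + 2) / (x^2 - 3 x - 1)
  and so acts as \<open>xi2\<close> and \<open>rho_upper\<close> at once, while \<open>rho_L\<close>
  acts as \<open>xi1\<close>. Every ratio is then of the middle kind, and no induction along the
  mesh is necessary.\<close>

lemma admissible_mesh_of_simple_condition:
  assumes mesh: "mesh t" and \<alpha>: "0 < \<alpha>" "\<alpha> < 1" and cond: "simple_mesh_ratio_condition (step_ratio t)"
  shows "admissible_mesh t \<alpha>"
proof -
  interpret caputo_mesh t \<alpha> by standard (use mesh \<alpha> in auto)
  have R: "0 < rho_R" "rho_R\<^sup>2 = 3 * rho_R + 2"
  proof -
    show "0 < rho_R" by (simp add: rho_R_def add_pos_nonneg)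
    have "(sqrt 17)\<^sup>2 = (17::real)" by simp
    then show "rho_R\<^sup>2 = 3 * rho_R + 2"
      unfolding rho_R_def by (simp add: power2_eq_square field_simps)
  qed
  note L = the_lower_root[OF R(1), folded rho_L_def]
  have b: "rho_L \<le> \<rho> k" "\<rho> k \<le> rho_R" "0 < \<rho> k" if "2 \<le> k" for k
    using cond that L(1) by (auto simp: simple_mesh_ratio_condition_def intro: step_ratio_pos)
  have q: "(\<rho> k)\<^sup>2 \<le> 3 * \<rho> k + 2" if "2 \<le> k" for k
    using quadratic_le_below_root[of 1 2 rho_R 3 "\<rho> k"] R b[OF that] by simp
  have upper: "0 \<le> 1 + 1 / (1 + \<rho> (Suc k)) + 2 * \<rho> k / (1 + \<rho> k) - (\<rho> k)\<^sup>2 / (1 + \<rho> k)" if k: "2 \<le> k" for k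
  proof -
    define x y where "x = \<rho> k" and "y = \<rho> (Suc k)"
    have xy: "0 < x" "0 < y" "y \<le> rho_R" "x\<^sup>2 \<le> 3 * x + 2" "x \<le> rho_R"
      using b[of k] b[of "Suc k"] q k by (auto simp: x_def y_def)
    have "y * (x\<^sup>2 - 3 * x - 1) \<le> - x\<^sup>2 + 4 * x + 2"
    proof (cases "1 \<le> x\<^sup>2 - 3 * x")
      case True
      then have "y * (x\<^sup>2 - 3 * x - 1) \<le> rho_R * (x\<^sup>2 - 3 * x - 1)"
        using xy by (intro mult_right_mono) auto
      moreover have "(1 + rho_R) * rho_R\<^sup>2 = (4 + 3 * rho_R) * rho_R + (2 + rho_R)"
        using R(2) by (simp add: power2_eq_square algebra_simps)
      then have "(1 + rho_R) * x\<^sup>2 \<le> (4 + 3 * rho_R) * x + (2 + rho_R)"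
        using R(1) xy by (intro quadratic_le_below_root[of _ _ rho_R]) auto
      ultimately show ?thesis by (simp add: algebra_simps)
    next
      case False
      then have "y * (x\<^sup>2 - 3 * x - 1) \<le> 0" using xy by (simp add: mult_le_0_iff)
      then show ?thesis using False xy by linarith
    qed
    then show ?thesis using ratio_upper_iff[OF xy(1,2)] by (simp add: x_def y_def)
  qed
  show ?thesis
  proof (unfold_locales)
    show "1 / ((\<rho> k)\<^sup>2 * (1 + \<rho> k)) - 3 \<le> 1 / \<rho> (Suc k)" if "2 \<le> k" for k
      using ratio_lower_of_root[OF L, of "\<rho> k" "\<rho> (Suc k)"] b[of k] b[of "Suc k"] that
      by (subst ratio_lower_iff) auto
    show "0 \<le> 1 + 1 / (1 + \<rho> (Suc k)) + 2 * \<rho> k / (1 + \<rho> k) - (\<rho> k)\<^sup>2 / (1 + \<rho> k)" if "3 \<le> k" for k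
      using upper[of k] that by simp
    show "(\<rho> k)\<^sup>2 \<le> 4 * \<rho> k + 2" if "3 \<le> k" for k
      using q[of k] b(3)[of k] that by simp
    define x y where "x = \<rho> 2" and "y = \<rho> 3"
    have x: "0 < x" using b[of 2] by (simp add: x_def)
    \<comment> \<open>\<open>upper\<close> already holds at \<open>k = 2\<close>; bounding
      \<open>x / (1 + x)\<close> by 2 turns it into the condition on the leading block.\<close>
    have "x ^ 3 / (1 + x)\<^sup>2 = x\<^sup>2 / (1 + x) * (x / (1 + x))"
      by (simp add: power2_eq_square power3_eq_cube)
    also have "\<dots> \<le> x\<^sup>2 / (1 + x) * 2" using x by (intro mult_left_mono) (auto simp: field_simps)
    also have "\<dots> \<le> 2 * (1 + 1 / (1 + y) + 2 * x / (1 + x))"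
    proof -
      have "x\<^sup>2 / (1 + x) \<le> 1 + 1 / (1 + y) + 2 * x / (1 + x)" using upper[of 2] by (simp add: x_def y_def)
      then have "x\<^sup>2 / (1 + x) * 2 \<le> (1 + 1 / (1 + y) + 2 * x / (1 + x)) * 2" by (rule mult_right_mono) simp
      then show ?thesis by (simp only: mult.commute)
    qed
    finally show "0 \<le> 2 + 2 / (1 + \<rho> 3) + 4 * \<rho> 2 / (1 + \<rho> 2) - \<rho> 2 ^ 3 / (1 + \<rho> 2)\<^sup>2"
      by (simp add: x_def y_def)
  qed
qed

text \<open>After a small or a large ratio, the next one is not explicitly required to stay below
  \<open>rho_upper\<close>. It does because both bounding functions take this value at
  \<open>xi1\<close> and \<open>xi2\<close> and are smaller beyond. An induction thus carries the
  open interval along and yields the two polynomial inequalities on the way.\<close>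

lemma admissible_mesh_of_ratio_condition:
  assumes mesh: "mesh t" and \<alpha>: "0 < \<alpha>" "\<alpha> < 1" and cond: "mesh_ratio_condition (step_ratio t)"
  shows "admissible_mesh t \<alpha>"
proof -
  interpret caputo_mesh t \<alpha> by standard (use mesh \<alpha> in auto)
  note U = rho_upper_props and X = xi2_props
  note L = the_lower_root[OF U(1), folded xi1_def]
  have xi1: "xi1 < 1"
  proof (rule ccontr)
    assume "\<not> xi1 < 1"
    then have "1 * 1 \<le> xi1\<^sup>2 * (1 + xi1)" by (intro mult_mono) auto
    then show False using L(2) by (simp add: mult.assoc)
  qed
  have den: "0 < xi2\<^sup>2 - 3 * xi2 - 1"
  proof (rule ccontr)
    assume n: "\<not> 0 < xi2\<^sup>2 - 3 * xi2 - 1"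
    then have "rho_upper * (xi2\<^sup>2 - 3 * xi2 - 1) \<le> 0" using U(1) by (simp add: mult_le_0_iff)
    moreover have "rho_upper * (xi2\<^sup>2 - 3 * xi2 - 1) = - (xi2\<^sup>2 - 3 * xi2 - 1) + xi2 + 1"
      using X(2) by (simp add: algebra_simps)
    ultimately show False using n X(1) by linarith
  qed
  have step: "rho_lower < \<rho> (Suc k) \<and> \<rho> (Suc k) < rho_upper
      \<and> \<rho> (Suc k) * (1 - 3 * (\<rho> k)\<^sup>2 * (1 + \<rho> k)) \<le> (\<rho> k)\<^sup>2 * (1 + \<rho> k)
      \<and> \<rho> (Suc k) * ((\<rho> k)\<^sup>2 - 3 * \<rho> k - 1) \<le> - (\<rho> k)\<^sup>2 + 4 * \<rho> k + 2"
    if k: "3 \<le> k" and bk: "rho_lower < \<rho> k" "\<rho> k < rho_upper" for k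
  proof -
    define x y where "x = \<rho> k" and "y = \<rho> (Suc k)"
    have x: "0 < x" and y: "0 < y" using step_ratio_pos[of k] step_ratio_pos[of "Suc k"] k by (auto simp: x_def y_def)
    have c: "(rho_lower < x \<and> x < xi1 \<longrightarrow> rho_lower < y \<and> y \<le> x\<^sup>2 * (1 + x) / (1 - 3 * x\<^sup>2 * (1 + x))) \<and>
        (xi1 \<le> x \<and> x \<le> xi2 \<longrightarrow> rho_lower < y \<and> y < rho_upper) \<and>
        (xi2 < x \<and> x < rho_upper \<longrightarrow> rho_lower < y \<and> y \<le> (- x\<^sup>2 + 4 * x + 2) / (x\<^sup>2 - 3 * x - 1))"
      using cond k unfolding mesh_ratio_condition_def x_def y_def by simp
    have bx: "rho_lower < x" "x < rho_upper" using bk by (auto simp: x_def)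
    consider "x < xi1" | "xi1 \<le> x" "x \<le> xi2" | "xi2 < x" by linarith
    then have "rho_lower < y \<and> y < rho_upper \<and> y * (1 - 3 * x\<^sup>2 * (1 + x)) \<le> x\<^sup>2 * (1 + x)
      \<and> y * (x\<^sup>2 - 3 * x - 1) \<le> - x\<^sup>2 + 4 * x + 2"
    proof cases
      case 1
      then have yl: "rho_lower < y" "y \<le> x\<^sup>2 * (1 + x) / (1 - 3 * x\<^sup>2 * (1 + x))" using c bx by auto
      have lt: "x\<^sup>2 * (1 + x) < xi1\<^sup>2 * (1 + xi1)" using cubic_strict_mono[OF x 1] .
      then have d: "1 - 3 * xi1\<^sup>2 * (1 + xi1) < 1 - 3 * x\<^sup>2 * (1 + x)" by (simp add: mult.assoc)
      then have dpos: "0 < 1 - 3 * x\<^sup>2 * (1 + x)" using L(2) by linarith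
      have lower: "y * (1 - 3 * x\<^sup>2 * (1 + x)) \<le> x\<^sup>2 * (1 + x)"
        using yl(2) by (simp add: pos_le_divide_eq[OF dpos])
      also have "\<dots> < rho_upper * (1 - 3 * xi1\<^sup>2 * (1 + xi1))" using lt L(3) by linarith
      also have "\<dots> \<le> rho_upper * (1 - 3 * x\<^sup>2 * (1 + x))" using d U(1) by (intro mult_left_mono) auto
      finally have "y < rho_upper" using dpos by (simp add: mult_less_cancel_right)
      moreover have "y * (x\<^sup>2 - 3 * x - 1) \<le> - x\<^sup>2 + 4 * x + 2"
      proof -
        have "x\<^sup>2 \<le> x" using x 1 xi1 by (simp add: power2_eq_square mult_left_le)
        then have "y * (x\<^sup>2 - 3 * x - 1) \<le> 0" using x y by (simp add: mult_le_0_iff)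
        then show ?thesis using \<open>x\<^sup>2 \<le> x\<close> x by linarith
      qed
      ultimately show ?thesis using yl lower by blast
    next
      case 2
      then have yb: "rho_lower < y" "y < rho_upper" using c by auto
      have "y * (x\<^sup>2 - 3 * x - 1) \<le> - x\<^sup>2 + 4 * x + 2"
      proof (cases "0 \<le> x\<^sup>2 - 3 * x - 1")
        case True
        then have "y * (x\<^sup>2 - 3 * x - 1) \<le> rho_upper * (x\<^sup>2 - 3 * x - 1)"
          using yb by (intro mult_right_mono) auto
        also have "\<dots> \<le> - x\<^sup>2 + 4 * x + 2"
          using quadratic_le_below_root[OF _ _ X, of x] U(1) x 2 by (simp add: algebra_simps)
        finally show ?thesis .
      next
        case False
        then have "y * (x\<^sup>2 - 3 * x - 1) \<le> 0" using y by (simp add: mult_le_0_iff)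
        then show ?thesis using False x by linarith
      qed
      then show ?thesis using yb ratio_lower_of_root[OF L 2(1) y] by auto
    next
      case 3
      then have yl: "rho_lower < y" "y \<le> (- x\<^sup>2 + 4 * x + 2) / (x\<^sup>2 - 3 * x - 1)" using c bx by auto
      have "xi2 * (xi2 - 3) \<le> x * (x - 3)"
      proof -
        have "0 < xi2 * (xi2 - 3)" using den by (simp add: power2_eq_square algebra_simps)
        then have "3 < xi2" using X(1) by (simp add: zero_less_mult_iff)
        then show ?thesis using 3 by (intro mult_mono) auto
      qed
      then have d: "0 < x\<^sup>2 - 3 * x - 1" using den by (simp add: power2_eq_square algebra_simps)
      have upper: "y * (x\<^sup>2 - 3 * x - 1) \<le> - x\<^sup>2 + 4 * x + 2"
        using yl(2) by (simp add: pos_le_divide_eq[OF d])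
      also have "\<dots> < rho_upper * (x\<^sup>2 - 3 * x - 1)"
        using quadratic_gt_above_root[OF _ _ X 3] U(1) by (simp add: algebra_simps)
      finally have "y < rho_upper" using d by (simp add: mult_less_cancel_right)
      moreover have "y * (1 - 3 * x\<^sup>2 * (1 + x)) \<le> x\<^sup>2 * (1 + x)"
      proof -
        have "0 < x * (x - 3)" using d by (simp add: power2_eq_square algebra_simps)
        then have "3 < x" using x by (simp add: zero_less_mult_iff)
        then have "1 * 1 \<le> x\<^sup>2 * (1 + x)" by (intro mult_mono) auto
        then have "y * (1 - 3 * x\<^sup>2 * (1 + x)) \<le> 0" using y by (simp add: mult_le_0_iff mult.assoc)
        then show ?thesis using x by (smt (verit) mult_nonneg_nonneg zero_le_power2)
      qed
      ultimately show ?thesis using yl upper by blast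
    qed
    then show ?thesis unfolding x_def y_def .
  qed
  have bounds: "rho_lower < \<rho> k \<and> \<rho> k < rho_upper" if "3 \<le> k" for k
    using that
  proof (induction k rule: nat_induct_at_least)
    case base
    then show ?case using cond by (simp add: mesh_ratio_condition_def)
  next
    case (Suc k)
    then show ?case using step[of k] by blast
  qed
  show ?thesis
  proof (unfold_locales)
    show "1 / ((\<rho> k)\<^sup>2 * (1 + \<rho> k)) - 3 \<le> 1 / \<rho> (Suc k)" if k: "2 \<le> k" for k
    proof (cases "k = 2")
      case True
      then show ?thesis using cond by (simp add: mesh_ratio_condition_def)
    next
      case False
      then show ?thesis
        using step[of k] bounds[of k] k step_ratio_pos[of k] step_ratio_pos[of "Suc k"]
        by (subst ratio_lower_iff) auto
    qed
    show "0 \<le> 1 + 1 / (1 + \<rho> (Suc k)) + 2 * \<rho> k / (1 + \<rho> k) - (\<rho> k)\<^sup>2 / (1 + \<rho> k)" if "3 \<le> k" for k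
      using step[of k] bounds[of k] that step_ratio_pos[of k] step_ratio_pos[of "Suc k"]
      by (subst ratio_upper_iff) auto
    show "(\<rho> k)\<^sup>2 \<le> 4 * \<rho> k + 2" if k: "3 \<le> k" for k
    proof -
      have "0 < \<rho> k" "\<rho> k < rho_upper" using bounds[OF k] step_ratio_pos[of k] k by auto
      then have "\<rho> k * (\<rho> k - 4) \<le> 2"
      proof (cases "4 \<le> \<rho> k")
        case True
        then have "\<rho> k * (\<rho> k - 4) \<le> rho_upper * (rho_upper - 4)"
          using \<open>\<rho> k < rho_upper\<close> by (intro mult_mono) auto
        then show ?thesis using U(2) by (simp add: power2_eq_square algebra_simps)
      next
        case False
        then have "\<rho> k * (\<rho> k - 4) \<le> 0" using \<open>0 < \<rho> k\<close> by (simp add: mult_le_0_iff)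
        then show ?thesis by simp
      qed
      then show ?thesis by (simp add: power2_eq_square algebra_simps)
    qed
    show "0 \<le> 2 + 2 / (1 + \<rho> 3) + 4 * \<rho> 2 / (1 + \<rho> 2) - \<rho> 2 ^ 3 / (1 + \<rho> 2)\<^sup>2"
      using cond by (simp add: mesh_ratio_condition_def)
  qed
qed

section \<open>The energy estimate\<close>

lemma (in caputo_mesh) L2_op_square_integrable:
  assumes u: "\<And>j. u j square_integrable_on \<Omega>" and k: "1 \<le> k"
  shows "(\<lambda>x. L2_op \<alpha> t (\<lambda>i. u i x) k) square_integrable_on \<Omega>"
proof -
  define c where "c j = cell_weight t j (kernel k)" for j
  define e where "e = kappa k / (1 + \<rho> (Suc k)) + correction k"
  have G: "Gamma (1 - \<alpha>) \<noteq> 0" using \<alpha> by (intro less_imp_neq[symmetric] Gamma_real_pos) auto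
  have "L2_op \<alpha> t (\<lambda>i. u i x) k = 1 / Gamma (1 - \<alpha>) *
      ((\<Sum>j=1..k. c j * (u j x - u (j - 1) x)) + e * (u k x - u (k - 1) x)
        - \<rho> k * correction k * (u (k - 1) x - u (k - 2) x))" for x
    using L2_op_eq[OF k, of "\<lambda>i. u i x"] G unfolding c_def e_def by (simp add: field_simps)
  moreover have "(\<lambda>x. 1 / Gamma (1 - \<alpha>) *
      ((\<Sum>j=1..k. c j * (u j x - u (j - 1) x)) + e * (u k x - u (k - 1) x)
        - \<rho> k * correction k * (u (k - 1) x - u (k - 2) x))) square_integrable_on \<Omega>"
    by (intro square_integrable_cmult square_integrable_diff square_integrable_add square_integrable_sum u)
  ultimately show ?thesis by simp
qed

lemma (in admissible_mesh) L2_op_energy_nonneg: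
  assumes u: "\<And>j. u j square_integrable_on \<Omega>"
  shows "0 \<le> (\<Sum>k=1..n. L2_inner \<Omega> (\<lambda>x. L2_op \<alpha> t (\<lambda>i. u i x) k) (\<lambda>x. u k x - u (k - 1) x))"
proof -
  have "integrable (lebesgue_on \<Omega>) (\<lambda>x. L2_op \<alpha> t (\<lambda>i. u i x) k \<bullet> (u k x - u (k - 1) x))" if "k \<in> {1..n}" for k
    using that by (intro L2_inner_integrable L2_op_square_integrable square_integrable_diff u) auto
  then have "(\<Sum>k=1..n. L2_inner \<Omega> (\<lambda>x. L2_op \<alpha> t (\<lambda>i. u i x) k) (\<lambda>x. u k x - u (k - 1) x))
      = (\<integral>x. (\<Sum>k=1..n. L2_op \<alpha> t (\<lambda>i. u i x) k \<bullet> (u k x - u (k - 1) x)) \<partial>lebesgue_on \<Omega>)"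
    unfolding L2_inner_def by (rule Bochner_Integration.integral_sum[symmetric])
  also have "\<dots> \<ge> 0"
  proof (rule Bochner_Integration.integral_nonneg)
    show "0 \<le> (\<Sum>k=1..n. L2_op \<alpha> t (\<lambda>i. u i x) k \<bullet> (u k x - u (k - 1) x))" for x
      using L2_op_increment_form_nonneg[of "\<lambda>i. u i x" n] by simp
  qed
  finally show ?thesis .
qed

lemma sum_by_parts_L2_inner:
  fixes n :: nat
  assumes f: "\<And>k. f k square_integrable_on \<Omega>" and u: "\<And>k. u k square_integrable_on \<Omega>"
  shows "(\<Sum>k=1..n. L2_inner \<Omega> (f k) (\<lambda>x. u k x - u (k - 1) x))
    = L2_inner \<Omega> (f n) (u n) - L2_inner \<Omega> (f 0) (u 0)
      - (\<Sum>k=1..n. L2_inner \<Omega> (\<lambda>x. f k x - f (k - 1) x) (u (k - 1)))"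
proof (induction n)
  case (Suc n)
  have "L2_inner \<Omega> (f (Suc n)) (\<lambda>x. u (Suc n) x - u n x) = L2_inner \<Omega> (f (Suc n)) (u (Suc n)) - L2_inner \<Omega> (f (Suc n)) (u n)"
    by (rule L2_inner_diff_right[OF u u f])
  moreover have "L2_inner \<Omega> (\<lambda>x. f (Suc n) x - f n x) (u n) = L2_inner \<Omega> (f (Suc n)) (u n) - L2_inner \<Omega> (f n) (u n)"
    by (rule L2_inner_diff_left[OF f f u])
  ultimately show ?case using Suc by simp
qed simp

text \<open>If \<open>M\<close> exceeded \<open>G + 2 * K\<close>, then M^2 would exceed G M + 2 K
  M, which is at least G^2 + 2 K M.\<close>

lemma le_of_square_le:
  fixes M G K :: real
  assumes "M\<^sup>2 \<le> G\<^sup>2 + 2 * K * M" "G \<le> M" "0 \<le> G" "0 \<le> K"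
  shows "M \<le> G + 2 * K"
proof (rule ccontr)
  assume "\<not> M \<le> G + 2 * K"
  then have "G + 2 * K < M" "0 < M" using assms by auto
  then have "(G + 2 * K) * M < M * M" by (intro mult_strict_right_mono)
  moreover have "G * G \<le> G * M" using assms by (intro mult_left_mono)
  ultimately show False using assms(1) by (simp add: power2_eq_square algebra_simps)
qed

text \<open>Summation by parts in time brings in every \<open>u k\<close> up to \<open>n\<close>, so
  a common bound \<open>M\<close> for their gradients appears on the right instead of the gradient
  at level \<open>n\<close> alone.\<close>

lemma gradient_energy_bound:
  assumes \<Omega>: "open \<Omega>" and adm: "admissible_mesh t \<alpha>"
    and C: "sobolev_embedding_constant \<Omega> C"
    and f: "\<And>s. 0 \<le> s \<Longrightarrow> f s square_integrable_on \<Omega>" "\<And>s. 0 \<le> s \<Longrightarrow> L2_norm \<Omega> (f s) \<le> B"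
    and V: "\<And>n. (\<Sum>k=1..n. L2_norm \<Omega> (\<lambda>x. f (t k) x - f (t (k - 1)) x)) \<le> V"
    and u0: "u 0 \<in> H10 \<Omega>" and sol: "L2_scheme_solution \<alpha> \<Omega> f t u"
    and M: "\<And>k. k \<le> n \<Longrightarrow> L2_norm \<Omega> (weak_gradient \<Omega> (u k)) \<le> M"
  shows "(L2_norm \<Omega> (weak_gradient \<Omega> (u n)))\<^sup>2 \<le> (L2_norm \<Omega> (weak_gradient \<Omega> (u 0)))\<^sup>2 + 2 * ((2 * B + V) * C) * M"
proof -
  interpret admissible_mesh t \<alpha> by (rule adm)
  define g where "g k = weak_gradient \<Omega> (u k)" for k
  define G where "G k = L2_norm \<Omega> (g k)" for k
  define d where "d k = (\<lambda>x. u k x - u (k - 1) x)" for k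
  have H: "u k \<in> H10 \<Omega>" for k
    using u0 sol by (cases k) (auto simp: L2_scheme_solution_def)
  note H1 = H10_imp_H1[OF H]
  have sq: "u k square_integrable_on \<Omega>" "g k square_integrable_on \<Omega>" for k
    unfolding g_def by (rule H1_square_integrable[OF H1])+
  have t0: "0 \<le> t k" for k using mesh_le[of 0 k] mesh by (simp add: mesh_def)
  have fsq: "f (t k) square_integrable_on \<Omega>" for k by (rule f(1)[OF t0])
  have C0: "0 \<le> C" and Cu: "L2_norm \<Omega> (u k) \<le> C * G k" for k
    using C H unfolding sobolev_embedding_constant_def G_def g_def by blast+
  have uM: "L2_norm \<Omega> (u k) \<le> C * M" if "k \<le> n" for k
    using Cu[of k] mult_left_mono[OF M[OF that] C0] unfolding G_def g_def by linarith
  have B0: "0 \<le> B" by (rule order_trans[OF L2_norm_nonneg f(2)[OF order_refl]])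
  have CM: "0 \<le> C * M" by (rule order_trans[OF L2_norm_nonneg uM[of 0]]) simp
  have bound: "\<bar>L2_inner \<Omega> v (u k)\<bar> \<le> L2_norm \<Omega> v * (C * M)" if "v square_integrable_on \<Omega>" "k \<le> n" for v k
    using L2_Cauchy_Schwarz[OF that(1) sq(1)[of k]] mult_left_mono[OF uM[OF that(2)] L2_norm_nonneg[of \<Omega> v]] by linarith
  have step: "L2_inner \<Omega> (\<lambda>x. L2_op \<alpha> t (\<lambda>i. u i x) k) (d k)
      \<le> ((G (k - 1))\<^sup>2 - (G k)\<^sup>2) / 2 + L2_inner \<Omega> (f (t k)) (d k)" if k: "1 \<le> k" for k
  proof -
    have "d k \<in> H10 \<Omega>" unfolding d_def by (rule H10_diff[OF \<Omega> H H])
    then have "L2_inner \<Omega> (\<lambda>x. L2_op \<alpha> t (\<lambda>i. u i x) k) (d k)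
        = - L2_inner \<Omega> (g k) (weak_gradient \<Omega> (d k)) + L2_inner \<Omega> (f (t k)) (d k)"
      using sol k unfolding L2_scheme_solution_def g_def by blast
    moreover have "L2_inner \<Omega> (g k) (weak_gradient \<Omega> (d k)) = (G k)\<^sup>2 - L2_inner \<Omega> (g k) (g (k - 1))"
      unfolding d_def G_def L2_inner_self[symmetric] g_def[of k] g_def[of "k - 1"]
      by (rule L2_inner_weak_gradient_diff[OF \<Omega> H1 H1 H1_square_integrable(2)[OF H1]])
    moreover have "L2_inner \<Omega> (g k) (g (k - 1)) \<le> ((G k)\<^sup>2 + (G (k - 1))\<^sup>2) / 2"
    proof -
      have "0 \<le> (G k - G (k - 1))\<^sup>2" by simp
      then have "G k * G (k - 1) \<le> ((G k)\<^sup>2 + (G (k - 1))\<^sup>2) / 2" by (simp add: power2_diff)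
      moreover have "L2_inner \<Omega> (g k) (g (k - 1)) \<le> G k * G (k - 1)"
        using L2_Cauchy_Schwarz[OF sq(2) sq(2), of k "k - 1"] unfolding G_def by linarith
      ultimately show ?thesis by linarith
    qed
    ultimately show ?thesis by (simp add: field_simps)
  qed
  have "0 \<le> (\<Sum>k=1..n. L2_inner \<Omega> (\<lambda>x. L2_op \<alpha> t (\<lambda>i. u i x) k) (d k))"
    unfolding d_def by (rule L2_op_energy_nonneg[OF sq(1)])
  also have "\<dots> \<le> (\<Sum>k=1..n. ((G (k - 1))\<^sup>2 - (G k)\<^sup>2) / 2 + L2_inner \<Omega> (f (t k)) (d k))"
    by (intro sum_mono step) auto
  also have "\<dots> = ((G 0)\<^sup>2 - (G n)\<^sup>2) / 2 + (\<Sum>k=1..n. L2_inner \<Omega> (f (t k)) (d k))"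
  proof -
    have "(\<Sum>k=1..n. ((G (k - 1))\<^sup>2 - (G k)\<^sup>2) / 2) = ((G 0)\<^sup>2 - (G n)\<^sup>2) / 2"
      by (induction n) (auto simp: field_simps)
    then show ?thesis by (simp add: sum.distrib)
  qed
  also have "(\<Sum>k=1..n. L2_inner \<Omega> (f (t k)) (d k)) \<le> (2 * B + V) * (C * M)"
  proof -
    \<comment> \<open>The value \<open>f (t 0)\<close>, which does not occur in the scheme, is
      inserted to complete the summation by parts; its boundary term accounts for the second
      \<open>B\<close>.\<close>
    have "(\<Sum>k=1..n. L2_inner \<Omega> (f (t k)) (d k)) = L2_inner \<Omega> (f (t n)) (u n) - L2_inner \<Omega> (f (t 0)) (u 0)
      - (\<Sum>k=1..n. L2_inner \<Omega> (\<lambda>x. f (t k) x - f (t (k - 1)) x) (u (k - 1)))"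
      unfolding d_def by (rule sum_by_parts_L2_inner[of "\<lambda>k. f (t k)", OF fsq sq(1)])
    moreover have "L2_inner \<Omega> (f (t n)) (u n) \<le> B * (C * M)"
      using bound[OF fsq, of n n] mult_right_mono[OF f(2)[OF t0[of n]] CM] by linarith
    moreover have "- L2_inner \<Omega> (f (t 0)) (u 0) \<le> B * (C * M)"
      using bound[OF fsq, of 0 0] mult_right_mono[OF f(2)[OF t0[of 0]] CM] by linarith
    moreover have "- (\<Sum>k=1..n. L2_inner \<Omega> (\<lambda>x. f (t k) x - f (t (k - 1)) x) (u (k - 1))) \<le> V * (C * M)"
    proof -
      have "- (\<Sum>k=1..n. L2_inner \<Omega> (\<lambda>x. f (t k) x - f (t (k - 1)) x) (u (k - 1)))
          = (\<Sum>k=1..n. - L2_inner \<Omega> (\<lambda>x. f (t k) x - f (t (k - 1)) x) (u (k - 1)))"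
        by (simp add: sum_negf)
      also have "\<dots> \<le> (\<Sum>k=1..n. L2_norm \<Omega> (\<lambda>x. f (t k) x - f (t (k - 1)) x) * (C * M))"
      proof (rule sum_mono)
        fix k assume "k \<in> {1..n}"
        then have "k - 1 \<le> n" by auto
        from bound[OF square_integrable_diff[OF fsq fsq] this, of k "k - 1"]
        show "- L2_inner \<Omega> (\<lambda>x. f (t k) x - f (t (k - 1)) x) (u (k - 1))
            \<le> L2_norm \<Omega> (\<lambda>x. f (t k) x - f (t (k - 1)) x) * (C * M)" by linarith
      qed
      also have "\<dots> = (\<Sum>k=1..n. L2_norm \<Omega> (\<lambda>x. f (t k) x - f (t (k - 1)) x)) * (C * M)"
        by (rule sum_distrib_right[symmetric])
      also have "\<dots> \<le> V * (C * M)" by (rule mult_right_mono[OF V CM])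
      finally show ?thesis .
    qed
    ultimately have "(\<Sum>k=1..n. L2_inner \<Omega> (f (t k)) (d k)) \<le> B * (C * M) + B * (C * M) + V * (C * M)"
      by linarith
    then show ?thesis by (simp add: algebra_simps)
  qed
  finally have "(G n)\<^sup>2 \<le> (G 0)\<^sup>2 + 2 * ((2 * B + V) * (C * M))" by (simp add: field_simps)
  then show ?thesis by (simp add: G_def g_def mult.assoc)
qed

theorem theorem4p1:
  fixes \<Omega> :: "'a::euclidean_space set" and f :: "real \<Rightarrow> 'a \<Rightarrow> real"
  assumes "bounded \<Omega>" and "lipschitz_domain \<Omega>"
    and "L2_bounded \<Omega> f" and "L2_bounded_variation \<Omega> f"
  shows "(\<exists>C\<^sub>\<Omega>. sobolev_embedding_constant \<Omega> C\<^sub>\<Omega>) \<and>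
    (\<exists>C\<^sub>f\<ge>0. \<forall>C\<^sub>\<Omega>. sobolev_embedding_constant \<Omega> C\<^sub>\<Omega> \<longrightarrow>
      (\<forall>(\<alpha>::real) (t::nat \<Rightarrow> real) (u::nat \<Rightarrow> 'a \<Rightarrow> real).
        0 < \<alpha> \<and> \<alpha> < 1 \<and> mesh t \<and>
        (mesh_ratio_condition (step_ratio t) \<or> simple_mesh_ratio_condition (step_ratio t)) \<and>
        u 0 \<in> H10 \<Omega> \<and> L2_scheme_solution \<alpha> \<Omega> f t u \<longrightarrow>
        (\<forall>n\<ge>1. L2_norm \<Omega> (weak_gradient \<Omega> (u n))
           \<le> L2_norm \<Omega> (weak_gradient \<Omega> (u 0)) + 2 * C\<^sub>f * C\<^sub>\<Omega>)))"
proof -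
  have \<Omega>: "open \<Omega>" using assms(2) by (simp add: lipschitz_domain_def)
  have f: "f s square_integrable_on \<Omega>" if "0 \<le> s" for s
    using assms(3) that by (simp add: L2_bounded_def)
  obtain B where B: "\<And>s. 0 \<le> s \<Longrightarrow> L2_norm \<Omega> (f s) \<le> B"
    using assms(3) unfolding L2_bounded_def bdd_above_def by auto
  obtain V where V: "(\<Sum>i=1..m. L2_norm \<Omega> (\<lambda>x. f (s i) x - f (s (i - 1)) x)) \<le> V"
    if "0 \<le> s 0" "\<forall>i<m. s i < s (Suc i)" for m :: nat and s :: "nat \<Rightarrow> real"
    using assms(4) unfolding L2_bounded_variation_def bdd_above_def by blast
  have B0: "0 \<le> B" by (rule order_trans[OF L2_norm_nonneg B[OF order_refl]])
  \<comment> \<open>The empty sum, \<open>m = 0\<close>, is among the admissible variations.\<close>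
  have V0: "0 \<le> V" using V[of "\<lambda>_. 0" 0] by simp
  \<comment> \<open>\<open>2 * B + V\<close> collects the two boundary terms and the total
    variation. As \<open>V\<close> bounds the variation over all increasing sequences, one constant
    serves every mesh and every \<alpha>.\<close>
  have "L2_norm \<Omega> (weak_gradient \<Omega> (u n)) \<le> L2_norm \<Omega> (weak_gradient \<Omega> (u 0)) + 2 * (2 * B + V) * C"
    if C: "sobolev_embedding_constant \<Omega> C" and \<alpha>: "0 < \<alpha>" "\<alpha> < 1" and t: "mesh t"
      and ratio: "mesh_ratio_condition (step_ratio t) \<or> simple_mesh_ratio_condition (step_ratio t)"
      and u0: "u 0 \<in> H10 \<Omega>" and sol: "L2_scheme_solution \<alpha> \<Omega> f t u" for C \<alpha> t and u :: "nat \<Rightarrow> 'a \<Rightarrow> real" and n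
  proof -
    have adm: "admissible_mesh t \<alpha>"
      using ratio admissible_mesh_of_ratio_condition[OF t \<alpha>] admissible_mesh_of_simple_condition[OF t \<alpha>] by blast
    have Vt: "(\<Sum>k=1..m. L2_norm \<Omega> (\<lambda>x. f (t k) x - f (t (k - 1)) x)) \<le> V" for m
      using t by (intro V) (auto simp: mesh_def strict_mono_Suc_iff)
    define G where "G k = L2_norm \<Omega> (weak_gradient \<Omega> (u k))" for k
    \<comment> \<open>The estimate is applied at the index where the maximum is attained, so that
      the same \<open>M\<close> stands on both sides and a factor \<open>M\<close> can be
      removed.\<close>
    define M where "M = Max (G ` {..n})"
    have M: "G k \<le> M" if "k \<le> n" for k
      unfolding M_def using that by (intro Max_ge) auto
    have "M \<in> G ` {..n}" unfolding M_def by (intro Max_in) auto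
    then obtain m where m: "m \<le> n" "M = G m" by auto
    have "(G m)\<^sup>2 \<le> (G 0)\<^sup>2 + 2 * ((2 * B + V) * C) * M"
      unfolding G_def
    proof (rule gradient_energy_bound[OF \<Omega> adm C f B Vt u0 sol])
      show "L2_norm \<Omega> (weak_gradient \<Omega> (u k)) \<le> M" if "k \<le> m" for k
        using M[of k] that m(1) by (simp add: G_def)
    qed
    moreover have "0 \<le> C" using C by (simp add: sobolev_embedding_constant_def)
    ultimately have "M \<le> G 0 + 2 * ((2 * B + V) * C)"
      using M[of 0] B0 V0 m(2) by (intro le_of_square_le) (simp_all add: G_def)
    then show ?thesis using M[of n] unfolding G_def mult.assoc by linarith
  qed
  moreover have "0 \<le> 2 * B + V" using B0 V0 by simp
  ultimately show ?thesis
    using sobolev_embedding_constant_exists[OF \<Omega> assms(1)] by blast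
qed

end
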